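(* Let $(R,\mathfrak m)$ be a commutative noetherian local ring that is not Gorenstein and satisfies $\mathfrak m^3=0\neq\mathfrak m^2$. Suppose $A$ is a non-zero minimal acyclic complex of finitely generated free $R$-modules. Set $$\mathcal H=\{i\in\mathbb Z\mid \mathrm H^i(A^* )=0\}$$ and consider the conditions: (i) The set $\mathcal H$ contains infinitely many positive integers. (ii) All the free modules $A_i$ ($i\in\mathbb Z$) have the same rank. (iii) For every integer $l$: if $l-1$ and $l+1$ are in $\mathcal H$, then so is $l$. Then (i) implies (ii), and (ii) implies (iii). In particular, if two out of every three consecutive integers belong to $\mathcal H$, then $\mathcal H=\mathbb Z$, i.e. $A$ is totally acyclic.
   Context: A complex $A=\cdots\to A_{i+1}\xrightarrow{\partial_{i+1}}A_i\xrightarrow{\partial_i}A_{i-1}\to\cdots$ (indexed by all $i\in\mathbb Z$) of finitely generated free $R$-modules is acyclic if all its homology modules vanish, and minimal if $\partial_i(A_i)\subseteq\mathfrak m A_{i-1}$ for all $i$. Its dual is $A^*=\operatorname{Hom}_R(A,R)$, with $A_i^*=\operatorname{Hom}_R(A_i,R)$ in cohomological degree $i$, so that $\mathrm H^i(A^* )=\operatorname{Ker}(\partial_{i+1}^* )/\operatorname{Im}(\partial_i^* )$. An acyclic complex $A$ of finitely generated free modules is totally acyclic if $A^*$ is also acyclic. *)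

theory Defs
  imports "HOL-Algebra.Algebra"
begin

section \<open>Local rings\<close>

definition local_ring :: "('a, 'r) ring_scheme \<Rightarrow> 'a set \<Rightarrow> bool" where
  "local_ring R \<mm> \<longleftrightarrow>
     cring R \<and> maximalideal \<mm> R \<and> (\<forall>J. maximalideal J R \<longrightarrow> J = \<mm>)"

section \<open>Modules and linear maps\<close>

definition linear_maps ::
  "('a, 'r) ring_scheme \<Rightarrow> ('a, 'b, 'm) module_scheme \<Rightarrow> ('a, 'c, 'n) module_scheme \<Rightarrow> ('b \<Rightarrow> 'c) set"
where
  "linear_maps R M N = {f \<in> carrier M \<rightarrow> carrier N.
     (\<forall>x\<in>carrier M. \<forall>y\<in>carrier M. f (x \<oplus>\<^bsub>M\<^esub> y) = f x \<oplus>\<^bsub>N\<^esub> f y) \<and>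
     (\<forall>a\<in>carrier R. \<forall>x\<in>carrier M. f (a \<odot>\<^bsub>M\<^esub> x) = a \<odot>\<^bsub>N\<^esub> f x)}"

definition regular_module :: "('a, 'r) ring_scheme \<Rightarrow> ('a, 'a) module" where
  "regular_module R =
     \<lparr>carrier = carrier R, monoid.mult = monoid.mult R, one = one R,
      ring.zero = ring.zero R, ring.add = ring.add R, smult = monoid.mult R\<rparr>"

definition ideal_smult ::
  "('a, 'r) ring_scheme \<Rightarrow> 'a set \<Rightarrow> ('a, 'b, 'm) module_scheme \<Rightarrow> 'b set" where
  "ideal_smult R J M =
     \<Inter>{N. submodule N R M \<and> (\<forall>a\<in>J. \<forall>x\<in>carrier M. a \<odot>\<^bsub>M\<^esub> x \<in> N)}"

definition finite_basis ::
  "('a, 'r) ring_scheme \<Rightarrow> ('a, 'b, 'm) module_scheme \<Rightarrow> 'b set \<Rightarrow> bool" where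
  "finite_basis R M B \<longleftrightarrow> finite B \<and> B \<subseteq> carrier M \<and>
     (\<forall>x\<in>carrier M. \<exists>!c. c \<in> B \<rightarrow>\<^sub>E carrier R \<and> x = (\<Oplus>\<^bsub>M\<^esub>b\<in>B. c b \<odot>\<^bsub>M\<^esub> b))"

definition fg_free :: "('a, 'r) ring_scheme \<Rightarrow> ('a, 'b, 'm) module_scheme \<Rightarrow> bool" where
  "fg_free R M \<longleftrightarrow> module R M \<and> (\<exists>B. finite_basis R M B)"

text \<open>Over a nonzero commutative ring all bases of \<open>M\<close> have the same cardinality, so the choice
  below does not matter.\<close>

definition free_rank :: "('a, 'r) ring_scheme \<Rightarrow> ('a, 'b, 'm) module_scheme \<Rightarrow> nat" where
  "free_rank R M = card (SOME B. finite_basis R M B)"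

section \<open>Injective dimension and Gorenstein rings\<close>

text \<open>A definition in HOL cannot quantify over modules on arbitrary types, so injective modules and
  injective resolutions are taken with underlying type \<open>'a list\<close>, where \<open>'a\<close> is the type of the
  ring elements. This loses nothing for a noetherian local ring \<open>R\<close>: the type contains copies of
  all ideals of \<open>R\<close>, so that by Baer's criterion \<open>injective_module\<close> has its usual meaning; and if
  \<open>R\<close> has finite injective dimension, then its minimal injective resolution is, in each degree, a
  finite or infinite direct sum of hulls \<open>E(R/p)\<close>, one for each prime \<open>p\<close> of the given height,
  which has cardinality at most that of \<open>'a list\<close>.\<close>

definition injective_module :: "('a, 'r) ring_scheme \<Rightarrow> ('a, 'a list) module \<Rightarrow> bool" where
  "injective_module R I \<longleftrightarrow> module R I \<and>
     (\<forall>(M :: ('a, 'a list) module) (N :: ('a, 'a list) module) f g.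
        module R M \<and> module R N \<and>
        f \<in> linear_maps R M N \<and> inj_on f (carrier M) \<and> g \<in> linear_maps R M I \<longrightarrow>
        (\<exists>h\<in>linear_maps R N I. \<forall>x\<in>carrier M. h (f x) = g x))"

text \<open>There is an exact sequence
  \<open>0 \<longrightarrow> M \<longrightarrow> I 0 \<longrightarrow> I 1 \<longrightarrow> \<dots> \<longrightarrow> I n \<longrightarrow> 0\<close> with all \<open>I j\<close> injective.\<close>

definition injective_dim_le ::
  "('a, 'r) ring_scheme \<Rightarrow> ('a, 'b, 'm) module_scheme \<Rightarrow> nat \<Rightarrow> bool" where
  "injective_dim_le R M n \<longleftrightarrow>
     (\<exists>(I :: nat \<Rightarrow> ('a, 'a list) module) e d.
        (\<forall>j. injective_module R (I j)) \<and>
        (\<forall>j>n. carrier (I j) = {\<zero>\<^bsub>I j\<^esub>}) \<and>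
        e \<in> linear_maps R M (I 0) \<and> inj_on e (carrier M) \<and>
        (\<forall>j. d j \<in> linear_maps R (I j) (I (Suc j))) \<and>
        e ` carrier M = a_kernel (I 0) (I 1) (d 0) \<and>
        (\<forall>j. d j ` carrier (I j) = a_kernel (I (Suc j)) (I (Suc (Suc j))) (d (Suc j))))"

definition gorenstein_local_ring :: "('a, 'r) ring_scheme \<Rightarrow> 'a set \<Rightarrow> bool" where
  "gorenstein_local_ring R \<mm> \<longleftrightarrow>
     local_ring R \<mm> \<and> noetherian_ring R \<and> (\<exists>n. injective_dim_le R (regular_module R) n)"

section \<open>Complexes of finitely generated free modules\<close>

text \<open>The differential \<open>d i\<close> goes from \<open>A i\<close> to \<open>A (i - 1)\<close>.\<close>

definition free_complex ::
  "('a, 'r) ring_scheme \<Rightarrow> (int \<Rightarrow> ('a, 'b, 'm) module_scheme) \<Rightarrow> (int \<Rightarrow> 'b \<Rightarrow> 'b) \<Rightarrow> bool" where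
  "free_complex R A d \<longleftrightarrow>
     (\<forall>i. fg_free R (A i)) \<and>
     (\<forall>i. d i \<in> linear_maps R (A i) (A (i - 1))) \<and>
     (\<forall>i. \<forall>x\<in>carrier (A (i + 1)). d i (d (i + 1) x) = \<zero>\<^bsub>A (i - 1)\<^esub>)"

text \<open>Homology \<open>Ker g / Im f\<close> at the middle term of \<open>L \<longrightarrow> M \<longrightarrow> N\<close>, as an additive
  group; this suffices, since it is only ever asked whether the homology vanishes.\<close>

definition homology_at ::
  "('a, 'b, 'l) module_scheme \<Rightarrow> ('a, 'c, 'm) module_scheme \<Rightarrow> ('a, 'd, 'n) module_scheme \<Rightarrow>
   ('b \<Rightarrow> 'c) \<Rightarrow> ('c \<Rightarrow> 'd) \<Rightarrow> 'c set monoid" where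
  "homology_at L M N f g = (add_monoid M)\<lparr>carrier := a_kernel M N g\<rparr> Mod (f ` carrier L)"

definition homology ::
  "(int \<Rightarrow> ('a, 'b, 'm) module_scheme) \<Rightarrow> (int \<Rightarrow> 'b \<Rightarrow> 'b) \<Rightarrow> int \<Rightarrow> 'b set monoid" where
  "homology A d i = homology_at (A (i + 1)) (A i) (A (i - 1)) (d (i + 1)) (d i)"

definition acyclic_complex ::
  "(int \<Rightarrow> ('a, 'b, 'm) module_scheme) \<Rightarrow> (int \<Rightarrow> 'b \<Rightarrow> 'b) \<Rightarrow> bool" where
  "acyclic_complex A d \<longleftrightarrow> (\<forall>i. trivial_group (homology A d i))"

definition minimal_complex ::
  "('a, 'r) ring_scheme \<Rightarrow> 'a set \<Rightarrow> (int \<Rightarrow> ('a, 'b, 'm) module_scheme) \<Rightarrow> (int \<Rightarrow> 'b \<Rightarrow> 'b) \<Rightarrow> bool"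
where
  "minimal_complex R \<mm> A d \<longleftrightarrow> (\<forall>i. d i ` carrier (A i) \<subseteq> ideal_smult R \<mm> (A (i - 1)))"

definition nonzero_complex :: "(int \<Rightarrow> ('a, 'b, 'm) module_scheme) \<Rightarrow> bool" where
  "nonzero_complex A \<longleftrightarrow> (\<exists>i. carrier (A i) \<noteq> {\<zero>\<^bsub>A i\<^esub>})"

section \<open>The dual complex\<close>

text \<open>Elements of the dual are represented by functions that are \<open>undefined\<close> outside the carrier
  of \<open>M\<close>, so that equality of functions is equality of linear maps. The ring operations \<open>mult\<close>
  and \<open>one\<close> of the record play no role for modules.\<close>

definition dual_module ::
  "('a, 'r) ring_scheme \<Rightarrow> ('a, 'b, 'm) module_scheme \<Rightarrow> ('a, 'b \<Rightarrow> 'a) module" where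
  "dual_module R M =
     \<lparr>carrier = linear_maps R M (regular_module R) \<inter> extensional (carrier M),
      monoid.mult = undefined,
      one = undefined,
      ring.zero = (\<lambda>x\<in>carrier M. \<zero>\<^bsub>R\<^esub>),
      ring.add = (\<lambda>f g. \<lambda>x\<in>carrier M. f x \<oplus>\<^bsub>R\<^esub> g x),
      smult = (\<lambda>a f. \<lambda>x\<in>carrier M. a \<otimes>\<^bsub>R\<^esub> f x)\<rparr>"

text \<open>For \<open>u : M \<longrightarrow> N\<close> this is \<open>Hom(N, R) \<longrightarrow> Hom(M, R), f \<mapsto> f \<circ> u\<close>.\<close>

definition dual_map :: "('a, 'b, 'm) module_scheme \<Rightarrow> ('b \<Rightarrow> 'c) \<Rightarrow> ('c \<Rightarrow> 'a) \<Rightarrow> ('b \<Rightarrow> 'a)" where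
  "dual_map M u f = compose (carrier M) f u"

definition dual_cohomology ::
  "('a, 'r) ring_scheme \<Rightarrow> (int \<Rightarrow> ('a, 'b, 'm) module_scheme) \<Rightarrow> (int \<Rightarrow> 'b \<Rightarrow> 'b) \<Rightarrow> int \<Rightarrow>
   ('b \<Rightarrow> 'a) set monoid" where
  "dual_cohomology R A d i =
     homology_at (dual_module R (A (i - 1))) (dual_module R (A i)) (dual_module R (A (i + 1)))
       (dual_map (A i) (d i)) (dual_map (A (i + 1)) (d (i + 1)))"

definition vanishing_degrees ::
  "('a, 'r) ring_scheme \<Rightarrow> (int \<Rightarrow> ('a, 'b, 'm) module_scheme) \<Rightarrow> (int \<Rightarrow> 'b \<Rightarrow> 'b) \<Rightarrow> int set" where
  "vanishing_degrees R A d = {i. trivial_group (dual_cohomology R A d i)}"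

definition totally_acyclic ::
  "('a, 'r) ring_scheme \<Rightarrow> (int \<Rightarrow> ('a, 'b, 'm) module_scheme) \<Rightarrow> (int \<Rightarrow> 'b \<Rightarrow> 'b) \<Rightarrow> bool" where
  "totally_acyclic R A d \<longleftrightarrow>
     free_complex R A d \<and> acyclic_complex A d \<and>
     (\<forall>i. trivial_group (dual_cohomology R A d i))"

end

theory Submission
  imports Defs "HOL-Library.Extended_Nat"
begin

text \<open>
  Let \<open>b\<^sub>i\<close> be the rank of \<open>A\<^sub>i\<close>, let \<open>Z\<^sub>i\<close> be the kernel of \<open>\<partial>\<^sub>i\<close>, which is the image of \<open>\<partial>\<^sub>i\<^sub>+\<^sub>1\<close>, let
  \<open>k = R/\<mm>\<close>, and let \<open>h\<close> be the length of \<open>\<mm>\<^sup>2\<close>. By minimality, \<open>Z\<^sub>i \<subseteq> \<mm> A\<^sub>i\<close> and \<open>\<mm> Z\<^sub>i \<subseteq> \<mm>\<^sup>2 A\<^sub>i\<close>, and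
  the socle of \<open>A\<^sub>i\<close> is contained in \<open>Z\<^sub>i\<close>. Of the ring one needs to know that its socle is not principal:
  otherwise a count of lengths of annihilators shows that \<open>R\<close> is injective over itself, so Gorenstein
  (\<open>socle_not_principal\<close>).

  The proof hinges on direct summands \<open>k\<close> of the modules \<open>Z\<^sub>i\<close>. If \<open>Z\<^sub>i\<close> has none, then the socle of \<open>A\<^sub>i\<close>
  is contained in \<open>\<mm> Z\<^sub>i\<close>, so that the socle of \<open>R\<close> is \<open>\<mm>\<^sup>2\<close>, \<open>h \<ge> 2\<close>, and \<open>Z\<^sub>i\<close> has length
  \<open>b\<^sub>i\<^sub>+\<^sub>1 + h b\<^sub>i\<close>. If \<open>Z\<^sub>i\<close> and \<open>Z\<^sub>i\<^sub>-\<^sub>1\<close> have none, the sequence \<open>0 \<rightarrow> Z\<^sub>i \<rightarrow> A\<^sub>i \<rightarrow> Z\<^sub>i\<^sub>-\<^sub>1 \<rightarrow> 0\<close>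
  therefore yields a recurrence \<open>e b\<^sub>i = b\<^sub>i\<^sub>+\<^sub>1 + h b\<^sub>i\<^sub>-\<^sub>1\<close>, where \<open>1 + e + h\<close> is the length of \<open>R\<close>
  (\<open>rank_recurrence\<close>).

  A degree \<open>i\<close> lies in \<open>\<H>\<close> exactly if every linear map \<open>Z\<^sub>i\<^sub>-\<^sub>1 \<rightarrow> R\<close> extends to \<open>A\<^sub>i\<^sub>-\<^sub>1\<close>. This rules out
  summands \<open>k\<close> of \<open>Z\<^sub>i\<^sub>-\<^sub>1\<close>, because an extension of a map \<open>k \<rightarrow> R\<close> would make the socle of \<open>R\<close> principal
  (\<open>extend_imp_no_residue\<close>). It also rules them out for all \<open>Z\<^sub>j\<close> with \<open>j < i - 1\<close>
  (\<open>extend_imp_no_residue_below\<close>): such a summand gives \<open>Ext\<^sup>n(k, R) = 0\<close> for \<open>n = i - 1 - j\<close>, hence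
  \<open>Ext\<^sup>n(M, R) = 0\<close> for all modules \<open>M\<close> of finite length, and for \<open>M = Z\<^sub>j\<^sub>-\<^sub>n\<close> this says that \<open>j + 1\<close> is in \<open>\<H>\<close>,
  which excludes the summand of \<open>Z\<^sub>j\<close> after all.

  So if \<open>\<H>\<close> contains arbitrarily large degrees, the recurrence holds for all integers \<open>i\<close>. The
  determinant \<open>b\<^sub>i\<^sup>2 - b\<^sub>i\<^sub>+\<^sub>1 b\<^sub>i\<^sub>-\<^sub>1\<close> is then divisible by every power of \<open>h\<close>, so it is zero, and the ranks form
  a two-sided geometric sequence of positive integers, which is constant (\<open>equal_ranks\<close>).

  If the ranks are equal and \<open>\<H>\<close> contains \<open>l - 1\<close> and \<open>l + 1\<close>, the recurrence in degree \<open>l\<close> gives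
  \<open>e = 1 + h\<close>. Images in the dual complex have length at most \<open>(1 + h) b\<close>, which is half of the length
  of a free module of rank \<open>b\<close>. Exactness in degrees \<open>l - 1\<close> and \<open>l + 1\<close> then determines the lengths of
  kernel and image in degree \<open>l\<close>, and they agree (\<open>dual_exact_between\<close>).

  All of this is carried out in coordinates, with matrices over \<open>R\<close> and their transposes.
\<close>

section \<open>Length of modules\<close>

text \<open>Chains are built from the top downwards, which makes both inequalities behind the additivity of
  length inductions over \<open>n\<close>. With values in \<^typ>\<open>enat\<close>, additivity holds without any finiteness.\<close>

primrec has_chain :: "('a, 'r) ring_scheme \<Rightarrow> ('a, 'b, 'm) module_scheme \<Rightarrow> nat \<Rightarrow> 'b set \<Rightarrow> bool" where
  "has_chain R M 0 P \<longleftrightarrow> True"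
| "has_chain R M (Suc n) P \<longleftrightarrow> (\<exists>Y. submodule Y R M \<and> Y \<subset> P \<and> has_chain R M n Y)"

definition module_length :: "('a, 'r) ring_scheme \<Rightarrow> ('a, 'b, 'm) module_scheme \<Rightarrow> 'b set \<Rightarrow> enat" where
  "module_length R M P = (SUP n\<in>{n. has_chain R M n P}. enat n)"

text \<open>Restricting the domain by changing only the carrier lets submodules keep the operations of the
  ambient module.\<close>

abbreviation submodule_maps ::
  "('a, 'r) ring_scheme \<Rightarrow> ('a, 'b, 'm) module_scheme \<Rightarrow> 'b set \<Rightarrow> ('a, 'c, 'n) module_scheme \<Rightarrow> ('b \<Rightarrow> 'c) set" where
  "submodule_maps R M P N \<equiv> linear_maps R (M\<lparr>carrier := P\<rparr>) N"

lemma submodule_mapsI: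
  assumes "\<And>x. x \<in> P \<Longrightarrow> f x \<in> carrier N"
    and "\<And>x y. x \<in> P \<Longrightarrow> y \<in> P \<Longrightarrow> f (x \<oplus>\<^bsub>M\<^esub> y) = f x \<oplus>\<^bsub>N\<^esub> f y"
    and "\<And>a x. a \<in> carrier R \<Longrightarrow> x \<in> P \<Longrightarrow> f (a \<odot>\<^bsub>M\<^esub> x) = a \<odot>\<^bsub>N\<^esub> f x"
  shows "f \<in> submodule_maps R M P N"
  using assms by (auto simp: linear_maps_def)

lemma submodule_mapsD:
  assumes "f \<in> submodule_maps R M P N"
  shows "x \<in> P \<Longrightarrow> f x \<in> carrier N"
    and "x \<in> P \<Longrightarrow> y \<in> P \<Longrightarrow> f (x \<oplus>\<^bsub>M\<^esub> y) = f x \<oplus>\<^bsub>N\<^esub> f y"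
    and "a \<in> carrier R \<Longrightarrow> x \<in> P \<Longrightarrow> f (a \<odot>\<^bsub>M\<^esub> x) = a \<odot>\<^bsub>N\<^esub> f x"
  using assms by (auto simp: linear_maps_def)

lemma submodule_maps_mono:
  "f \<in> submodule_maps R M P N \<Longrightarrow> Y \<subseteq> P \<Longrightarrow> f \<in> submodule_maps R M Y N"
  by (auto simp: linear_maps_def subset_iff)

context module
begin

lemma submoduleI':
  assumes "H \<subseteq> carrier M" "\<zero>\<^bsub>M\<^esub> \<in> H"
    and "\<And>a b. a \<in> H \<Longrightarrow> b \<in> H \<Longrightarrow> a \<oplus>\<^bsub>M\<^esub> b \<in> H"
    and "\<And>a x. a \<in> carrier R \<Longrightarrow> x \<in> H \<Longrightarrow> a \<odot>\<^bsub>M\<^esub> x \<in> H"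
  shows "submodule H R M"
proof (rule submoduleI)
  fix x assume x: "x \<in> H"
  have "\<ominus>\<^bsub>M\<^esub> x = (\<ominus> \<one>) \<odot>\<^bsub>M\<^esub> x"
    using x assms(1) by (subst smult_l_minus) auto
  then show "\<ominus>\<^bsub>M\<^esub> x \<in> H" using assms(4)[OF _ x] by simp
qed (use assms in auto)

lemma submodule_sub: "submodule H R M \<Longrightarrow> x \<in> H \<Longrightarrow> x \<in> carrier M"
  using submoduleE(1) by blast

lemma submodule_zero: "submodule H R M \<Longrightarrow> \<zero>\<^bsub>M\<^esub> \<in> H"
  using submodule.axioms(1) subgroup.one_closed by fastforce

lemma submodule_minus:
  "submodule H R M \<Longrightarrow> x \<in> H \<Longrightarrow> y \<in> H \<Longrightarrow> x \<ominus>\<^bsub>M\<^esub> y \<in> H"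
  by (simp add: M.minus_eq submoduleE(3,5))

lemma submodule_zero_set: "submodule {\<zero>\<^bsub>M\<^esub>} R M"
  by (rule submoduleI') auto

lemma submodule_Int: "submodule H R M \<Longrightarrow> submodule K R M \<Longrightarrow> submodule (H \<inter> K) R M"
  by (rule submoduleI') (auto intro: submodule_sub submodule_zero submoduleE(4,5))

lemma minus_swap:
  assumes "l \<in> carrier M" "g \<in> carrier M" "l' \<in> carrier M" "g' \<in> carrier M"
    and "l \<oplus>\<^bsub>M\<^esub> g = l' \<oplus>\<^bsub>M\<^esub> g'"
  shows "g \<ominus>\<^bsub>M\<^esub> g' = l' \<ominus>\<^bsub>M\<^esub> l"
proof -
  have "g = \<ominus>\<^bsub>M\<^esub> l \<oplus>\<^bsub>M\<^esub> (l \<oplus>\<^bsub>M\<^esub> g)" using assms(1,2) by (simp add: M.r_neg1)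
  then have g: "g = \<ominus>\<^bsub>M\<^esub> l \<oplus>\<^bsub>M\<^esub> (l' \<oplus>\<^bsub>M\<^esub> g')" unfolding assms(5) .
  have "\<ominus>\<^bsub>M\<^esub> l \<oplus>\<^bsub>M\<^esub> (l' \<oplus>\<^bsub>M\<^esub> g') \<oplus>\<^bsub>M\<^esub> \<ominus>\<^bsub>M\<^esub> g' = \<ominus>\<^bsub>M\<^esub> l \<oplus>\<^bsub>M\<^esub> l'"
    using assms(1-4) by (simp add: M.a_assoc M.r_neg)
  then show ?thesis using assms(1-4) g by (simp add: M.minus_eq M.a_comm)
qed

lemma add_minus_cancel:
  "k \<in> carrier M \<Longrightarrow> u \<in> carrier M \<Longrightarrow> (k \<oplus>\<^bsub>M\<^esub> u) \<ominus>\<^bsub>M\<^esub> k = u"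
  by (simp add: M.minus_eq M.a_comm[of k u] M.a_assoc M.r_neg)

lemma minus_add_cancel:
  "k \<in> carrier M \<Longrightarrow> u \<in> carrier M \<Longrightarrow> (u \<ominus>\<^bsub>M\<^esub> k) \<oplus>\<^bsub>M\<^esub> k = u"
  by (simp add: M.minus_eq M.a_assoc M.l_neg)

lemma plus_minus_cancel:
  assumes "k \<in> carrier M" "u \<in> carrier M"
  shows "k \<oplus>\<^bsub>M\<^esub> ((u \<ominus>\<^bsub>M\<^esub> k) \<ominus>\<^bsub>M\<^esub> \<zero>\<^bsub>M\<^esub>) = u"
proof -
  have z: "\<ominus>\<^bsub>M\<^esub> \<zero>\<^bsub>M\<^esub> = \<zero>\<^bsub>M\<^esub>" using M.r_neg[OF M.zero_closed] by simp
  show ?thesis unfolding M.minus_eq z using assms by (subst M.a_comm) (auto simp: M.a_assoc M.l_neg)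
qed

definition adjoin :: "'c set \<Rightarrow> 'c \<Rightarrow> 'c set" where
  "adjoin K x = {k \<oplus>\<^bsub>M\<^esub> a \<odot>\<^bsub>M\<^esub> x | k a. k \<in> K \<and> a \<in> carrier R}"

lemma adjoinI: "k \<in> K \<Longrightarrow> a \<in> carrier R \<Longrightarrow> k \<oplus>\<^bsub>M\<^esub> a \<odot>\<^bsub>M\<^esub> x \<in> adjoin K x"
  by (auto simp: adjoin_def)

lemma adjoin_add:
  assumes "k \<in> carrier M" "k' \<in> carrier M" "a \<in> carrier R" "a' \<in> carrier R" "x \<in> carrier M"
  shows "(k \<oplus>\<^bsub>M\<^esub> a \<odot>\<^bsub>M\<^esub> x) \<oplus>\<^bsub>M\<^esub> (k' \<oplus>\<^bsub>M\<^esub> a' \<odot>\<^bsub>M\<^esub> x) = (k \<oplus>\<^bsub>M\<^esub> k') \<oplus>\<^bsub>M\<^esub> (a \<oplus> a') \<odot>\<^bsub>M\<^esub> x"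
  using assms by (simp add: smult_l_distr M.a_ac)

lemma adjoin_smult:
  assumes "k \<in> carrier M" "a \<in> carrier R" "c \<in> carrier R" "x \<in> carrier M"
  shows "c \<odot>\<^bsub>M\<^esub> (k \<oplus>\<^bsub>M\<^esub> a \<odot>\<^bsub>M\<^esub> x) = c \<odot>\<^bsub>M\<^esub> k \<oplus>\<^bsub>M\<^esub> (c \<otimes> a) \<odot>\<^bsub>M\<^esub> x"
  using assms by (simp add: smult_r_distr smult_assoc1)

lemma adjoin_submodule:
  assumes K: "submodule K R M" and x: "x \<in> carrier M"
  shows "submodule (adjoin K x) R M" and "K \<subseteq> adjoin K x" and "x \<in> adjoin K x"
proof -
  note Kc = submodule_sub[OF K]
  show sub: "K \<subseteq> adjoin K x"
  proof
    fix k assume k: "k \<in> K"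
    have "k = k \<oplus>\<^bsub>M\<^esub> \<zero> \<odot>\<^bsub>M\<^esub> x" using Kc[OF k] x by simp
    then show "k \<in> adjoin K x" using adjoinI[OF k R.zero_closed, of x] by simp
  qed
  have "x = \<zero>\<^bsub>M\<^esub> \<oplus>\<^bsub>M\<^esub> \<one> \<odot>\<^bsub>M\<^esub> x" using x by simp
  then show "x \<in> adjoin K x" using adjoinI[OF submodule_zero[OF K] R.one_closed, of x] by simp
  show "submodule (adjoin K x) R M"
  proof (rule submoduleI')
    show "adjoin K x \<subseteq> carrier M" using Kc x by (auto simp: adjoin_def)
    show "\<zero>\<^bsub>M\<^esub> \<in> adjoin K x" using sub submodule_zero[OF K] by blast
  next
    fix u v assume "u \<in> adjoin K x" "v \<in> adjoin K x"
    then obtain k a k' a' where *: "k \<in> K" "a \<in> carrier R" "k' \<in> K" "a' \<in> carrier R"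
      "u = k \<oplus>\<^bsub>M\<^esub> a \<odot>\<^bsub>M\<^esub> x" "v = k' \<oplus>\<^bsub>M\<^esub> a' \<odot>\<^bsub>M\<^esub> x" unfolding adjoin_def by blast
    show "u \<oplus>\<^bsub>M\<^esub> v \<in> adjoin K x"
      unfolding *(5,6) using * Kc x K by (simp add: adjoin_add adjoinI submoduleE(5))
  next
    fix c u assume c: "c \<in> carrier R" and "u \<in> adjoin K x"
    then obtain k a where *: "k \<in> K" "a \<in> carrier R" "u = k \<oplus>\<^bsub>M\<^esub> a \<odot>\<^bsub>M\<^esub> x"
      unfolding adjoin_def by blast
    show "c \<odot>\<^bsub>M\<^esub> u \<in> adjoin K x"
      unfolding *(3) using * c Kc x K by (simp add: adjoin_smult adjoinI submoduleE(4))
  qed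
qed

lemma adjoin_least:
  assumes "submodule N R M" "K \<subseteq> N" "x \<in> N"
  shows "adjoin K x \<subseteq> N"
  using assms by (auto simp: adjoin_def intro!: submoduleE(4,5))

lemma has_chain_mono:
  assumes "has_chain R M n P" "P \<subseteq> Y"
  shows "has_chain R M n Y"
  using assms by (cases n) (simp, metis has_chain.simps(2) psubset_subset_trans)

lemma has_chain_less: "has_chain R M n P \<Longrightarrow> m \<le> n \<Longrightarrow> has_chain R M m P"
proof (induction n arbitrary: P m)
  case (Suc n)
  show ?case
  proof (cases m)
    case (Suc m')
    then show ?thesis using Suc.prems Suc.IH by auto
  qed simp
qed simp

lemma has_chain_le_length: "has_chain R M n P \<Longrightarrow> enat n \<le> module_length R M P"
  unfolding module_length_def by (rule SUP_upper) simp

lemma length_leI: "(\<And>n. has_chain R M n P \<Longrightarrow> enat n \<le> B) \<Longrightarrow> module_length R M P \<le> B"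
  unfolding module_length_def by (rule SUP_least) simp

text \<open>The lengths of chains are closed downwards, so the supremum is attained whenever it is finite.\<close>

lemma has_chain_iff_length: "has_chain R M n P \<longleftrightarrow> enat n \<le> module_length R M P"
proof
  assume le: "enat n \<le> module_length R M P"
  show "has_chain R M n P"
  proof (rule ccontr)
    assume no: "\<not> has_chain R M n P"
    then have n: "n > 0" by (cases n) auto
    have "module_length R M P \<le> enat (n - 1)"
    proof (rule length_leI)
      fix m assume "has_chain R M m P"
      then have "m < n" using no has_chain_less[of m P n] by (meson not_le)
      then show "enat m \<le> enat (n - 1)" by simp
    qed
    then show False using le n by (meson diff_less enat_ord_simps(1) leD less_numeral_extra(1) order_trans)
  qed
qed (rule has_chain_le_length)

lemma length_mono: "P \<subseteq> Y \<Longrightarrow> module_length R M P \<le> module_length R M Y"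
  by (meson has_chain_le_length has_chain_mono length_leI)

lemma length_strict_mono:
  assumes "submodule P R M" "P \<subset> Y"
  shows "module_length R M P + 1 \<le> module_length R M Y"
proof (cases "module_length R M P")
  case (enat n)
  then have "has_chain R M (Suc n) Y" using assms has_chain_iff_length[of n P] by auto
  then show ?thesis using enat has_chain_le_length[of "Suc n" Y]
    by (metis eSuc_enat plus_1_eSuc(2))
next
  case infinity
  then show ?thesis using length_mono[of P Y] assms by (simp add: psubset_imp_subset)
qed

lemma length_eq_imp_eq:
  assumes "submodule P R M" "P \<subseteq> Y" "module_length R M Y \<le> module_length R M P"
    "module_length R M P \<noteq> \<infinity>"
  shows "P = Y"
proof (rule ccontr)
  assume "P \<noteq> Y"
  then have "module_length R M P + 1 \<le> module_length R M P"
    using length_strict_mono[of P Y] assms by (metis order.trans psubsetI)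
  then show False using assms(4) by (cases "module_length R M P") (auto simp: one_enat_def)
qed

lemma length_zero: "module_length R M {\<zero>\<^bsub>M\<^esub>} = 0"
proof -
  have "module_length R M {\<zero>\<^bsub>M\<^esub>} \<le> 0"
  proof (rule length_leI)
    fix n assume n: "has_chain R M n {\<zero>\<^bsub>M\<^esub>}"
    show "enat n \<le> 0"
    proof (cases n)
      case (Suc m)
      then obtain Y where "submodule Y R M" "Y \<subset> {\<zero>\<^bsub>M\<^esub>}" using n by auto
      then show ?thesis using submodule_zero by blast
    qed (simp add: zero_enat_def)
  qed
  then show ?thesis by simp
qed

end

lemma submodule_map_zero:
  assumes "module R M" "module R N" "submodule P R M" "f \<in> submodule_maps R M P N"
  shows "f \<zero>\<^bsub>M\<^esub> = \<zero>\<^bsub>N\<^esub>"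
proof -
  interpret M: module R M by fact
  interpret N: module R N by fact
  have z: "\<zero>\<^bsub>M\<^esub> \<in> P" using M.submodule_zero assms by blast
  have "f (\<zero>\<^bsub>R\<^esub> \<odot>\<^bsub>M\<^esub> \<zero>\<^bsub>M\<^esub>) = \<zero>\<^bsub>R\<^esub> \<odot>\<^bsub>N\<^esub> f \<zero>\<^bsub>M\<^esub>" using submodule_mapsD(3)[OF assms(4)] z by blast
  then show ?thesis using submodule_mapsD(1)[OF assms(4) z] by simp
qed

lemma submodule_map_minus:
  assumes "module R M" "module R N" "submodule P R M" "f \<in> submodule_maps R M P N" "x \<in> P" "y \<in> P"
  shows "f (x \<ominus>\<^bsub>M\<^esub> y) = f x \<ominus>\<^bsub>N\<^esub> f y"
proof -
  interpret M: module R M by fact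
  interpret N: module R N by fact
  have c: "x \<in> carrier M" "y \<in> carrier M" using M.submodule_sub assms by auto
  note fc = submodule_mapsD(1)[OF assms(4)]
  have m: "\<ominus>\<^bsub>M\<^esub> y = (\<ominus>\<^bsub>R\<^esub> \<one>\<^bsub>R\<^esub>) \<odot>\<^bsub>M\<^esub> y" using c by (simp add: M.smult_l_minus)
  have "f (\<ominus>\<^bsub>M\<^esub> y) = (\<ominus>\<^bsub>R\<^esub> \<one>\<^bsub>R\<^esub>) \<odot>\<^bsub>N\<^esub> f y" unfolding m
    by (rule submodule_mapsD(3)[OF assms(4)]) (use assms in auto)
  also have "\<dots> = \<ominus>\<^bsub>N\<^esub> f y" using fc assms by (simp add: N.smult_l_minus)
  finally have "f (\<ominus>\<^bsub>M\<^esub> y) = \<ominus>\<^bsub>N\<^esub> f y" .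
  moreover have "\<ominus>\<^bsub>M\<^esub> y \<in> P" using M.submoduleE(3) assms by blast
  ultimately show ?thesis using submodule_mapsD(2)[OF assms(4)] assms by (simp add: M.minus_eq N.minus_eq)
qed

text \<open>The sum of \<open>L\<close> and the image of \<open>g\<close> is the pushout of \<open>L\<close> and \<open>Y\<close> along the elements of \<open>Y\<close>
  that \<open>g\<close> sends into \<open>L\<close>, so \<open>f\<close> and \<open>F\<close> glue as soon as they agree on those.\<close>

lemma glue_maps:
  assumes M: "module R M" and N: "module R N" and P: "module R P"
    and L: "submodule L R M" and Y: "submodule Y R P"
    and f: "f \<in> submodule_maps R M L N" and g: "g \<in> submodule_maps R P Y M" and F: "F \<in> submodule_maps R P Y N"
    and compat: "\<forall>y\<in>Y. g y \<in> L \<longrightarrow> F y = f (g y)"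
  shows "\<exists>h\<in>submodule_maps R M {l \<oplus>\<^bsub>M\<^esub> g y | l y. l \<in> L \<and> y \<in> Y} N.
    (\<forall>l\<in>L. \<forall>y\<in>Y. h (l \<oplus>\<^bsub>M\<^esub> g y) = f l \<oplus>\<^bsub>N\<^esub> F y) \<and> (\<forall>l\<in>L. h l = f l)"
proof -
  interpret M: module R M by fact
  interpret N: module R N by fact
  interpret P: module R P by fact
  note fD = submodule_mapsD[OF f] and gD = submodule_mapsD[OF g] and FD = submodule_mapsD[OF F]
  note Lc = M.submodule_sub[OF L]
  have wd: "f l \<oplus>\<^bsub>N\<^esub> F y = f l' \<oplus>\<^bsub>N\<^esub> F y'"
    if "l \<in> L" "l' \<in> L" "y \<in> Y" "y' \<in> Y" "l \<oplus>\<^bsub>M\<^esub> g y = l' \<oplus>\<^bsub>M\<^esub> g y'" for l l' y y'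
  proof -
    have "g (y \<ominus>\<^bsub>P\<^esub> y') = l' \<ominus>\<^bsub>M\<^esub> l"
      unfolding submodule_map_minus[OF P M Y g that(3,4)]
      by (rule M.minus_swap[OF Lc[OF that(1)] gD(1)[OF that(3)] Lc[OF that(2)] gD(1)[OF that(4)] that(5)])
    then have "F (y \<ominus>\<^bsub>P\<^esub> y') = f (l' \<ominus>\<^bsub>M\<^esub> l)"
      using compat P.submodule_minus[OF Y that(3,4)] M.submodule_minus[OF L that(2,1)] by simp
    then have e: "F y \<ominus>\<^bsub>N\<^esub> F y' = f l' \<ominus>\<^bsub>N\<^esub> f l"
      unfolding submodule_map_minus[OF P N Y F that(3,4)] submodule_map_minus[OF M N L f that(2,1)] .
    have c: "F y \<in> carrier N" "F y' \<in> carrier N" "f l \<in> carrier N" "f l' \<in> carrier N"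
      using FD(1) fD(1) that by blast+
    have "F y = (f l' \<ominus>\<^bsub>N\<^esub> f l) \<oplus>\<^bsub>N\<^esub> F y'" using N.minus_add_cancel[OF c(2,1)] e by simp
    then have "f l \<oplus>\<^bsub>N\<^esub> F y = ((f l' \<ominus>\<^bsub>N\<^esub> f l) \<oplus>\<^bsub>N\<^esub> f l) \<oplus>\<^bsub>N\<^esub> F y'" using c by (simp add: N.M.a_ac)
    then show ?thesis using N.minus_add_cancel[OF c(3,4)] by simp
  qed
  define h where "h u = (THE r. \<exists>l\<in>L. \<exists>y\<in>Y. u = l \<oplus>\<^bsub>M\<^esub> g y \<and> r = f l \<oplus>\<^bsub>N\<^esub> F y)" for u
  have hI: "h (l \<oplus>\<^bsub>M\<^esub> g y) = f l \<oplus>\<^bsub>N\<^esub> F y" if "l \<in> L" "y \<in> Y" for l y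
    unfolding h_def
  proof (rule the_equality)
    show "\<exists>l'\<in>L. \<exists>y'\<in>Y. l \<oplus>\<^bsub>M\<^esub> g y = l' \<oplus>\<^bsub>M\<^esub> g y' \<and> f l \<oplus>\<^bsub>N\<^esub> F y = f l' \<oplus>\<^bsub>N\<^esub> F y'"
      by (rule bexI[OF bexI[OF conjI[OF refl refl] that(2)] that(1)])
  next
    fix r assume "\<exists>l'\<in>L. \<exists>y'\<in>Y. l \<oplus>\<^bsub>M\<^esub> g y = l' \<oplus>\<^bsub>M\<^esub> g y' \<and> r = f l' \<oplus>\<^bsub>N\<^esub> F y'"
    then obtain l' y' where *: "l' \<in> L" "y' \<in> Y" "l \<oplus>\<^bsub>M\<^esub> g y = l' \<oplus>\<^bsub>M\<^esub> g y'" "r = f l' \<oplus>\<^bsub>N\<^esub> F y'"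
      by blast
    show "r = f l \<oplus>\<^bsub>N\<^esub> F y" unfolding *(4) by (rule wd[OF that(1) *(1) that(2) *(2,3), symmetric])
  qed
  have "h \<in> submodule_maps R M {l \<oplus>\<^bsub>M\<^esub> g y | l y. l \<in> L \<and> y \<in> Y} N"
  proof (rule submodule_mapsI)
    fix u assume "u \<in> {l \<oplus>\<^bsub>M\<^esub> g y | l y. l \<in> L \<and> y \<in> Y}"
    then obtain l y where *: "l \<in> L" "y \<in> Y" "u = l \<oplus>\<^bsub>M\<^esub> g y" by blast
    show "h u \<in> carrier N" unfolding *(3) hI[OF *(1,2)] using fD(1)[OF *(1)] FD(1)[OF *(2)] by simp
    fix v assume "v \<in> {l \<oplus>\<^bsub>M\<^esub> g y | l y. l \<in> L \<and> y \<in> Y}"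
    then obtain l' y' where **: "l' \<in> L" "y' \<in> Y" "v = l' \<oplus>\<^bsub>M\<^esub> g y'" by blast
    have "u \<oplus>\<^bsub>M\<^esub> v = (l \<oplus>\<^bsub>M\<^esub> l') \<oplus>\<^bsub>M\<^esub> g (y \<oplus>\<^bsub>P\<^esub> y')"
      unfolding *(3) **(3) gD(2)[OF *(2) **(2)]
      using Lc[OF *(1)] Lc[OF **(1)] gD(1)[OF *(2)] gD(1)[OF **(2)] by (simp add: M.M.a_ac)
    then have "h (u \<oplus>\<^bsub>M\<^esub> v) = f (l \<oplus>\<^bsub>M\<^esub> l') \<oplus>\<^bsub>N\<^esub> F (y \<oplus>\<^bsub>P\<^esub> y')"
      using hI[OF M.submoduleE(5)[OF L *(1) **(1)] P.submoduleE(5)[OF Y *(2) **(2)]] by simp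
    then show "h (u \<oplus>\<^bsub>M\<^esub> v) = h u \<oplus>\<^bsub>N\<^esub> h v"
      unfolding *(3) **(3) hI[OF *(1,2)] hI[OF **(1,2)] fD(2)[OF *(1) **(1)] FD(2)[OF *(2) **(2)]
      using fD(1)[OF *(1)] fD(1)[OF **(1)] FD(1)[OF *(2)] FD(1)[OF **(2)] by (simp add: N.M.a_ac)
  next
    fix a u assume a: "a \<in> carrier R" and "u \<in> {l \<oplus>\<^bsub>M\<^esub> g y | l y. l \<in> L \<and> y \<in> Y}"
    then obtain l y where *: "l \<in> L" "y \<in> Y" "u = l \<oplus>\<^bsub>M\<^esub> g y" by blast
    have "a \<odot>\<^bsub>M\<^esub> u = (a \<odot>\<^bsub>M\<^esub> l) \<oplus>\<^bsub>M\<^esub> g (a \<odot>\<^bsub>P\<^esub> y)"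
      unfolding *(3) gD(3)[OF a *(2)] using a Lc[OF *(1)] gD(1)[OF *(2)] by (simp add: M.smult_r_distr)
    then have "h (a \<odot>\<^bsub>M\<^esub> u) = f (a \<odot>\<^bsub>M\<^esub> l) \<oplus>\<^bsub>N\<^esub> F (a \<odot>\<^bsub>P\<^esub> y)"
      using hI[OF M.submoduleE(4)[OF L a *(1)] P.submoduleE(4)[OF Y a *(2)]] by simp
    then show "h (a \<odot>\<^bsub>M\<^esub> u) = a \<odot>\<^bsub>N\<^esub> h u"
      unfolding *(3) hI[OF *(1,2)] fD(3)[OF a *(1)] FD(3)[OF a *(2)]
      using a fD(1)[OF *(1)] FD(1)[OF *(2)] by (simp add: N.smult_r_distr)
  qed
  moreover have "h l = f l" if l: "l \<in> L" for l
  proof -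
    have "l = l \<oplus>\<^bsub>M\<^esub> g \<zero>\<^bsub>P\<^esub>" using Lc[OF l] submodule_map_zero[OF P M Y g] by simp
    then have "h l = f l \<oplus>\<^bsub>N\<^esub> F \<zero>\<^bsub>P\<^esub>" using hI[OF l P.submodule_zero[OF Y]] by simp
    then show ?thesis using submodule_map_zero[OF P N Y F] fD(1)[OF l] by simp
  qed
  ultimately show ?thesis using hI by blast
qed

lemma submodule_image:
  assumes "module R M" "module R N" "submodule P R M" "f \<in> submodule_maps R M P N"
  shows "submodule (f ` P) R N"
proof -
  interpret M: module R M by fact
  interpret N: module R N by fact
  note D = submodule_mapsD[OF assms(4)]
  show ?thesis
  proof (rule N.submoduleI')
    show "\<zero>\<^bsub>N\<^esub> \<in> f ` P"
      using submodule_map_zero[OF assms] M.submodule_zero[OF assms(3)] by (metis imageI)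
  next
    fix u v assume "u \<in> f ` P" "v \<in> f ` P"
    then show "u \<oplus>\<^bsub>N\<^esub> v \<in> f ` P"
      using D(2) M.submoduleE(5)[OF assms(3)] by (metis (no_types, lifting) image_iff)
  next
    fix a u assume "a \<in> carrier R" "u \<in> f ` P"
    then show "a \<odot>\<^bsub>N\<^esub> u \<in> f ` P"
      using D(3) M.submoduleE(4)[OF assms(3)] by (metis (no_types, lifting) image_iff)
  qed (use D in auto)
qed

lemma submodule_preimage:
  assumes "module R M" "module R N" "submodule P R M" "f \<in> submodule_maps R M P N" "submodule Y R N"
  shows "submodule {x \<in> P. f x \<in> Y} R M"
proof -
  interpret M: module R M by fact
  interpret N: module R N by fact
  note D = submodule_mapsD[OF assms(4)]
  show ?thesis
    by (rule M.submoduleI')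
      (use assms submodule_map_zero[OF assms(1-4)] D in
        \<open>auto intro: M.submodule_sub M.submodule_zero M.submoduleE(4,5) N.submodule_zero N.submoduleE(4,5)\<close>)
qed

lemma submodule_kernel:
  assumes "module R M" "module R N" "submodule P R M" "f \<in> submodule_maps R M P N"
  shows "submodule {x \<in> P. f x = \<zero>\<^bsub>N\<^esub>} R M"
  using submodule_preimage[OF assms module.submodule_zero_set[OF assms(2)]] by simp

text \<open>A chain in \<open>P\<close> gives a chain in the kernel, by intersection, and one in the image, and every
  strict step remains strict in at least one of the two. Conversely, the preimages of a chain in the
  image can be put on top of a chain in the kernel.\<close>

theorem length_rank_nullity:
  assumes "module R M" "module R N" "submodule P R M" "f \<in> submodule_maps R M P N"
  shows "module_length R M P =
    module_length R M {x \<in> P. f x = \<zero>\<^bsub>N\<^esub>} + module_length R N (f ` P)"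
proof (rule antisym)
  interpret M: module R M by fact
  interpret N: module R N by fact
  define K where "K = {x \<in> P. f x = \<zero>\<^bsub>N\<^esub>}"
  have Ks: "submodule K R M" unfolding K_def by (rule submodule_kernel[OF assms])
  have split: "\<exists>p q. p + q = n \<and> has_chain R M p (Y \<inter> K) \<and> has_chain R N q (f ` Y)"
    if "has_chain R M n Y" "submodule Y R M" "Y \<subseteq> P" for n Y
    using that
  proof (induction n arbitrary: Y)
    case 0
    show ?case by (rule exI[of _ 0], rule exI[of _ 0]) simp
  next
    case (Suc n)
    then obtain W where W: "submodule W R M" "W \<subset> Y" "has_chain R M n W" by auto
    then obtain p q where pq: "p + q = n" "has_chain R M p (W \<inter> K)" "has_chain R N q (f ` W)"
      using Suc by (meson psubset_imp_subset subset_trans)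
    show ?case
    proof (cases "W \<inter> K = Y \<inter> K")
      case False
      then have "has_chain R M (Suc p) (Y \<inter> K)"
        using W pq(2) M.submodule_Int[OF W(1) Ks] by auto
      moreover have "has_chain R N q (f ` Y)" using N.has_chain_mono[OF pq(3)] W(2) by blast
      ultimately show ?thesis using pq(1) by (metis add_Suc)
    next
      case True
      have "f ` W \<noteq> f ` Y"
      proof
        assume eq: "f ` W = f ` Y"
        have "Y \<subseteq> W"
        proof
          fix y assume y: "y \<in> Y"
          then obtain w where w: "w \<in> W" "f w = f y" using eq by (metis imageE imageI)
          have wY: "w \<in> Y" using w W by blast
          have yX: "y \<in> P" "w \<in> P" using y wY Suc by auto
          have "f (y \<ominus>\<^bsub>M\<^esub> w) = f y \<ominus>\<^bsub>N\<^esub> f w" using submodule_map_minus[OF assms yX] .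
          also have "\<dots> = \<zero>\<^bsub>N\<^esub>" using w submodule_mapsD(1)[OF assms(4) yX(1)] by (simp add: N.M.minus_eq N.M.r_neg)
          finally have "y \<ominus>\<^bsub>M\<^esub> w \<in> Y \<inter> K" using M.submodule_minus[OF Suc.prems(2) y wY] Suc.prems K_def by auto
          then have "y \<ominus>\<^bsub>M\<^esub> w \<in> W" using True by blast
          then have "y \<ominus>\<^bsub>M\<^esub> w \<oplus>\<^bsub>M\<^esub> w \<in> W" using w M.submoduleE(5)[OF W(1)] by blast
          then show "y \<in> W" using M.submodule_sub[OF assms(3)] yX
            by (simp add: M.M.minus_eq M.M.a_assoc M.M.l_neg)
        qed
        then show False using W by blast
      qed
      then have "f ` W \<subset> f ` Y" using W(2) by blast
      moreover have "submodule (f ` W) R N"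
        by (rule submodule_image[OF assms(1,2) W(1) submodule_maps_mono[OF assms(4)]]) (use W Suc in auto)
      ultimately have "has_chain R N (Suc q) (f ` Y)" using pq(3) by auto
      moreover have "has_chain R M p (Y \<inter> K)" using pq(2) True by simp
      ultimately show ?thesis using pq(1) by (metis add_Suc_right)
    qed
  qed
  show "module_length R M P \<le> module_length R M {x \<in> P. f x = \<zero>\<^bsub>N\<^esub>} + module_length R N (f ` P)"
  proof (rule M.length_leI)
    fix n assume "has_chain R M n P"
    then obtain p q where pq: "p + q = n" "has_chain R M p (P \<inter> K)" "has_chain R N q (f ` P)"
      using split[of n P] assms by auto
    have "P \<inter> K = K" by (auto simp: K_def)
    then show "enat n \<le> module_length R M {x \<in> P. f x = \<zero>\<^bsub>N\<^esub>} + module_length R N (f ` P)"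
      using M.has_chain_le_length[of p K] N.has_chain_le_length[OF pq(3)] pq(1,2) K_def
      by (metis add_mono plus_enat_simps(1))
  qed
  have join: "has_chain R M (p + q) {x \<in> P. f x \<in> Y}"
    if "has_chain R M p K" "has_chain R N q Y" "submodule Y R N" "Y \<subseteq> f ` P" for p q Y
    using that(2-)
  proof (induction q arbitrary: Y)
    case 0
    have "K \<subseteq> {x \<in> P. f x \<in> Y}" using N.submodule_zero[OF 0(2)] by (auto simp: K_def)
    then show ?case using that(1) M.has_chain_mono by simp
  next
    case (Suc q)
    then obtain W where W: "submodule W R N" "W \<subset> Y" "has_chain R N q W" by auto
    have c: "has_chain R M (p + q) {x \<in> P. f x \<in> W}" using Suc W by blast
    have "{x \<in> P. f x \<in> W} \<subset> {x \<in> P. f x \<in> Y}" using W(2) Suc.prems(3) by blast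
    then show ?case using c submodule_preimage[OF assms W(1)] by auto
  qed
  show "module_length R M {x \<in> P. f x = \<zero>\<^bsub>N\<^esub>} + module_length R N (f ` P) \<le> module_length R M P"
  proof -
    have J: "enat (p + q) \<le> module_length R M P"
      if "has_chain R M p K" "has_chain R N q (f ` P)" for p q
      using join[OF that submodule_image[OF assms]] M.has_chain_mono M.has_chain_le_length by (metis (no_types, lifting) image_eqI mem_Collect_eq subsetI subset_refl)
    have inf: "a = \<infinity>" if "\<And>q. enat q \<le> a" for a
      using that[of "Suc (the_enat a)"] by (cases a) auto
    consider (fin) p q where "module_length R M K = enat p" "module_length R N (f ` P) = enat q"
      | (N) "module_length R N (f ` P) = \<infinity>" | (M) "module_length R M K = \<infinity>"
      by (metis enat.exhaust infinity_enat_def)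
    then show ?thesis
    proof cases
      case fin
      then have "has_chain R M p K" "has_chain R N q (f ` P)"
        using M.has_chain_iff_length N.has_chain_iff_length by auto
      then show ?thesis using J fin K_def by fastforce
    next
      case N
      have "module_length R M P = \<infinity>"
        using J[of 0] N N.has_chain_iff_length by (intro inf) simp
      then show ?thesis by simp
    next
      case M
      have "enat q \<le> module_length R M P" for q
        using J[of q 0] M M.has_chain_iff_length[of q] by simp
      then have "module_length R M P = \<infinity>" by (rule inf)
      then show ?thesis by simp
    qed
  qed
qed

section \<open>Free modules of coordinate vectors\<close>

text \<open>All coordinate vectors are kept in one module: \<open>R\<^sup>b\<close> consists of the sequences that vanish from
  index \<open>b\<close> on. Free modules of different ranks then share their operations, and \<open>R\<^sup>p\<close> is a submodule
  of \<open>R\<^sup>q\<close> for \<open>p \<le> q\<close>.\<close>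

definition sequence_module :: "('a, 'r) ring_scheme \<Rightarrow> ('a, nat \<Rightarrow> 'a) module" where
  "sequence_module R =
     \<lparr>carrier = {v. \<forall>n. v n \<in> carrier R}, monoid.mult = undefined, one = undefined,
      ring.zero = (\<lambda>n. \<zero>\<^bsub>R\<^esub>), ring.add = (\<lambda>v w n. v n \<oplus>\<^bsub>R\<^esub> w n),
      smult = (\<lambda>a v n. a \<otimes>\<^bsub>R\<^esub> v n)\<rparr>"

lemma sequence_module_simps [simp]:
  "carrier (sequence_module R) = {v. \<forall>n. v n \<in> carrier R}"
  "\<zero>\<^bsub>sequence_module R\<^esub> = (\<lambda>n. \<zero>\<^bsub>R\<^esub>)"
  "v \<oplus>\<^bsub>sequence_module R\<^esub> w = (\<lambda>n. v n \<oplus>\<^bsub>R\<^esub> w n)"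
  "a \<odot>\<^bsub>sequence_module R\<^esub> v = (\<lambda>n. a \<otimes>\<^bsub>R\<^esub> v n)"
  by (auto simp: sequence_module_def)

lemma regular_module_simps [simp]:
  "carrier (regular_module R) = carrier R"
  "\<zero>\<^bsub>regular_module R\<^esub> = \<zero>\<^bsub>R\<^esub>"
  "v \<oplus>\<^bsub>regular_module R\<^esub> w = v \<oplus>\<^bsub>R\<^esub> w"
  "a \<odot>\<^bsub>regular_module R\<^esub> v = a \<otimes>\<^bsub>R\<^esub> v"
  by (auto simp: regular_module_def)

lemma (in cring) sequence_module: "module R (sequence_module R)"
proof (rule moduleI)
  show "abelian_group (sequence_module R)"
  proof (rule abelian_groupI)
    fix v assume "v \<in> carrier (sequence_module R)"
    then show "\<exists>w\<in>carrier (sequence_module R). w \<oplus>\<^bsub>sequence_module R\<^esub> v = \<zero>\<^bsub>sequence_module R\<^esub>"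
      by (intro bexI[of _ "\<lambda>n. \<ominus> v n"]) (auto simp: l_neg)
  qed (auto simp: a_ac)
qed (auto simp: is_cring l_distr r_distr m_assoc)

lemma (in cring) regular_module: "module R (regular_module R)"
proof (rule moduleI)
  show "abelian_group (regular_module R)"
  proof (rule abelian_groupI)
    fix v assume "v \<in> carrier (regular_module R)"
    then show "\<exists>w\<in>carrier (regular_module R). w \<oplus>\<^bsub>regular_module R\<^esub> v = \<zero>\<^bsub>regular_module R\<^esub>"
      by (intro bexI[of _ "\<ominus> v"]) (auto simp: l_neg)
  qed (auto simp: a_ac)
qed (auto simp: is_cring l_distr r_distr m_assoc)

definition unit_vector :: "('a, 'r) ring_scheme \<Rightarrow> nat \<Rightarrow> nat \<Rightarrow> 'a" where
  "unit_vector R t = (\<lambda>n. if n = t then \<one>\<^bsub>R\<^esub> else \<zero>\<^bsub>R\<^esub>)"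

text \<open>For an ideal \<open>J\<close> this is \<open>J R\<^sup>b\<close>.\<close>

definition vectors :: "('a, 'r) ring_scheme \<Rightarrow> 'a set \<Rightarrow> nat \<Rightarrow> (nat \<Rightarrow> 'a) set" where
  "vectors R J b = {v. (\<forall>n<b. v n \<in> J) \<and> (\<forall>n\<ge>b. v n = \<zero>\<^bsub>R\<^esub>)}"

definition lincomb ::
  "('a, 'b, 'm) module_scheme \<Rightarrow> (nat \<Rightarrow> 'b) \<Rightarrow> nat \<Rightarrow> (nat \<Rightarrow> 'a) \<Rightarrow> 'b" where
  "lincomb M g b v = (\<Oplus>\<^bsub>M\<^esub>t\<in>{..<b}. v t \<odot>\<^bsub>M\<^esub> g t)"

context module
begin

lemma lincomb_0 [simp]: "lincomb M g 0 v = \<zero>\<^bsub>M\<^esub>"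
  by (simp add: lincomb_def)

lemma lincomb_Suc:
  assumes "\<And>t. t \<le> b \<Longrightarrow> g t \<in> carrier M" "\<And>t. t \<le> b \<Longrightarrow> v t \<in> carrier R"
  shows "lincomb M g (Suc b) v = v b \<odot>\<^bsub>M\<^esub> g b \<oplus>\<^bsub>M\<^esub> lincomb M g b v"
  using assms unfolding lincomb_def lessThan_Suc by (subst finsum_insert) auto

lemma lincomb_closed:
  assumes "\<And>t. t < b \<Longrightarrow> g t \<in> carrier M" "\<And>t. t < b \<Longrightarrow> v t \<in> carrier R"
  shows "lincomb M g b v \<in> carrier M"
  using assms unfolding lincomb_def by (intro finsum_closed) auto

lemma lincomb_cong:
  assumes "\<And>t. t < b \<Longrightarrow> v t = w t" "\<And>t. t < b \<Longrightarrow> g t = h t"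
    "\<And>t. t < b \<Longrightarrow> h t \<in> carrier M" "\<And>t. t < b \<Longrightarrow> w t \<in> carrier R"
  shows "lincomb M g b v = lincomb M h b w"
  unfolding lincomb_def by (rule finsum_cong') (use assms in auto)

lemma lincomb_in_submodule:
  assumes N: "submodule N R M" and "\<And>t. t < b \<Longrightarrow> g t \<in> carrier M" "\<And>t. t < b \<Longrightarrow> v t \<in> carrier R"
    and "\<And>t. t < b \<Longrightarrow> v t \<odot>\<^bsub>M\<^esub> g t \<in> N"
  shows "lincomb M g b v \<in> N"
  using assms(2-)
proof (induction b)
  case 0
  then show ?case using submodule_zero[OF N] by simp
next
  case (Suc b)
  then show ?case using submoduleE(5)[OF N] by (subst lincomb_Suc) auto
qed

lemma lincomb_maps:
  assumes "\<And>t. t < b \<Longrightarrow> g t \<in> carrier M"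
  shows "lincomb M g b \<in> submodule_maps R (sequence_module R) (carrier (sequence_module R)) M"
proof (rule submodule_mapsI)
  fix v w assume vw: "v \<in> carrier (sequence_module R)" "w \<in> carrier (sequence_module R)"
  have "lincomb M g b (v \<oplus>\<^bsub>sequence_module R\<^esub> w) =
      (\<Oplus>\<^bsub>M\<^esub>t\<in>{..<b}. v t \<odot>\<^bsub>M\<^esub> g t \<oplus>\<^bsub>M\<^esub> w t \<odot>\<^bsub>M\<^esub> g t)"
    unfolding lincomb_def by (rule finsum_cong') (use vw assms in \<open>auto simp: smult_l_distr\<close>)
  also have "\<dots> = lincomb M g b v \<oplus>\<^bsub>M\<^esub> lincomb M g b w"
    unfolding lincomb_def by (rule finsum_addf) (use vw assms in auto)
  finally show "lincomb M g b (v \<oplus>\<^bsub>sequence_module R\<^esub> w) = lincomb M g b v \<oplus>\<^bsub>M\<^esub> lincomb M g b w" .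
next
  fix a v assume av: "a \<in> carrier R" "v \<in> carrier (sequence_module R)"
  have "lincomb M g b (a \<odot>\<^bsub>sequence_module R\<^esub> v) = (\<Oplus>\<^bsub>M\<^esub>t\<in>{..<b}. a \<odot>\<^bsub>M\<^esub> (v t \<odot>\<^bsub>M\<^esub> g t))"
    unfolding lincomb_def by (rule finsum_cong') (use av assms in \<open>auto simp: smult_assoc1\<close>)
  also have "\<dots> = a \<odot>\<^bsub>M\<^esub> lincomb M g b v"
    unfolding lincomb_def by (rule finsum_smult_ldistr[symmetric]) (use av assms in auto)
  finally show "lincomb M g b (a \<odot>\<^bsub>sequence_module R\<^esub> v) = a \<odot>\<^bsub>M\<^esub> lincomb M g b v" .
qed (use assms in \<open>auto intro: lincomb_closed\<close>)

end

locale coordinate_ring = cring R for R (structure)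
begin

abbreviation V where "V \<equiv> sequence_module R"
abbreviation RR where "RR \<equiv> regular_module R"
abbreviation free :: "nat \<Rightarrow> (nat \<Rightarrow> 'a) set" where "free \<equiv> vectors R (carrier R)"
abbreviation maps :: "(nat \<Rightarrow> 'a) set \<Rightarrow> ((nat \<Rightarrow> 'a) \<Rightarrow> (nat \<Rightarrow> 'a)) set" where
  "maps P \<equiv> submodule_maps R V P V"
abbreviation functionals :: "(nat \<Rightarrow> 'a) set \<Rightarrow> ((nat \<Rightarrow> 'a) \<Rightarrow> 'a) set" where
  "functionals P \<equiv> submodule_maps R V P RR"
abbreviation len :: "(nat \<Rightarrow> 'a) set \<Rightarrow> enat" where "len \<equiv> module_length R V"
abbreviation ideal_len :: "'a set \<Rightarrow> enat" where "ideal_len \<equiv> module_length R RR"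

sublocale V: module R V by (rule sequence_module)
sublocale RR: module R RR by (rule regular_module)

abbreviation zero_vector ("\<zero>\<^sub>V") where "\<zero>\<^sub>V \<equiv> \<zero>\<^bsub>V\<^esub>"
abbreviation add_vector (infixl "\<oplus>\<^sub>V" 65) where "v \<oplus>\<^sub>V w \<equiv> v \<oplus>\<^bsub>V\<^esub> w"
abbreviation minus_vector (infixl "\<ominus>\<^sub>V" 65) where "v \<ominus>\<^sub>V w \<equiv> v \<ominus>\<^bsub>V\<^esub> w"
abbreviation smult_vector (infixl "\<odot>\<^sub>V" 70) where "a \<odot>\<^sub>V v \<equiv> a \<odot>\<^bsub>V\<^esub> v"

lemmas V_map_zero = submodule_map_zero[OF V.module_axioms V.module_axioms]
  and V_map_minus = submodule_map_minus[OF V.module_axioms V.module_axioms]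
  and V_image = submodule_image[OF V.module_axioms V.module_axioms]
  and V_kernel = submodule_kernel[OF V.module_axioms V.module_axioms]
  and functional_zero = submodule_map_zero[OF V.module_axioms RR.module_axioms]

lemma ideal_submodule: "ideal J R \<longleftrightarrow> submodule J R RR"
proof
  assume J: "ideal J R"
  interpret ideal J R by fact
  show "submodule J R RR" by (rule RR.submoduleI') (auto simp: I_l_closed)
next
  assume J: "submodule J R RR"
  show "ideal J R"
  proof (rule idealI[OF ring_axioms])
    show "subgroup J (add_monoid R)"
      using J unfolding submodule_def subgroup_def regular_module_def a_inv_def
      by (simp add: m_inv_def)
  next
    fix a x assume "a \<in> J" "x \<in> carrier R"
    then show "x \<otimes> a \<in> J" "a \<otimes> x \<in> J"
      using RR.submoduleE(4)[OF J, of x a] RR.submodule_sub[OF J, of a] by (auto simp: m_comm)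
  qed
qed

lemma vectors_submodule: "ideal J R \<Longrightarrow> submodule (vectors R J b) R V"
  apply (rule V.submoduleI')
  apply (auto simp: vectors_def ideal.I_l_closed additive_subgroup.zero_closed ideal.axioms(1)
      additive_subgroup.a_closed)
  by (metis additive_subgroup.a_Hcarr ideal.axioms(1) not_le zero_closed)

lemma free_submodule: "submodule (free b) R V"
  by (rule vectors_submodule[OF oneideal])

lemma vectors_mono: "J \<subseteq> K \<Longrightarrow> vectors R J b \<subseteq> vectors R K b"
  by (auto simp: vectors_def)

lemma vectors_sub_free: "ideal J R \<Longrightarrow> vectors R J b \<subseteq> free b"
  by (rule vectors_mono) (simp add: ideal.Icarr subsetI)

lemma free_mono: "b \<le> c \<Longrightarrow> free b \<subseteq> free c"
  unfolding vectors_def by (auto) (metis not_le zero_closed)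

lemma freeD: "v \<in> free b \<Longrightarrow> v n \<in> carrier R"
  unfolding vectors_def by (cases "n < b") auto

lemma free_in_V: "v \<in> free b \<Longrightarrow> v \<in> carrier V"
  using freeD by auto

lemma unit_vector_free: "t < b \<Longrightarrow> unit_vector R t \<in> free b"
  by (auto simp: unit_vector_def vectors_def)

lemma vectors_0: "vectors R J 0 = {\<zero>\<^bsub>V\<^esub>}"
  by (auto simp: vectors_def)

lemma lincomb_unit_vector:
  assumes "module R M" "\<And>n. n < b \<Longrightarrow> g n \<in> carrier M" "t < b"
  shows "lincomb M g b (unit_vector R t) = g t"
proof -
  interpret M: module R M by fact
  have uc: "unit_vector R t n \<in> carrier R" for n by (simp add: unit_vector_def)
  have "c \<le> b \<Longrightarrow> lincomb M g c (unit_vector R t) = (if t < c then g t else \<zero>\<^bsub>M\<^esub>)" for c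
  proof (induction c)
    case (Suc c)
    have "lincomb M g (Suc c) (unit_vector R t) =
      unit_vector R t c \<odot>\<^bsub>M\<^esub> g c \<oplus>\<^bsub>M\<^esub> lincomb M g c (unit_vector R t)"
      by (rule M.lincomb_Suc) (use assms Suc uc in auto)
    also have "\<dots> = (if t < Suc c then g t else \<zero>\<^bsub>M\<^esub>)"
      using Suc assms by (auto simp: unit_vector_def less_Suc_eq)
    finally show ?case .
  qed simp
  then show ?thesis using assms(3) by simp
qed

lemma linear_eq_lincomb:
  assumes "module R M" "f \<in> submodule_maps R V (free b) M" "v \<in> free b"
  shows "f v = lincomb M (\<lambda>t. f (unit_vector R t)) b v"
proof -
  interpret M: module R M by fact
  note D = submodule_mapsD[OF assms(2)]
  have fu: "t < b \<Longrightarrow> f (unit_vector R t) \<in> carrier M" for t using D(1) unit_vector_free by blast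
  have "c \<le> b \<Longrightarrow> v \<in> free c \<Longrightarrow> f v = lincomb M (\<lambda>t. f (unit_vector R t)) c v" for c v
  proof (induction c arbitrary: v)
    case 0
    then have "v = \<zero>\<^bsub>V\<^esub>" using vectors_0 by blast
    then show ?case
      using submodule_map_zero[OF V.module_axioms assms(1) free_submodule assms(2)] by simp
  next
    case (Suc c)
    define w where "w = v(c := \<zero>)"
    have vc: "v n \<in> carrier R" for n using freeD[OF Suc.prems(2)] .
    have w: "w \<in> free c" using Suc.prems(2) unfolding w_def vectors_def by auto
    have wb: "w \<in> free b" using w free_mono[of c b] Suc.prems(1) by (meson Suc_leD subsetD)
    have ub: "unit_vector R c \<in> free b" using Suc.prems unit_vector_free by auto
    have v: "v = v c \<odot>\<^bsub>V\<^esub> unit_vector R c \<oplus>\<^bsub>V\<^esub> w"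
      using vc by (auto simp: w_def unit_vector_def)
    have cb: "v c \<odot>\<^bsub>V\<^esub> unit_vector R c \<in> free b"
      using V.submoduleE(4)[OF free_submodule vc ub] .
    have "f v = v c \<odot>\<^bsub>M\<^esub> f (unit_vector R c) \<oplus>\<^bsub>M\<^esub> f w"
      using D(2)[OF cb wb] D(3)[OF vc ub] v by metis
    also have "f w = lincomb M (\<lambda>t. f (unit_vector R t)) c w"
      using Suc w by auto
    also have "\<dots> = lincomb M (\<lambda>t. f (unit_vector R t)) c v"
      by (rule M.lincomb_cong) (use fu Suc vc in \<open>auto simp: w_def\<close>)
    also have "v c \<odot>\<^bsub>M\<^esub> f (unit_vector R c) \<oplus>\<^bsub>M\<^esub> \<dots> = lincomb M (\<lambda>t. f (unit_vector R t)) (Suc c) v"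
      by (rule M.lincomb_Suc[symmetric]) (use fu Suc vc in auto)
    finally show ?case .
  qed
  then show ?thesis using assms by blast
qed

lemma linear_eqI:
  assumes "module R M" "f \<in> submodule_maps R V (free b) M" "g \<in> submodule_maps R V (free b) M"
    "\<And>t. t < b \<Longrightarrow> f (unit_vector R t) = g (unit_vector R t)" "v \<in> free b"
  shows "f v = g v"
proof -
  interpret M: module R M by fact
  have "lincomb M (\<lambda>t. f (unit_vector R t)) b v = lincomb M (\<lambda>t. g (unit_vector R t)) b v"
    by (rule M.lincomb_cong)
      (use assms submodule_mapsD(1)[OF assms(3)] unit_vector_free freeD in auto)
  then show ?thesis using linear_eq_lincomb assms by metis
qed

lemma lincomb_maps_free:
  assumes "module R M" "\<And>t. t < b \<Longrightarrow> g t \<in> carrier M"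
  shows "lincomb M g b \<in> submodule_maps R V (free c) M"
proof (rule submodule_maps_mono)
  show "lincomb M g b \<in> submodule_maps R V (carrier V) M"
    by (rule module.lincomb_maps) (use assms in auto)
  show "free c \<subseteq> carrier V" using free_in_V by blast
qed

text \<open>Projectivity of free modules.\<close>

lemma free_lift:
  assumes M: "module R M" and N: "module R N" and Y: "submodule Y R M" and f: "f \<in> submodule_maps R M Y N"
    and g: "g \<in> submodule_maps R V (free b) N" and sub: "g ` free b \<subseteq> f ` Y"
  obtains h where "h \<in> submodule_maps R V (free b) M" "\<And>v. v \<in> free b \<Longrightarrow> h v \<in> Y"
    "\<And>v. v \<in> free b \<Longrightarrow> f (h v) = g v"
proof -
  interpret M: module R M by fact
  have "\<forall>t. \<exists>y. t < b \<longrightarrow> y \<in> Y \<and> f y = g (unit_vector R t)"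
    using sub unit_vector_free by (metis (no_types, lifting) imageE imageI subsetD)
  then obtain y where y: "\<And>t. t < b \<Longrightarrow> y t \<in> Y" "\<And>t. t < b \<Longrightarrow> f (y t) = g (unit_vector R t)"
    by metis
  have yc: "\<And>t. t < b \<Longrightarrow> y t \<in> carrier M" using y M.submodule_sub[OF Y] by blast
  define h where "h = lincomb M y b"
  have h: "h \<in> submodule_maps R V (free b) M" unfolding h_def by (rule lincomb_maps_free[OF M yc])
  have hY: "h v \<in> Y" if "v \<in> free b" for v
    unfolding h_def by (rule M.lincomb_in_submodule[OF Y]) (use yc y freeD[OF that] M.submoduleE(4)[OF Y] in auto)
  have fh: "(\<lambda>v. f (h v)) \<in> submodule_maps R V (free b) N"
    using submodule_mapsD[OF h] submodule_mapsD[OF f] hY by (auto intro!: submodule_mapsI simp del: sequence_module_simps)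
  have "f (h v) = g v" if "v \<in> free b" for v
    by (rule linear_eqI[OF N fh g _ that])
      (simp add: h_def lincomb_unit_vector[OF M yc] y)
  then show ?thesis using that h hY by blast
qed

text \<open>Projection to the last coordinate has image \<open>J\<close> and kernel \<open>J R\<^sup>b\<close>.\<close>

lemma vectors_length:
  assumes "ideal J R"
  shows "len (vectors R J b) = enat b * ideal_len J"
proof (induction b)
  case 0
  show ?case unfolding vectors_0 V.length_zero by (simp add: zero_enat_def[symmetric])
next
  case (Suc b)
  interpret J: ideal J R by fact
  have ev: "(\<lambda>v. v b) \<in> submodule_maps R V (vectors R J (Suc b)) RR"
    by (rule submodule_mapsI) (auto simp: vectors_def)
  have ker: "{v \<in> vectors R J (Suc b). v b = \<zero>} = vectors R J b"
    using J.zero_closed by (auto simp: vectors_def less_Suc_eq le_Suc_eq Suc_le_eq)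
      (metis le_eq_less_or_eq)+
  have im: "(\<lambda>v. v b) ` vectors R J (Suc b) = J"
  proof
    show "J \<subseteq> (\<lambda>v. v b) ` vectors R J (Suc b)"
    proof
      fix a assume "a \<in> J"
      then show "a \<in> (\<lambda>v. v b) ` vectors R J (Suc b)"
        by (intro image_eqI[of _ _ "\<lambda>n. if n = b then a else \<zero>"]) (auto simp: vectors_def)
    qed
  qed (auto simp: vectors_def)
  have "len (vectors R J (Suc b)) = len (vectors R J b) + ideal_len J"
    using length_rank_nullity[OF V.module_axioms RR.module_axioms vectors_submodule[OF assms] ev]
    by (simp add: ker im)
  then show ?case using Suc.IH
    by (metis add.commute eSuc_enat mult_eSuc)
qed

end

section \<open>Local rings with radical cube zero\<close>

locale cube_zero_ring = coordinate_ring R for R (structure) +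
  fixes \<mm> :: "'a set"
  assumes maximal: "maximalideal \<mm> R"
    and noetherian: "noetherian_ring R"
    and cube: "\<mm> \<cdot> \<mm> \<cdot> \<mm> = {\<zero>}"
begin

lemma m_ideal: "ideal \<mm> R"
  using maximal by (simp add: maximalideal.axioms(1))

lemma m_carrier: "a \<in> \<mm> \<Longrightarrow> a \<in> carrier R"
  using m_ideal ideal.Icarr by metis

lemma m_mult: "a \<in> \<mm> \<Longrightarrow> c \<in> carrier R \<Longrightarrow> c \<otimes> a \<in> \<mm>"
  using m_ideal ideal.I_l_closed by metis

abbreviation msq where "msq \<equiv> \<mm> \<cdot> \<mm>"

lemma msq_ideal: "ideal msq R"
  by (rule ideal_prod_is_ideal[OF m_ideal m_ideal])

lemma msq_carrier: "a \<in> msq \<Longrightarrow> a \<in> carrier R"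
  using msq_ideal ideal.Icarr by metis

lemma msqI: "a \<in> \<mm> \<Longrightarrow> b \<in> \<mm> \<Longrightarrow> a \<otimes> b \<in> msq"
  by (rule ideal_prod.prod)

lemma msq_m_zero: "a \<in> msq \<Longrightarrow> b \<in> \<mm> \<Longrightarrow> a \<otimes> b = \<zero>"
  using ideal_prod.prod[of a msq b \<mm> R] cube by blast

lemma one_notin_m: "\<one> \<notin> \<mm>"
  using maximal ideal.one_imp_carrier[OF m_ideal] maximalideal.I_notcarr by metis

text \<open>By maximality of \<open>\<mm>\<close>, some \<open>1 - x\<close> with \<open>x\<close> in \<open>\<mm>\<close> is a multiple of \<open>a\<close>, and \<open>1 - x\<close> is
  invertible because \<open>x\<close> is nilpotent.\<close>

lemma unit_outside_m:
  assumes "a \<in> carrier R" "a \<notin> \<mm>"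
  obtains c where "c \<in> carrier R" "c \<otimes> a = \<one>"
proof -
  define J where "J = RR.adjoin \<mm> a"
  have msub: "submodule \<mm> R RR" using m_ideal ideal_submodule by blast
  have J: "submodule J R RR" "\<mm> \<subseteq> J" "a \<in> J"
    unfolding J_def using RR.adjoin_submodule[OF msub] assms by auto
  then have "J = carrier R"
    using maximalideal.I_maximal[OF maximal, of J] ideal_submodule[of J] assms
      ideal.Icarr[of J R] by blast
  then have "\<one> \<in> J" by simp
  then obtain x r where x: "x \<in> \<mm>" "r \<in> carrier R" "\<one> = x \<oplus> r \<otimes> a"
    unfolding J_def RR.adjoin_def by auto
  have xc: "x \<in> carrier R" using m_carrier x by blast
  have ra: "r \<otimes> a \<in> carrier R" using x assms by simp
  have r: "r \<otimes> a = \<one> \<ominus> x" using xc x(2,3) assms ra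
    by (metis add.m_comm add.inv_solve_right' a_minus_def one_closed)
  \<comment> \<open>the geometric series for the inverse of \<open>1 - x\<close> stops after three terms\<close>
  define u where "u = \<one> \<oplus> x \<oplus> x \<otimes> x"
  have uc: "u \<in> carrier R" using xc by (simp add: u_def)
  have "u \<otimes> (\<one> \<ominus> x) = \<one> \<ominus> (x \<otimes> x) \<otimes> x"
    unfolding u_def using xc by algebra
  also have "\<dots> = \<one>" using msq_m_zero[OF msqI[OF x(1) x(1)] x(1)] by (simp add: minus_eq)
  finally have "u \<otimes> (\<one> \<ominus> x) = \<one>" .
  moreover have "(u \<otimes> r) \<otimes> a = u \<otimes> (r \<otimes> a)" using uc x(2) assms by (simp add: m_assoc)
  ultimately have "(u \<otimes> r) \<otimes> a = \<one>" by (simp only: r)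
  then show ?thesis using that[of "u \<otimes> r"] uc x by auto
qed

text \<open>As \<open>\<mm>\<close> is nilpotent, every proper inclusion of modules contains a simple step.\<close>

lemma simple_step:
  assumes M: "module R M" and K: "submodule K R M" and N: "submodule N R M" and "K \<subset> N"
  obtains x where "x \<in> N" "x \<notin> K" "\<And>c. c \<in> \<mm> \<Longrightarrow> c \<odot>\<^bsub>M\<^esub> x \<in> K"
proof -
  interpret M: module R M by fact
  obtain x where x: "x \<in> N" "x \<notin> K" using \<open>K \<subset> N\<close> by blast
  have Nm: "y \<in> N \<Longrightarrow> c \<in> \<mm> \<Longrightarrow> c \<odot>\<^bsub>M\<^esub> y \<in> N" for c y using M.submoduleE(4)[OF N] m_carrier by blast
  show thesis
  proof (cases "\<forall>c\<in>\<mm>. c \<odot>\<^bsub>M\<^esub> x \<in> K")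
    case True
    then show thesis using that x by blast
  next
    case False
    then obtain c where c: "c \<in> \<mm>" "c \<odot>\<^bsub>M\<^esub> x \<notin> K" by blast
    show thesis
    proof (cases "\<forall>d\<in>\<mm>. d \<odot>\<^bsub>M\<^esub> (c \<odot>\<^bsub>M\<^esub> x) \<in> K")
      case True
      then show thesis using that[of "c \<odot>\<^bsub>M\<^esub> x"] x Nm c by blast
    next
      case False
      then obtain d where d: "d \<in> \<mm>" "d \<odot>\<^bsub>M\<^esub> (c \<odot>\<^bsub>M\<^esub> x) \<notin> K" by blast
      have "e \<odot>\<^bsub>M\<^esub> (d \<odot>\<^bsub>M\<^esub> (c \<odot>\<^bsub>M\<^esub> x)) \<in> K" if e: "e \<in> \<mm>" for e
      proof -
        have cc: "e \<in> carrier R" "d \<in> carrier R" "c \<in> carrier R" "x \<in> carrier M"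
          using e d c m_carrier x M.submodule_sub[OF N] by auto
        have "(e \<otimes> d) \<otimes> c = \<zero>" using msq_m_zero[OF msqI] e d c by blast
        then have "e \<odot>\<^bsub>M\<^esub> (d \<odot>\<^bsub>M\<^esub> (c \<odot>\<^bsub>M\<^esub> x)) = \<zero>\<^bsub>M\<^esub>"
          using M.smult_assoc1[of "e \<otimes> d" c x] M.smult_assoc1[of e d "c \<odot>\<^bsub>M\<^esub> x"] cc by simp
        then show ?thesis using M.submodule_zero[OF K] by simp
      qed
      then show thesis using that[OF Nm[OF Nm[OF x(1) c(1)] d(1)] d(2)] by blast
    qed
  qed
qed

lemma scalar_in_m:
  assumes "module R M" "submodule K R M" "x \<in> carrier M" "x \<notin> K" "a \<in> carrier R" "a \<odot>\<^bsub>M\<^esub> x \<in> K"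
  shows "a \<in> \<mm>"
proof (rule ccontr)
  interpret M: module R M by fact
  assume "a \<notin> \<mm>"
  then obtain c where c: "c \<in> carrier R" "c \<otimes> a = \<one>" using unit_outside_m assms by metis
  have "c \<odot>\<^bsub>M\<^esub> (a \<odot>\<^bsub>M\<^esub> x) \<in> K" using M.submoduleE(4)[OF assms(2) c(1)] assms by blast
  then show False using assms c by (metis M.smult_assoc1 M.smult_one)
qed

text \<open>The scalars that take \<open>x\<close> into \<open>K\<close> lie in \<open>\<mm>\<close>, so \<open>x\<close> can be sent to any \<open>z\<close> killed by \<open>\<mm>\<close>
  while \<open>K\<close> goes to zero.\<close>

lemma simple_quotient_map:
  assumes M: "module R M" and N: "module R N" and K: "submodule K R M"
    and x: "x \<in> carrier M" "x \<notin> K"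
    and z: "z \<in> carrier N" "\<And>c. c \<in> \<mm> \<Longrightarrow> c \<odot>\<^bsub>N\<^esub> z = \<zero>\<^bsub>N\<^esub>"
  obtains \<pi> where "\<pi> \<in> submodule_maps R M (module.adjoin R M K x) N"
    "\<And>k a. k \<in> K \<Longrightarrow> a \<in> carrier R \<Longrightarrow> \<pi> (k \<oplus>\<^bsub>M\<^esub> a \<odot>\<^bsub>M\<^esub> x) = a \<odot>\<^bsub>N\<^esub> z"
proof -
  interpret M: module R M by fact
  interpret N: module R N by fact
  have f: "(\<lambda>k. \<zero>\<^bsub>N\<^esub>) \<in> submodule_maps R M K N" by (rule submodule_mapsI) auto
  have g: "(\<lambda>a. a \<odot>\<^bsub>M\<^esub> x) \<in> submodule_maps R RR (carrier RR) M"
    by (rule submodule_mapsI) (use x in \<open>auto simp: M.smult_l_distr M.smult_assoc1\<close>)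
  have F: "(\<lambda>a. a \<odot>\<^bsub>N\<^esub> z) \<in> submodule_maps R RR (carrier RR) N"
    by (rule submodule_mapsI) (use z in \<open>auto simp: N.smult_l_distr N.smult_assoc1\<close>)
  have "\<forall>a\<in>carrier RR. a \<odot>\<^bsub>M\<^esub> x \<in> K \<longrightarrow> a \<odot>\<^bsub>N\<^esub> z = \<zero>\<^bsub>N\<^esub>"
    using z(2) scalar_in_m[OF M K x] by simp
  from glue_maps[OF M N regular_module K RR.carrier_is_submodule f g F this]
  obtain \<pi> where \<pi>: "\<pi> \<in> submodule_maps R M {k \<oplus>\<^bsub>M\<^esub> a \<odot>\<^bsub>M\<^esub> x | k a. k \<in> K \<and> a \<in> carrier RR} N"
    "\<forall>k\<in>K. \<forall>a\<in>carrier RR. \<pi> (k \<oplus>\<^bsub>M\<^esub> a \<odot>\<^bsub>M\<^esub> x) = \<zero>\<^bsub>N\<^esub> \<oplus>\<^bsub>N\<^esub> a \<odot>\<^bsub>N\<^esub> z" by blast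
  show thesis
    by (rule that[of \<pi>]) (use \<pi> z(1) in \<open>auto simp: M.adjoin_def\<close>)
qed

lemma simple_length_le:
  assumes N: "module R N" and z: "z \<in> carrier N" "\<And>c. c \<in> \<mm> \<Longrightarrow> c \<odot>\<^bsub>N\<^esub> z = \<zero>\<^bsub>N\<^esub>"
  shows "module_length R N (module.adjoin R N {\<zero>\<^bsub>N\<^esub>} z) \<le> 1"
proof -
  interpret N: module R N by fact
  show ?thesis
  proof (rule N.length_leI)
    fix n assume n: "has_chain R N n (N.adjoin {\<zero>\<^bsub>N\<^esub>} z)"
    show "enat n \<le> 1"
    proof (rule ccontr)
      assume "\<not> enat n \<le> 1"
      then obtain m where "n = Suc (Suc m)" by (cases n; cases "n - 1") (auto simp: one_enat_def)
      then obtain Y W where Y: "submodule Y R N" "Y \<subset> N.adjoin {\<zero>\<^bsub>N\<^esub>} z" and W: "submodule W R N" "W \<subset> Y"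
        using n by auto
      then obtain y where y: "y \<in> Y" "y \<noteq> \<zero>\<^bsub>N\<^esub>" using N.submodule_zero[OF W(1)] by blast
      then obtain a where a: "a \<in> carrier R" "y = a \<odot>\<^bsub>N\<^esub> z" using Y(2) z(1) unfolding N.adjoin_def by force
      then have "z \<in> Y"
        using scalar_in_m[OF N Y(1) z(1) _ a(1)] z(2) y by blast
      then have "N.adjoin {\<zero>\<^bsub>N\<^esub>} z \<subseteq> Y" by (intro N.adjoin_least[OF Y(1)]) (use N.submodule_zero[OF Y(1)] in auto)
      then show False using Y(2) by blast
    qed
  qed
qed

text \<open>If \<open>x\<close> is not in \<open>K\<close>, sending it to a nonzero element of \<open>R\<close> that is killed by \<open>\<mm>\<close> embeds the
  quotient by \<open>K\<close> into a simple module.\<close>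

lemma length_adjoin_le:
  assumes M: "module R M" and K: "submodule K R M" and x: "x \<in> carrier M"
    and mx: "\<And>c. c \<in> \<mm> \<Longrightarrow> c \<odot>\<^bsub>M\<^esub> x \<in> K"
  shows "module_length R M (module.adjoin R M K x) \<le> module_length R M K + 1"
proof -
  interpret M: module R M by fact
  show ?thesis
  proof (cases "x \<in> K")
    case True
    have "module_length R M (M.adjoin K x) \<le> module_length R M K"
      by (rule M.length_mono[OF M.adjoin_least[OF K order_refl True]])
    also have "\<dots> \<le> module_length R M K + 1" by simp
    finally show ?thesis .
  next
    case False
    note ad = M.adjoin_submodule[OF K x]
    have z0: "submodule {\<zero>\<^bsub>RR\<^esub>} R RR" by (rule RR.submodule_zero_set)
    have "\<one> \<noteq> \<zero>" using one_notin_m m_ideal additive_subgroup.zero_closed ideal.axioms(1) by metis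
    then have "{\<zero>\<^bsub>RR\<^esub>} \<subset> carrier RR" using one_closed by auto
    then obtain z where z: "z \<in> carrier RR" "z \<notin> {\<zero>\<^bsub>RR\<^esub>}" "\<And>c. c \<in> \<mm> \<Longrightarrow> c \<odot>\<^bsub>RR\<^esub> z \<in> {\<zero>\<^bsub>RR\<^esub>}"
      using simple_step[OF regular_module z0 RR.carrier_is_submodule] by blast
    then have mz: "\<And>c. c \<in> \<mm> \<Longrightarrow> c \<odot>\<^bsub>RR\<^esub> z = \<zero>\<^bsub>RR\<^esub>" by blast
    obtain \<pi> where \<pi>: "\<pi> \<in> submodule_maps R M (M.adjoin K x) RR"
      "\<And>k a. k \<in> K \<Longrightarrow> a \<in> carrier R \<Longrightarrow> \<pi> (k \<oplus>\<^bsub>M\<^esub> a \<odot>\<^bsub>M\<^esub> x) = a \<odot>\<^bsub>RR\<^esub> z"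
      using simple_quotient_map[OF M regular_module K x False z(1) mz] by blast
    have ker: "{u \<in> M.adjoin K x. \<pi> u = \<zero>\<^bsub>RR\<^esub>} \<subseteq> K"
    proof
      fix u assume u: "u \<in> {u \<in> M.adjoin K x. \<pi> u = \<zero>\<^bsub>RR\<^esub>}"
      then obtain k a where ka: "k \<in> K" "a \<in> carrier R" "u = k \<oplus>\<^bsub>M\<^esub> a \<odot>\<^bsub>M\<^esub> x" unfolding M.adjoin_def by blast
      then have "a \<odot>\<^bsub>RR\<^esub> z \<in> {\<zero>\<^bsub>RR\<^esub>}" using u \<pi>(2)[OF ka(1,2)] by simp
      then have "a \<in> \<mm>" by (rule scalar_in_m[OF regular_module z0 z(1,2) ka(2)])
      then show "u \<in> K" using ka mx M.submoduleE(5)[OF K] by blast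
    qed
    have "\<pi> ` M.adjoin K x \<subseteq> RR.adjoin {\<zero>\<^bsub>RR\<^esub>} z"
    proof
      fix v assume "v \<in> \<pi> ` M.adjoin K x"
      then obtain k a where ka: "k \<in> K" "a \<in> carrier R" "v = a \<odot>\<^bsub>RR\<^esub> z" using \<pi>(2) unfolding M.adjoin_def by blast
      show "v \<in> RR.adjoin {\<zero>\<^bsub>RR\<^esub>} z"
        unfolding ka(3) by (rule RR.submoduleE(4)[OF _ ka(2)]) (use RR.adjoin_submodule[OF z0 z(1)] in auto)
    qed
    then have "ideal_len (\<pi> ` M.adjoin K x) \<le> 1"
      using RR.length_mono simple_length_le[OF regular_module z(1) mz] order_trans by blast
    then show ?thesis
      unfolding length_rank_nullity[OF M regular_module ad(1) \<pi>(1)] by (intro add_mono M.length_mono[OF ker])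
  qed
qed

text \<open>Submodules of a module of finite length satisfy the ascending chain condition.\<close>

lemma maximal_submodule:
  assumes M: "module R M" and K: "submodule K0 R M" "K0 \<subseteq> N" "Q K0" and fin: "module_length R M N \<noteq> \<infinity>"
  obtains K where "submodule K R M" "K \<subseteq> N" "Q K"
    "\<And>K'. submodule K' R M \<Longrightarrow> K \<subset> K' \<Longrightarrow> K' \<subseteq> N \<Longrightarrow> \<not> Q K'"
proof -
  interpret M: module R M by fact
  obtain n where n: "module_length R M N = enat n" using fin by auto
  have le: "\<exists>k\<le>n. module_length R M K = enat k" if "K \<subseteq> N" for K
    using M.length_mono[OF that] n by (cases "module_length R M K") auto
  define P where "P = (\<lambda>K. submodule K R M \<and> K \<subseteq> N \<and> Q K)"
  have PK0: "P K0" using K by (simp add: P_def)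
  have bound: "\<forall>K. P K \<longrightarrow> the_enat (module_length R M K) < Suc n"
  proof (intro allI impI)
    fix K assume "P K"
    then obtain k where "k \<le> n" "module_length R M K = enat k" using le P_def by blast
    then show "the_enat (module_length R M K) < Suc n" by simp
  qed
  have "\<exists>K. P K \<and> (\<forall>K'. P K' \<longrightarrow> the_enat (module_length R M K') \<le> the_enat (module_length R M K))"
    by (rule ex_has_greatest_nat[where P = P and k = K0 and b = "Suc n"]) (fact PK0, fact bound)
  then obtain K where PK: "P K"
    and mx: "\<And>K'. P K' \<Longrightarrow> the_enat (module_length R M K') \<le> the_enat (module_length R M K)" by blast
  show thesis
  proof (rule that[of K])
    fix K' assume K': "submodule K' R M" "K \<subset> K'" "K' \<subseteq> N"
    show "\<not> Q K'"
    proof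
      assume "Q K'"
      then have "the_enat (module_length R M K') \<le> the_enat (module_length R M K)"
        using K' mx by (simp add: P_def)
      moreover have "module_length R M K + 1 \<le> module_length R M K'"
        using M.length_strict_mono[of K K'] PK K' by (simp add: P_def)
      moreover obtain k where "module_length R M K = enat k" using le PK P_def by blast
      moreover obtain k' where "module_length R M K' = enat k'" using le K' by blast
      ultimately show False by (simp add: one_enat_def)
    qed
  qed (use PK P_def in auto)
qed

lemma adjoin_finite_set:
  assumes M: "module R M" and K: "submodule K R M" and "finite A" "A \<subseteq> carrier M"
    and mA: "\<And>c x. c \<in> \<mm> \<Longrightarrow> x \<in> A \<Longrightarrow> c \<odot>\<^bsub>M\<^esub> x \<in> K"
  shows "\<exists>N. submodule N R M \<and> K \<subseteq> N \<and> A \<subseteq> N \<and> module_length R M N \<le> module_length R M K + enat (card A)"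
  using assms(3-)
proof (induction A rule: finite_induct)
  case empty
  then show ?case using K by (auto simp: zero_enat_def[symmetric])
next
  case (insert x A)
  interpret M: module R M by fact
  obtain N where N: "submodule N R M" "K \<subseteq> N" "A \<subseteq> N"
    "module_length R M N \<le> module_length R M K + enat (card A)"
    using insert by auto
  have "module_length R M (M.adjoin N x) \<le> module_length R M N + 1"
    by (rule length_adjoin_le[OF M N(1)]) (use insert N in auto)
  also have "\<dots> \<le> module_length R M K + enat (card A) + 1" using N by (rule_tac add_right_mono)
  also have "\<dots> = module_length R M K + enat (card (insert x A))"
    using insert by (simp add: add.assoc one_enat_def)
  finally have "module_length R M (M.adjoin N x) \<le> \<dots>" .
  then show ?case using M.adjoin_submodule[OF N(1), of x] N insert.prems by (meson insert_subset order_trans)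
qed

lemma ideal_length_step:
  assumes K: "ideal K R" and J: "ideal J R" and fin: "ideal_len K \<noteq> \<infinity>"
    and mJ: "\<And>c x. c \<in> \<mm> \<Longrightarrow> x \<in> J \<Longrightarrow> c \<otimes> x \<in> K"
  shows "ideal_len J \<noteq> \<infinity>"
proof -
  obtain A where A: "A \<subseteq> carrier R" "finite A" "J = Idl A"
    using noetherian_ring.finetely_gen[OF noetherian J] by blast
  have AJ: "A \<subseteq> J" using A genideal_self by blast
  have "\<exists>N. submodule N R RR \<and> K \<subseteq> N \<and> A \<subseteq> N \<and> ideal_len N \<le> ideal_len K + enat (card A)"
    by (rule adjoin_finite_set[OF regular_module]) (use K A AJ mJ ideal_submodule in auto)
  then obtain N where N: "submodule N R RR" "A \<subseteq> N"
    "ideal_len N \<le> ideal_len K + enat (card A)" by blast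
  have "J \<subseteq> N" unfolding A(3) by (rule genideal_minimal) (use N ideal_submodule in auto)
  then have "ideal_len J \<le> ideal_len K + enat (card A)" using N RR.length_mono order_trans by blast
  moreover obtain k where "ideal_len K = enat k" using fin by auto
  ultimately have "ideal_len J \<le> enat (k + card A)" by simp
  then show ?thesis using enat_ile by fastforce
qed

lemma ideal_len_carrier: "ideal_len (carrier R) = ideal_len \<mm> + 1"
proof (rule antisym)
  have msub: "submodule \<mm> R RR" using m_ideal ideal_submodule by blast
  have "carrier R \<subseteq> RR.adjoin \<mm> \<one>"
  proof
    fix a assume "a \<in> carrier R"
    then show "a \<in> RR.adjoin \<mm> \<one>"
      using RR.adjoin_submodule(1,3)[OF msub, of \<one>] RR.submoduleE(4)[of "RR.adjoin \<mm> \<one>" a \<one>] by simp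
  qed
  then have "ideal_len (carrier R) \<le> ideal_len (RR.adjoin \<mm> \<one>)" by (rule RR.length_mono)
  also have "\<dots> \<le> ideal_len \<mm> + 1"
    by (rule length_adjoin_le[OF regular_module msub]) (use m_carrier in auto)
  finally show "ideal_len (carrier R) \<le> ideal_len \<mm> + 1" .
  show "ideal_len \<mm> + 1 \<le> ideal_len (carrier R)"
    by (rule RR.length_strict_mono[OF msub]) (use m_carrier one_notin_m in blast)
qed

text \<open>Each step of \<open>0 \<subseteq> \<mm>\<^sup>2 \<subseteq> \<mm> \<subseteq> R\<close> has a finitely generated quotient that is killed by \<open>\<mm>\<close>.\<close>

lemma finite_length: "ideal_len (carrier R) \<noteq> \<infinity>"
proof -
  have "ideal_len {\<zero>} \<noteq> \<infinity>" using RR.length_zero by simp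
  then have "ideal_len msq \<noteq> \<infinity>"
  proof (rule ideal_length_step[OF zeroideal msq_ideal])
    fix c x assume "c \<in> \<mm>" "x \<in> msq"
    then show "c \<otimes> x \<in> {\<zero>}" using msq_m_zero[of x c] m_comm[of c x] m_carrier msq_carrier by simp
  qed
  then have "ideal_len \<mm> \<noteq> \<infinity>"
    by (rule ideal_length_step[OF msq_ideal m_ideal]) (use msqI in auto)
  then show ?thesis unfolding ideal_len_carrier by (auto simp: one_enat_def)
qed

lemma ideal_len_finite: "J \<subseteq> carrier R \<Longrightarrow> ideal_len J \<noteq> \<infinity>"
  using finite_length RR.length_mono[of J "carrier R"] enat_ile by (metis not_infinity_eq)

lemma vectors_len_finite: "P \<subseteq> free b \<Longrightarrow> len P \<noteq> \<infinity>"
proof -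
  assume "P \<subseteq> free b"
  then have "len P \<le> enat b * ideal_len (carrier R)"
    using vectors_length[OF oneideal, of b] V.length_mono[of P "free b"] by simp
  then show ?thesis using finite_length
    by (metis enat_ile enat.distinct(1) not_infinity_eq times_enat_simps(1))
qed

subsection \<open>The socle and self-injectivity\<close>

definition socle :: "'a set" where
  "socle = {a \<in> carrier R. \<forall>c\<in>\<mm>. c \<otimes> a = \<zero>}"

lemma socle_ideal: "ideal socle R"
proof -
  have "submodule socle R RR"
    by (rule RR.submoduleI')
      (auto simp: socle_def r_distr m_carrier m_lcomm)
  then show ?thesis using ideal_submodule by blast
qed

lemma msq_sub_socle: "msq \<subseteq> socle"
  using msq_m_zero msq_carrier m_carrier m_comm by (auto simp: socle_def)

definition annihilator :: "'a set \<Rightarrow> 'a set" where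
  "annihilator J = {z \<in> carrier R. \<forall>a\<in>J. z \<otimes> a = \<zero>}"

lemma annihilator_submodule: "J \<subseteq> carrier R \<Longrightarrow> submodule (annihilator J) R RR"
  by (rule RR.submoduleI') (auto simp: annihilator_def l_distr m_assoc subset_iff)

lemma annihilator_adjoin:
  assumes "J \<subseteq> carrier R" "a \<in> carrier R" "\<zero> \<in> J"
  shows "annihilator (RR.adjoin J a) = {z \<in> annihilator J. z \<otimes> a = \<zero>}"
proof (intro equalityI subsetI)
  fix z assume z: "z \<in> annihilator (RR.adjoin J a)"
  then have zc: "z \<in> carrier R" by (simp add: annihilator_def)
  have "z \<otimes> k = \<zero>" if "k \<in> J" for k
  proof -
    have "k \<oplus> \<zero> \<otimes> a \<in> RR.adjoin J a" using RR.adjoinI[OF that, of \<zero> a] by simp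
    then show ?thesis using z assms that by (auto simp: annihilator_def subset_iff)
  qed
  moreover have "z \<otimes> a = \<zero>"
  proof -
    have "\<zero> \<oplus> \<one> \<otimes> a \<in> RR.adjoin J a" using RR.adjoinI[OF assms(3), of \<one> a] by simp
    then show ?thesis using z assms by (auto simp: annihilator_def)
  qed
  ultimately show "z \<in> {z \<in> annihilator J. z \<otimes> a = \<zero>}" using zc by (simp add: annihilator_def)
next
  fix z assume z: "z \<in> {z \<in> annihilator J. z \<otimes> a = \<zero>}"
  then show "z \<in> annihilator (RR.adjoin J a)"
    using assms by (auto simp: annihilator_def RR.adjoin_def r_distr subset_iff m_lcomm)
qed

end

text \<open>A principal socle makes the ring self-injective, hence Gorenstein.\<close>

locale principal_socle_ring = cube_zero_ring +
  fixes s assumes s: "s \<in> socle" and socle_eq: "socle = {a \<otimes> s | a. a \<in> carrier R}"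
begin

lemma s_carrier: "s \<in> carrier R"
  using s by (simp add: socle_def)

lemma socle_length: "ideal_len socle \<le> 1"
proof -
  have "socle \<subseteq> RR.adjoin {\<zero>} s"
  proof
    fix t assume "t \<in> socle"
    then obtain a where "a \<in> carrier R" "t = \<zero> \<oplus> a \<otimes> s" using socle_eq s_carrier by auto
    then show "t \<in> RR.adjoin {\<zero>} s" using RR.adjoinI[of \<zero> "{\<zero>}" a s] by simp
  qed
  then have "ideal_len socle \<le> ideal_len (RR.adjoin {\<zero>} s)" by (rule RR.length_mono)
  also have "\<dots> \<le> 1"
    using simple_length_le[OF regular_module, of s] s by (simp add: socle_def)
  finally show ?thesis .
qed

text \<open>Multiplication by \<open>a\<close> maps the annihilator of \<open>J\<close> to the socle, with the annihilator of
  \<open>J + R a\<close> as its kernel.\<close>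

lemma annihilator_step:
  assumes J: "ideal J R" and a: "a \<in> carrier R" and ma: "\<And>c. c \<in> \<mm> \<Longrightarrow> c \<otimes> a \<in> J"
  shows "ideal_len (annihilator J) \<le> ideal_len (annihilator (RR.adjoin J a)) + 1"
proof -
  have Jc: "J \<subseteq> carrier R" using J by (simp add: ideal.Icarr subsetI)
  have z: "\<zero> \<in> J" using J by (simp add: additive_subgroup.zero_closed ideal.axioms(1))
  have f: "(\<lambda>z. z \<otimes> a) \<in> submodule_maps R RR (annihilator J) RR"
    by (rule submodule_mapsI) (use a in \<open>auto simp: annihilator_def l_distr m_assoc\<close>)
  have "(\<lambda>z. z \<otimes> a) ` annihilator J \<subseteq> socle"
    using a ma m_carrier by (auto simp: annihilator_def socle_def m_lcomm)
  then have "ideal_len ((\<lambda>z. z \<otimes> a) ` annihilator J) \<le> 1"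
    using RR.length_mono socle_length order_trans by blast
  then show ?thesis
    using length_rank_nullity[OF regular_module regular_module annihilator_submodule[OF Jc] f]
    by (simp add: annihilator_adjoin[OF Jc a z] add_left_mono)
qed

lemma annihilator_length_mono:
  assumes "ideal J R" "ideal K R" "J \<subseteq> K"
  shows "ideal_len (annihilator J) + ideal_len J \<le> ideal_len (annihilator K) + ideal_len K"
proof -
  have Ks: "submodule K R RR" using assms ideal_submodule by blast
  obtain n where n: "ideal_len K = enat n"
    using ideal_len_finite[of K] RR.submoduleE(1)[OF Ks] by auto
  have "ideal_len (annihilator J) + ideal_len J \<le> ideal_len (annihilator K) + ideal_len K"
    if "ideal_len K \<le> ideal_len J + enat d" "ideal J R" "J \<subseteq> K" for d J
    using that
  proof (induction d arbitrary: J)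
    case 0
    then have "J = K"
      using RR.length_eq_imp_eq[of J K] ideal_submodule n RR.length_mono[of J K]
      by (auto simp: zero_enat_def[symmetric])
    then show ?case by simp
  next
    case (Suc d)
    show ?case
    proof (cases "J = K")
      case False
      have Js: "submodule J R RR" using Suc ideal_submodule by blast
      obtain a where a: "a \<in> K" "a \<notin> J" "\<And>c. c \<in> \<mm> \<Longrightarrow> c \<otimes> a \<in> J"
        using simple_step[OF regular_module Js Ks] False Suc.prems by auto
      have ac: "a \<in> carrier R" using a(1) RR.submodule_sub[OF Ks] by simp
      define J' where "J' = RR.adjoin J a"
      have J': "submodule J' R RR" "J \<subset> J'"
        unfolding J'_def using RR.adjoin_submodule[OF Js, of a] ac a(2) by auto
      have J'K: "J' \<subseteq> K" unfolding J'_def using RR.adjoin_least[OF Ks] Suc.prems a by blast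
      have l: "ideal_len J + 1 \<le> ideal_len J'" using RR.length_strict_mono[OF Js J'(2)] .
      have "ideal_len K \<le> ideal_len J + enat (Suc d)" by (rule Suc.prems)
      also have "\<dots> = ideal_len J + 1 + enat d" by (simp add: add.assoc one_enat_def)
      also have "\<dots> \<le> ideal_len J' + enat d" using l by (rule add_right_mono)
      finally have IH: "ideal_len (annihilator J') + ideal_len J' \<le> ideal_len (annihilator K) + ideal_len K"
        using Suc.IH[of J'] J' J'K ideal_submodule by blast
      have "ideal_len (annihilator J) + ideal_len J \<le> ideal_len (annihilator J') + 1 + ideal_len J"
        using annihilator_step[OF Suc.prems(2) ac a(3)] unfolding J'_def by (rule add_right_mono)
      also have "\<dots> = ideal_len (annihilator J') + (ideal_len J + 1)" by (simp add: ac_simps)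
      also have "\<dots> \<le> ideal_len (annihilator J') + ideal_len J'" using l by (rule add_left_mono)
      finally show ?thesis using IH by (rule order_trans)
    qed simp
  qed
  from this[of J n] show ?thesis using assms n by (metis add_increasing i0_lb order_refl)
qed

text \<open>From \<open>0\<close> to \<open>R\<close> the annihilator has to shrink from \<open>R\<close> to \<open>0\<close>, but along a simple step it shrinks
  by at most one. So its length drops by exactly one along every simple step.\<close>

lemma annihilator_length:
  assumes "ideal J R"
  shows "ideal_len (annihilator J) + ideal_len J = ideal_len (carrier R)"
proof (rule antisym)
  have "annihilator (carrier R) = {\<zero>}" by (auto simp: annihilator_def dest: bspec[OF _ one_closed])
  then show "ideal_len (annihilator J) + ideal_len J \<le> ideal_len (carrier R)"
    using annihilator_length_mono[OF assms oneideal] RR.length_zero assms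
    by (simp add: ideal.Icarr subsetI)
  have "annihilator {\<zero>} = carrier R" by (auto simp: annihilator_def)
  then show "ideal_len (carrier R) \<le> ideal_len (annihilator J) + ideal_len J"
    using annihilator_length_mono[OF zeroideal assms] RR.length_zero assms
    by (simp add: additive_subgroup.zero_closed ideal.axioms(1))
qed

lemma annihilator_separates:
  assumes J: "ideal J R" and a: "a \<in> carrier R" "a \<notin> J"
  obtains z where "z \<in> annihilator J" "z \<otimes> a \<noteq> \<zero>"
proof (rule ccontr)
  assume "\<not> thesis"
  then have no: "\<And>z. z \<in> annihilator J \<Longrightarrow> z \<otimes> a = \<zero>" using that by blast
  have Js: "submodule J R RR" using J ideal_submodule by blast
  define J' where "J' = RR.adjoin J a"
  have J': "submodule J' R RR" "J \<subset> J'"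
    unfolding J'_def using RR.adjoin_submodule[OF Js, of a] a by auto
  have "annihilator J' = annihilator J" unfolding J'_def
    using annihilator_adjoin[of J a] no a RR.submodule_zero[OF Js] RR.submoduleE(1)[OF Js] by auto
  then have "ideal_len (annihilator J) + ideal_len J' = ideal_len (annihilator J) + ideal_len J"
    using annihilator_length[of J'] annihilator_length[OF J] J'(1) ideal_submodule by simp
  moreover have "ideal_len (annihilator J) \<noteq> \<infinity>"
    by (rule ideal_len_finite) (auto simp: annihilator_def)
  ultimately have "ideal_len J' = ideal_len J" by (simp add: enat_add_left_cancel)
  moreover have "ideal_len J \<noteq> \<infinity>" using ideal_len_finite[of J] J by (simp add: ideal.Icarr subsetI)
  ultimately show False using RR.length_strict_mono[OF Js J'(2)]
    by (cases "ideal_len J") (auto simp: one_enat_def)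
qed

text \<open>Baer's criterion for the ideal \<open>\<mm>\<close>. Take a largest ideal inside \<open>\<mm>\<close> on which \<open>f\<close> is multiplication
  by some element; if it could be enlarged by a simple step, the separation of ideals by their
  annihilators would correct the multiplier.\<close>

lemma m_hom_is_multiplication:
  assumes f: "f \<in> submodule_maps R RR \<mm> RR"
  obtains y where "y \<in> carrier R" "\<And>x. x \<in> \<mm> \<Longrightarrow> f x = y \<otimes> x"
proof -
  note D = submodule_mapsD[OF f, simplified]
  have ms: "submodule \<mm> R RR" using m_ideal ideal_submodule by blast
  define Q where "Q = (\<lambda>J. \<exists>y\<in>carrier R. \<forall>x\<in>J. f x = y \<otimes> x)"
  have f0: "f \<zero> = \<zero>" using submodule_map_zero[OF regular_module regular_module ms f] by simp
  then have Q0: "Q {\<zero>}" unfolding Q_def by (intro bexI[of _ \<zero>]) auto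
  have sub0: "submodule {\<zero>} R RR" "{\<zero>} \<subseteq> \<mm>"
    using zeroideal ideal_submodule RR.submodule_zero[OF ms] by auto
  have fin: "ideal_len \<mm> \<noteq> \<infinity>" by (rule ideal_len_finite) (use m_carrier in auto)
  obtain J where J: "submodule J R RR" "J \<subseteq> \<mm>" "Q J"
    and mx: "\<And>K. submodule K R RR \<Longrightarrow> J \<subset> K \<Longrightarrow> K \<subseteq> \<mm> \<Longrightarrow> \<not> Q K"
    using maximal_submodule[where Q = Q, OF regular_module sub0 Q0 fin] by blast
  obtain y where y: "y \<in> carrier R" "\<And>x. x \<in> J \<Longrightarrow> f x = y \<otimes> x" using J Q_def by blast
  have "J = \<mm>"
  proof (rule ccontr)
    assume "J \<noteq> \<mm>"
    then obtain a where a: "a \<in> \<mm>" "a \<notin> J" "\<And>c. c \<in> \<mm> \<Longrightarrow> c \<otimes> a \<in> J"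
      using simple_step[OF regular_module J(1) ms] J by auto
    have ac: "a \<in> carrier R" "f a \<in> carrier R" using a m_carrier D(1) by auto
    \<comment> \<open>the error of \<open>y\<close> at \<open>a\<close> lies in the socle, and an element of the annihilator of \<open>J\<close> corrects it\<close>
    define w where "w = f a \<ominus> y \<otimes> a"
    have wc: "w \<in> carrier R" using ac y by (simp add: w_def)
    have "w \<in> socle"
    proof -
      have "c \<otimes> w = \<zero>" if c: "c \<in> \<mm>" for c
      proof -
        have cc: "c \<in> carrier R" using c m_carrier by blast
        have "c \<otimes> w = c \<otimes> f a \<ominus> y \<otimes> (c \<otimes> a)" unfolding w_def using ac y cc by algebra
        also have "c \<otimes> f a = f (c \<otimes> a)" using D(3)[OF cc a(1)] by simp
        also have "\<dots> = y \<otimes> (c \<otimes> a)" using y(2) a(3)[OF c] .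
        finally show ?thesis using y cc ac by (simp add: minus_eq r_neg)
      qed
      then show ?thesis using wc by (simp add: socle_def)
    qed
    then obtain r where r: "r \<in> carrier R" "w = r \<otimes> s" using socle_eq by auto
    obtain z where z: "z \<in> annihilator J" "z \<otimes> a \<noteq> \<zero>"
      using annihilator_separates[of J a] J ac a ideal_submodule by blast
    have zc: "z \<in> carrier R" using z by (simp add: annihilator_def)
    have "c \<otimes> (z \<otimes> a) = \<zero>" if "c \<in> \<mm>" for c
      using z(1) a(3)[OF that] m_lcomm[of c z a] zc ac m_carrier[OF that] by (simp add: annihilator_def)
    then have "z \<otimes> a \<in> socle" using zc ac by (simp add: socle_def)
    then obtain r' where r': "r' \<in> carrier R" "z \<otimes> a = r' \<otimes> s" using socle_eq by auto
    have "r' \<notin> \<mm>" using r' z s by (auto simp: socle_def)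
    then obtain u where u: "u \<in> carrier R" "u \<otimes> r' = \<one>" using unit_outside_m r' by metis
    have "r \<otimes> u \<otimes> (z \<otimes> a) = r \<otimes> (u \<otimes> r') \<otimes> s"
      unfolding r'(2) using r(1) r'(1) u(1) s_carrier by algebra
    then have eq: "r \<otimes> u \<otimes> (z \<otimes> a) = w" using u r by simp
    define y' where "y' = y \<oplus> r \<otimes> u \<otimes> z"
    have y': "y' \<in> carrier R" using y r u zc by (simp add: y'_def)
    have yJ: "f k = y' \<otimes> k" if k: "k \<in> J" for k
    proof -
      have kc: "k \<in> carrier R" using RR.submodule_sub[OF J(1) k] by simp
      have "z \<otimes> k = \<zero>" using z k by (auto simp: annihilator_def)
      moreover have "y' \<otimes> k = y \<otimes> k \<oplus> r \<otimes> u \<otimes> (z \<otimes> k)" unfolding y'_def using y r u zc kc by algebra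
      ultimately show ?thesis using y k kc r u by simp
    qed
    have ya: "f a = y' \<otimes> a"
    proof -
      have "y' \<otimes> a = y \<otimes> a \<oplus> r \<otimes> u \<otimes> (z \<otimes> a)" unfolding y'_def using y r u zc ac by algebra
      also have "\<dots> = y \<otimes> a \<oplus> (f a \<ominus> y \<otimes> a)" unfolding eq w_def ..
      also have "\<dots> = f a" using ac y by algebra
      finally show ?thesis by simp
    qed
    have "f x = y' \<otimes> x" if x: "x \<in> RR.adjoin J a" for x
    proof -
      obtain k c where kc: "k \<in> J" "c \<in> carrier R" "x = k \<oplus> c \<otimes> a"
        using x unfolding RR.adjoin_def by auto
      have kR: "k \<in> carrier R" using RR.submodule_sub[OF J(1) kc(1)] by simp
      have "f x = f k \<oplus> c \<otimes> f a"
        using D(2)[of k "c \<otimes> a"] D(3)[OF kc(2) a(1)] kc J a m_mult by auto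
      also have "\<dots> = y' \<otimes> x" unfolding yJ[OF kc(1)] ya kc(3) using y' kR kc ac by algebra
      finally show ?thesis .
    qed
    then have "Q (RR.adjoin J a)" unfolding Q_def using y' by blast
    moreover have "RR.adjoin J a \<subseteq> \<mm>" using RR.adjoin_least[OF ms J(2) a(1)] .
    ultimately show False using mx[of "RR.adjoin J a"] RR.adjoin_submodule[OF J(1), of a] ac a(2) by auto
  qed
  then show thesis using that y by blast
qed


text \<open>The graphs of partial extensions are closed under unions of chains, so Zorn's lemma gives a
  maximal one. If its domain \<open>K\<close> were proper, there would be a simple step from \<open>K\<close> to \<open>K + R x\<close>, where
  the condition on the value of \<open>x\<close> concerns only the map \<open>\<mm> \<rightarrow> R\<close> induced by scaling \<open>x\<close>: the ideal
  \<open>\<mm>\<close> is the only case of Baer's criterion that occurs.\<close>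

lemma functional_extends:
  assumes N: "module R N" and L: "submodule L R N" and g: "g \<in> submodule_maps R N L RR"
  obtains h where "h \<in> linear_maps R N RR" "\<And>x. x \<in> L \<Longrightarrow> h x = g x"
proof -
  interpret N: module R N by fact
  define graph where "graph \<Gamma> \<longleftrightarrow> \<Gamma> \<subseteq> carrier N \<times> carrier R \<and> (\<lambda>x. (x, g x)) ` L \<subseteq> \<Gamma> \<and>
    (\<forall>x r y t. (x, r) \<in> \<Gamma> \<longrightarrow> (y, t) \<in> \<Gamma> \<longrightarrow> (x \<oplus>\<^bsub>N\<^esub> y, r \<oplus> t) \<in> \<Gamma>) \<and>
    (\<forall>a x r. a \<in> carrier R \<longrightarrow> (x, r) \<in> \<Gamma> \<longrightarrow> (a \<odot>\<^bsub>N\<^esub> x, a \<otimes> r) \<in> \<Gamma>) \<and>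
    (\<forall>r. (\<zero>\<^bsub>N\<^esub>, r) \<in> \<Gamma> \<longrightarrow> r = \<zero>)" for \<Gamma>
  have graphD: "\<Gamma> \<subseteq> carrier N \<times> carrier R" "(\<lambda>x. (x, g x)) ` L \<subseteq> \<Gamma>"
      "\<And>x r y t. (x, r) \<in> \<Gamma> \<Longrightarrow> (y, t) \<in> \<Gamma> \<Longrightarrow> (x \<oplus>\<^bsub>N\<^esub> y, r \<oplus> t) \<in> \<Gamma>"
      "\<And>a x r. a \<in> carrier R \<Longrightarrow> (x, r) \<in> \<Gamma> \<Longrightarrow> (a \<odot>\<^bsub>N\<^esub> x, a \<otimes> r) \<in> \<Gamma>"
      "\<And>r. (\<zero>\<^bsub>N\<^esub>, r) \<in> \<Gamma> \<Longrightarrow> r = \<zero>" if "graph \<Gamma>" for \<Gamma>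
    using that unfolding graph_def by blast+
  have graph_of: "graph ((\<lambda>x. (x, h x)) ` K)"
    if K: "submodule K R N" "L \<subseteq> K" and h: "h \<in> submodule_maps R N K RR" "\<And>x. x \<in> L \<Longrightarrow> h x = g x" for K h
    unfolding graph_def
  proof (intro conjI allI impI)
    note D = submodule_mapsD[OF h(1), simplified]
    let ?\<Gamma> = "(\<lambda>x. (x, h x)) ` K"
    show "?\<Gamma> \<subseteq> carrier N \<times> carrier R" using D(1) N.submodule_sub[OF K(1)] by blast
    show "(\<lambda>x. (x, g x)) ` L \<subseteq> ?\<Gamma>" using K(2) h(2) by force
    show "(x \<oplus>\<^bsub>N\<^esub> y, r \<oplus> t) \<in> ?\<Gamma>" if "(x, r) \<in> ?\<Gamma>" "(y, t) \<in> ?\<Gamma>" for x r y t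
      using that D(2)[of x y] N.submoduleE(5)[OF K(1), of x y] by (intro image_eqI[of _ _ "x \<oplus>\<^bsub>N\<^esub> y"]) auto
    show "(a \<odot>\<^bsub>N\<^esub> x, a \<otimes> r) \<in> ?\<Gamma>" if "a \<in> carrier R" "(x, r) \<in> ?\<Gamma>" for a x r
      using that D(3)[of a x] N.submoduleE(4)[OF K(1), of a x] by (intro image_eqI[of _ _ "a \<odot>\<^bsub>N\<^esub> x"]) auto
    show "r = \<zero>" if "(\<zero>\<^bsub>N\<^esub>, r) \<in> ?\<Gamma>" for r
      using that submodule_map_zero[OF N regular_module K(1) h(1)] by auto
  qed
  have "graph ((\<lambda>x. (x, g x)) ` L)" by (rule graph_of[OF L _ g]) auto
  moreover have "graph (\<Union>C)" if C: "C \<noteq> {}" "subset.chain (Collect graph) C" for C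
  proof -
    have gr: "\<And>\<Gamma>. \<Gamma> \<in> C \<Longrightarrow> graph \<Gamma>" using C(2) by (auto simp: subset_chain_def)
    have two: "\<exists>\<Gamma>\<in>C. p \<in> \<Gamma> \<and> q \<in> \<Gamma>" if "p \<in> \<Union>C" "q \<in> \<Union>C" for p q
      using that C(2) unfolding subset_chain_def by blast
    show ?thesis
      unfolding graph_def
    proof (intro conjI allI impI)
      show "\<Union>C \<subseteq> carrier N \<times> carrier R" using graphD(1)[OF gr] by blast
      show "(\<lambda>x. (x, g x)) ` L \<subseteq> \<Union>C" using graphD(2)[OF gr] C(1) by blast
    next
      fix x r y t assume "(x, r) \<in> \<Union>C" "(y, t) \<in> \<Union>C"
      then obtain \<Gamma> where "\<Gamma> \<in> C" "(x, r) \<in> \<Gamma>" "(y, t) \<in> \<Gamma>" using two by blast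
      then show "(x \<oplus>\<^bsub>N\<^esub> y, r \<oplus> t) \<in> \<Union>C" using graphD(3)[OF gr] by blast
    next
      fix a x r assume "a \<in> carrier R" "(x, r) \<in> \<Union>C"
      then show "(a \<odot>\<^bsub>N\<^esub> x, a \<otimes> r) \<in> \<Union>C" using graphD(4)[OF gr] by blast
    next
      fix r assume "(\<zero>\<^bsub>N\<^esub>, r) \<in> \<Union>C"
      then show "r = \<zero>" using graphD(5)[OF gr] by blast
    qed
  qed
  ultimately obtain \<Gamma> where \<Gamma>: "graph \<Gamma>" and mx: "\<And>\<Delta>. graph \<Delta> \<Longrightarrow> \<Gamma> \<subseteq> \<Delta> \<Longrightarrow> \<Delta> = \<Gamma>"
    using subset_Zorn_nonempty[of "Collect graph"] by blast
  note G = graphD[OF \<Gamma>]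
  have cN: "x \<in> carrier N" "r \<in> carrier R" if "(x, r) \<in> \<Gamma>" for x r using G(1) that by auto
  have uniq: "r = t" if "(x, r) \<in> \<Gamma>" "(x, t) \<in> \<Gamma>" for x r t
  proof -
    have c: "x \<in> carrier N" "r \<in> carrier R" "t \<in> carrier R" using that cN by auto
    have "((\<ominus> \<one>) \<odot>\<^bsub>N\<^esub> x, (\<ominus> \<one>) \<otimes> t) \<in> \<Gamma>" using G(4)[OF _ that(2)] by simp
    then have "(\<ominus>\<^bsub>N\<^esub> x, \<ominus> t) \<in> \<Gamma>" using c by (simp add: N.smult_l_minus l_minus)
    from G(3)[OF that(1) this] have "r \<oplus> \<ominus> t = \<zero>" using G(5) c by (simp add: N.M.r_neg)
    then show ?thesis using c by (metis minus_eq r_right_minus_eq)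
  qed
  define K where "K = fst ` \<Gamma>"
  define h where "h x = (THE r. (x, r) \<in> \<Gamma>)" for x
  have hI: "h x = r" if "(x, r) \<in> \<Gamma>" for x r
    unfolding h_def using that uniq by (intro the_equality) auto
  have hK: "(x, h x) \<in> \<Gamma>" if "x \<in> K" for x
    using that hI unfolding K_def by force
  have KI: "x \<in> K" if "(x, r) \<in> \<Gamma>" for x r using that unfolding K_def by force
  have Ks: "submodule K R N"
  proof (rule N.submoduleI')
    show "K \<subseteq> carrier N" using hK cN by blast
    show "\<zero>\<^bsub>N\<^esub> \<in> K" using G(2) N.submodule_zero[OF L] KI by blast
  next
    fix x y assume "x \<in> K" "y \<in> K"
    then show "x \<oplus>\<^bsub>N\<^esub> y \<in> K" using G(3) hK KI by blast
  next
    fix a x assume "a \<in> carrier R" "x \<in> K"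
    then show "a \<odot>\<^bsub>N\<^esub> x \<in> K" using G(4) hK KI by blast
  qed
  have h: "h \<in> submodule_maps R N K RR"
    by (rule submodule_mapsI) (use hI[OF G(3)] hI[OF G(4)] hK cN(2)[OF hK] in auto)
  have LK: "L \<subseteq> K" using G(2) KI by blast
  have "K = carrier N"
  proof (rule ccontr)
    assume "K \<noteq> carrier N"
    then have "K \<subset> carrier N" using N.submoduleE(1)[OF Ks] by blast
    then obtain x where x: "x \<in> carrier N" "x \<notin> K" "\<And>c. c \<in> \<mm> \<Longrightarrow> c \<odot>\<^bsub>N\<^esub> x \<in> K"
      using simple_step[OF N Ks N.carrier_is_submodule] by blast
    have "(\<lambda>c. h (c \<odot>\<^bsub>N\<^esub> x)) \<in> submodule_maps R RR \<mm> RR"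
    proof (rule submodule_mapsI)
      fix c assume c: "c \<in> \<mm>"
      show "h (c \<odot>\<^bsub>N\<^esub> x) \<in> carrier RR" using hK[OF x(3)[OF c]] cN by simp
      fix c' assume c': "c' \<in> \<mm>"
      have "((c \<oplus> c') \<odot>\<^bsub>N\<^esub> x, h (c \<odot>\<^bsub>N\<^esub> x) \<oplus> h (c' \<odot>\<^bsub>N\<^esub> x)) \<in> \<Gamma>"
        using G(3)[OF hK[OF x(3)[OF c]] hK[OF x(3)[OF c']]] c c' m_carrier x(1) by (simp add: N.smult_l_distr)
      then show "h ((c \<oplus>\<^bsub>RR\<^esub> c') \<odot>\<^bsub>N\<^esub> x) = h (c \<odot>\<^bsub>N\<^esub> x) \<oplus>\<^bsub>RR\<^esub> h (c' \<odot>\<^bsub>N\<^esub> x)" using hI by simp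
    next
      fix a c assume a: "a \<in> carrier R" and c: "c \<in> \<mm>"
      have "((a \<otimes> c) \<odot>\<^bsub>N\<^esub> x, a \<otimes> h (c \<odot>\<^bsub>N\<^esub> x)) \<in> \<Gamma>"
        using G(4)[OF a hK[OF x(3)[OF c]]] a c m_carrier x(1) by (simp add: N.smult_assoc1)
      then show "h ((a \<odot>\<^bsub>RR\<^esub> c) \<odot>\<^bsub>N\<^esub> x) = a \<odot>\<^bsub>RR\<^esub> h (c \<odot>\<^bsub>N\<^esub> x)" using hI by simp
    qed
    then obtain y where y: "y \<in> carrier R" "\<And>c. c \<in> \<mm> \<Longrightarrow> h (c \<odot>\<^bsub>N\<^esub> x) = y \<otimes> c"
      using m_hom_is_multiplication by metis
    have mult: "(\<lambda>a. a \<odot>\<^bsub>N\<^esub> x) \<in> submodule_maps R RR (carrier RR) N" "(\<lambda>a. a \<otimes> y) \<in> submodule_maps R RR (carrier RR) RR"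
      by (rule submodule_mapsI; use x(1) y(1) in \<open>simp add: N.smult_l_distr N.smult_assoc1 l_distr m_assoc\<close>)+
    have "\<forall>a\<in>carrier RR. a \<odot>\<^bsub>N\<^esub> x \<in> K \<longrightarrow> a \<otimes> y = h (a \<odot>\<^bsub>N\<^esub> x)"
      using scalar_in_m[OF N Ks x(1,2)] y m_comm by simp
    from glue_maps[OF N regular_module regular_module Ks RR.carrier_is_submodule h mult this]
    obtain h' where h': "h' \<in> submodule_maps R N {k \<oplus>\<^bsub>N\<^esub> a \<odot>\<^bsub>N\<^esub> x | k a. k \<in> K \<and> a \<in> carrier RR} RR"
      "\<And>k. k \<in> K \<Longrightarrow> h' k = h k" by blast
    note ad = N.adjoin_submodule[OF Ks x(1)]
    have "graph ((\<lambda>x. (x, h' x)) ` N.adjoin K x)"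
    proof (rule graph_of[OF ad(1)])
      show "L \<subseteq> N.adjoin K x" using LK ad(2) by blast
      show "h' \<in> submodule_maps R N (N.adjoin K x) RR" using h'(1) by (simp add: N.adjoin_def)
      show "h' u = g u" if "u \<in> L" for u
      proof -
        have "(u, g u) \<in> \<Gamma>" using G(2) that by blast
        then show ?thesis using h'(2)[of u] hI that LK by auto
      qed
    qed
    moreover have "\<Gamma> \<subseteq> (\<lambda>x. (x, h' x)) ` N.adjoin K x"
    proof
      fix p assume p: "p \<in> \<Gamma>"
      obtain k r where kr: "p = (k, r)" by (cases p)
      then have "k \<in> K" "h' k = r" using p KI hI h'(2) by auto
      then show "p \<in> (\<lambda>x. (x, h' x)) ` N.adjoin K x" using kr ad(2) by auto
    qed
    ultimately have "(\<lambda>x. (x, h' x)) ` N.adjoin K x = \<Gamma>" by (rule mx)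
    then show False using ad(3) KI x(2) by blast
  qed
  then have "h \<in> linear_maps R N RR" using h by simp
  moreover have "h x = g x" if "x \<in> L" for x using that G(2) hI by blast
  ultimately show thesis using that by blast
qed

text \<open>The copy of \<open>R\<close> on the underlying type required of injective modules.\<close>

definition self_copy :: "('a, 'a list) module" where
  "self_copy = \<lparr>carrier = {[a] | a. a \<in> carrier R}, monoid.mult = undefined, one = undefined,
      ring.zero = [\<zero>], ring.add = (\<lambda>u v. [hd u \<oplus> hd v]), smult = (\<lambda>a u. [a \<otimes> hd u])\<rparr>"

definition trivial_module :: "('a, 'a list) module" where
  "trivial_module = \<lparr>carrier = {[]}, monoid.mult = undefined, one = undefined,
      ring.zero = [], ring.add = (\<lambda>u v. []), smult = (\<lambda>a u. [])\<rparr>"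

lemma self_copy_simps [simp]:
  "carrier self_copy = {[a] | a. a \<in> carrier R}" "\<zero>\<^bsub>self_copy\<^esub> = [\<zero>]"
  "u \<oplus>\<^bsub>self_copy\<^esub> v = [hd u \<oplus> hd v]" "a \<odot>\<^bsub>self_copy\<^esub> u = [a \<otimes> hd u]"
  by (auto simp: self_copy_def)

lemma trivial_module_simps [simp]:
  "carrier trivial_module = {[]}" "\<zero>\<^bsub>trivial_module\<^esub> = []"
  "u \<oplus>\<^bsub>trivial_module\<^esub> v = []" "a \<odot>\<^bsub>trivial_module\<^esub> u = []"
  by (auto simp: trivial_module_def)

lemma self_copy_module: "module R self_copy"
proof (rule moduleI)
  show "abelian_group self_copy"
  proof (rule abelian_groupI)
    fix v assume "v \<in> carrier self_copy"
    then obtain a where a: "v = [a]" "a \<in> carrier R" by auto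
    then show "\<exists>w\<in>carrier self_copy. w \<oplus>\<^bsub>self_copy\<^esub> v = \<zero>\<^bsub>self_copy\<^esub>"
      by (intro bexI[of _ "[\<ominus> a]"]) (auto simp: l_neg)
  qed (auto simp: a_ac)
qed (auto simp: is_cring l_distr r_distr m_assoc)

lemma trivial_module_module: "module R trivial_module"
  by (rule moduleI) (auto simp: is_cring intro!: abelian_groupI)

lemma self_copy_injective: "injective_module R self_copy"
  unfolding injective_module_def
proof (intro conjI allI impI self_copy_module; elim conjE)
  fix M N :: "('a, 'a list) module" and f g
  assume M: "module R M" and N: "module R N" and f: "f \<in> linear_maps R M N"
    and inj: "inj_on f (carrier M)" and g: "g \<in> linear_maps R M self_copy"
  interpret M: module R M by fact
  have f': "f \<in> submodule_maps R M (carrier M) N" using f by simp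
  define g' where "g' u = hd (g (inv_into (carrier M) f u))" for u
  have g'f: "g' (f x) = hd (g x)" if "x \<in> carrier M" for x
    using that inj by (simp add: g'_def)
  have gc: "x \<in> carrier M \<Longrightarrow> \<exists>a\<in>carrier R. g x = [a]" for x
    using g unfolding linear_maps_def by fastforce
  have "g' \<in> submodule_maps R N (f ` carrier M) RR"
  proof (rule submodule_mapsI)
    fix u assume "u \<in> f ` carrier M"
    then show "g' u \<in> carrier RR" using g'f gc by fastforce
  next
    fix u v assume "u \<in> f ` carrier M" "v \<in> f ` carrier M"
    then obtain x y where xy: "x \<in> carrier M" "y \<in> carrier M" "u = f x" "v = f y" by blast
    have "u \<oplus>\<^bsub>N\<^esub> v = f (x \<oplus>\<^bsub>M\<^esub> y)" using xy f by (simp add: linear_maps_def)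
    then show "g' (u \<oplus>\<^bsub>N\<^esub> v) = g' u \<oplus>\<^bsub>RR\<^esub> g' v" using xy g'f g by (simp add: linear_maps_def)
  next
    fix a u assume a: "a \<in> carrier R" and "u \<in> f ` carrier M"
    then obtain x where x: "x \<in> carrier M" "u = f x" by blast
    have "a \<odot>\<^bsub>N\<^esub> u = f (a \<odot>\<^bsub>M\<^esub> x)" using x a f by (simp add: linear_maps_def)
    then show "g' (a \<odot>\<^bsub>N\<^esub> u) = a \<odot>\<^bsub>RR\<^esub> g' u" using x a g'f g by (simp add: linear_maps_def)
  qed
  then obtain h where h: "h \<in> linear_maps R N RR" "\<And>u. u \<in> f ` carrier M \<Longrightarrow> h u = g' u"
    using functional_extends[OF N submodule_image[OF M N M.carrier_is_submodule f']] by metis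
  show "\<exists>h\<in>linear_maps R N self_copy. \<forall>x\<in>carrier M. h (f x) = g x"
  proof (intro bexI[of _ "\<lambda>u. [h u]"] ballI)
    fix x assume x: "x \<in> carrier M"
    then show "[h (f x)] = g x" using h(2) g'f gc[OF x] by auto
  next
    show "(\<lambda>u. [h u]) \<in> linear_maps R N self_copy" using h(1) by (auto simp: linear_maps_def)
  qed
qed

lemma trivial_module_injective: "injective_module R trivial_module"
  unfolding injective_module_def
proof (intro conjI allI impI trivial_module_module; elim conjE)
  fix M N :: "('a, 'a list) module" and f g
  assume g: "g \<in> linear_maps R M trivial_module"
  show "\<exists>h\<in>linear_maps R N trivial_module. \<forall>x\<in>carrier M. h (f x) = g x"
    by (rule bexI[of _ "\<lambda>u. []"]) (use g in \<open>auto simp: linear_maps_def Pi_iff\<close>)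
qed

lemma self_injective_dim: "injective_dim_le R RR 0"
  unfolding injective_dim_le_def
proof (intro exI conjI allI impI)
  let ?I = "\<lambda>j::nat. if j = 0 then self_copy else trivial_module"
  let ?d = "\<lambda>(j::nat) (u :: 'a list). [] :: 'a list"
  let ?e = "\<lambda>a. [a]"
  fix j
  show "injective_module R (?I j)" using self_copy_injective trivial_module_injective by simp
  show "?e \<in> linear_maps R RR (?I 0)" by (auto simp: linear_maps_def)
  show "inj_on ?e (carrier RR)" by (auto simp: inj_on_def)
  show "?d j \<in> linear_maps R (?I j) (?I (Suc j))" by (auto simp: linear_maps_def)
  show "?e ` carrier RR = a_kernel (?I 0) (?I 1) (?d 0)" by (auto simp: a_kernel_def')
  show "?d j ` carrier (?I j) = a_kernel (?I (Suc j)) (?I (Suc (Suc j))) (?d (Suc j))"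
    by (auto simp: a_kernel_def')
  show "carrier (?I j) = {\<zero>\<^bsub>?I j\<^esub>}" if "j > 0" using that by simp
qed

end

context cube_zero_ring
begin

text \<open>The failure of the Gorenstein property enters the proof through this fact alone.\<close>

lemma socle_not_principal:
  assumes "local_ring R \<mm>" "\<not> gorenstein_local_ring R \<mm>" "s \<in> socle"
  shows "\<exists>t\<in>socle. \<forall>a\<in>carrier R. t \<noteq> a \<otimes> s"
proof (rule ccontr)
  assume no: "\<not> ?thesis"
  have "a \<otimes> s \<in> socle" if "a \<in> carrier R" for a
    using that assms(3) ideal.I_l_closed[OF socle_ideal] by blast
  then interpret principal_socle_ring R \<mm> s
    using no assms(3) by unfold_locales auto
  show False using self_injective_dim assms noetherian
    by (auto simp: gorenstein_local_ring_def)
qed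

end

section \<open>Vanishing of Ext into the ring\<close>

text \<open>From here on, the arguments treat vectors as elements of a module and rarely look at their
  coordinates.\<close>

declare sequence_module_simps [simp del]

context coordinate_ring
begin

definition functionals_extend :: "(nat \<Rightarrow> 'a) set \<Rightarrow> nat \<Rightarrow> bool" where
  "functionals_extend P q \<longleftrightarrow>
     (\<forall>f\<in>functionals P. \<exists>F\<in>functionals (free q). \<forall>x\<in>P. F x = f x)"

definition covers :: "nat \<Rightarrow> ((nat \<Rightarrow> 'a) \<Rightarrow> nat \<Rightarrow> 'a) \<Rightarrow> (nat \<Rightarrow> 'a) set \<Rightarrow> bool" where
  "covers q G P \<longleftrightarrow> G \<in> maps (free q) \<and> G ` free q = P"

definition syzygy :: "nat \<Rightarrow> ((nat \<Rightarrow> 'a) \<Rightarrow> nat \<Rightarrow> 'a) \<Rightarrow> (nat \<Rightarrow> 'a) set" where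
  "syzygy q G = {v \<in> free q. G v = \<zero>\<^sub>V}"

text \<open>For \<open>P\<close> in \<open>R\<^sup>q\<close>, this says \<open>Ext\<^sup>n\<^sup>+\<^sup>1(R\<^sup>q/P, R) = 0\<close>; for positive \<open>n\<close> this group is
  \<open>Ext\<^sup>n(P, R)\<close>, whatever \<open>q\<close> is. Quantifying over all presentations at every step avoids
  choosing resolutions and comparing them.\<close>

primrec ext_vanishes :: "nat \<Rightarrow> nat \<Rightarrow> (nat \<Rightarrow> 'a) set \<Rightarrow> bool" where
  "ext_vanishes 0 q P \<longleftrightarrow> functionals_extend P q"
| "ext_vanishes (Suc n) q P \<longleftrightarrow> (\<forall>p G. covers p G P \<longrightarrow> ext_vanishes n p (syzygy p G))"

lemma ext_vanishes_restrict:
  assumes "ext_vanishes n q P" "p \<le> q"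
  shows "ext_vanishes n p P"
proof (cases n)
  case 0
  have "functionals_extend P p"
    unfolding functionals_extend_def
  proof
    fix f assume f: "f \<in> functionals P"
    have "functionals_extend P q" using assms(1) 0 by simp
    from bspec[OF this[unfolded functionals_extend_def] f]
    obtain F where F: "F \<in> functionals (free q)" "\<forall>x\<in>P. F x = f x" by blast
    show "\<exists>F\<in>functionals (free p). \<forall>x\<in>P. F x = f x"
      using F(2) submodule_maps_mono[OF F(1) free_mono[OF assms(2)]] by blast
  qed
  then show ?thesis using 0 by simp
qed (use assms in simp)

lemma syzygy_submodule:
  assumes "G \<in> maps (free q)"
  shows "submodule (syzygy q G) R V"
  unfolding syzygy_def
  by (rule V_kernel[OF free_submodule assms])

lemma syzygy_free: "syzygy q G \<subseteq> free q"
  by (auto simp: syzygy_def)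

lemma maps_comp:
  assumes "f \<in> submodule_maps R M P N" "g \<in> submodule_maps R N Q L" "f ` P \<subseteq> Q"
  shows "(\<lambda>x. g (f x)) \<in> submodule_maps R M P L"
proof (rule submodule_mapsI)
  fix x assume "x \<in> P"
  then show "g (f x) \<in> carrier L" using submodule_mapsD(1)[OF assms(2)] assms(3) by blast
next
  fix x y assume "x \<in> P" "y \<in> P"
  then show "g (f (x \<oplus>\<^bsub>M\<^esub> y)) = g (f x) \<oplus>\<^bsub>L\<^esub> g (f y)"
    using submodule_mapsD(2)[OF assms(1)] submodule_mapsD(2)[OF assms(2)] assms(3) by (simp add: image_subset_iff)
next
  fix a x assume "a \<in> carrier R" "x \<in> P"
  then show "g (f (a \<odot>\<^bsub>M\<^esub> x)) = a \<odot>\<^bsub>L\<^esub> g (f x)"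
    using submodule_mapsD(3)[OF assms(1)] submodule_mapsD(3)[OF assms(2)] assms(3) by (simp add: image_subset_iff)
qed

lemma maps_add:
  assumes M: "module R M" and N: "module R N" "f \<in> submodule_maps R M P N" "g \<in> submodule_maps R M P N"
  shows "(\<lambda>x. f x \<oplus>\<^bsub>N\<^esub> g x) \<in> submodule_maps R M P N"
proof -
  interpret N: module R N by fact
  note D = submodule_mapsD[OF assms(3)] submodule_mapsD[OF assms(4)]
  show ?thesis
    by (rule submodule_mapsI) (simp_all add: D N.smult_r_distr N.M.a_ac)
qed

lemma maps_minus:
  assumes M: "module R M" and N: "module R N" "f \<in> submodule_maps R M P N" "g \<in> submodule_maps R M P N"
  shows "(\<lambda>x. f x \<ominus>\<^bsub>N\<^esub> g x) \<in> submodule_maps R M P N"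
proof -
  interpret N: module R N by fact
  note D = submodule_mapsD[OF assms(3)] submodule_mapsD[OF assms(4)]
  show ?thesis
    by (rule submodule_mapsI)
      (simp_all add: D N.minus_eq N.minus_add N.smult_r_distr N.smult_r_minus N.M.a_ac)
qed

text \<open>If \<open>Ext\<^sup>1(N/L, R) = 0\<close>, then every functional on \<open>L\<close> extends to \<open>N\<close>. The quotient \<open>N/L\<close> is the image
  of \<open>\<pi>\<close>, presented by \<open>G\<close>; lifting \<open>G\<close> to \<open>N\<close> turns the extension problem on \<open>L\<close> into one on the
  relations of \<open>G\<close>, and the solution is glued to \<open>f\<close>.\<close>

lemma ext1_extends:
  assumes L: "submodule L R V" and N: "submodule N R V" and LN: "L \<subseteq> N"
    and \<pi>: "\<pi> \<in> maps N" "\<And>x. x \<in> N \<Longrightarrow> \<pi> x = \<zero>\<^sub>V \<longleftrightarrow> x \<in> L"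
    and G: "covers q G (\<pi> ` N)" and ext: "functionals_extend (syzygy q G) q"
    and f: "f \<in> functionals L"
  obtains h where "h \<in> functionals N" "\<And>x. x \<in> L \<Longrightarrow> h x = f x"
proof -
  have Gm: "G \<in> maps (free q)" "G ` free q = \<pi> ` N" using G by (auto simp: covers_def)
  obtain g where g: "g \<in> maps (free q)" "\<And>v. v \<in> free q \<Longrightarrow> g v \<in> N" "\<And>v. v \<in> free q \<Longrightarrow> \<pi> (g v) = G v"
    using free_lift[OF V.module_axioms V.module_axioms N \<pi>(1) Gm(1)] Gm(2) by blast
  have gL: "v \<in> syzygy q G" if "v \<in> free q" "g v \<in> L" for v
    using that g(3)[OF that(1)] \<pi>(2)[OF g(2)[OF that(1)]] by (auto simp: syzygy_def)
  have gS: "g v \<in> L" if "v \<in> syzygy q G" for v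
  proof -
    have v: "v \<in> free q" "G v = \<zero>\<^sub>V" using that by (simp_all add: syzygy_def)
    then have "\<pi> (g v) = \<zero>\<^sub>V" using g(3) by simp
    then show ?thesis using \<pi>(2) g(2)[OF v(1)] by blast
  qed
  have fg: "(\<lambda>v. f (g v)) \<in> functionals (syzygy q G)"
    by (rule maps_comp[OF submodule_maps_mono[OF g(1) syzygy_free] f]) (use gS in blast)
  obtain F where F: "F \<in> functionals (free q)" "\<And>v. v \<in> syzygy q G \<Longrightarrow> F v = f (g v)"
    using bspec[OF ext[unfolded functionals_extend_def] fg] by blast
  have "\<forall>v\<in>free q. g v \<in> L \<longrightarrow> F v = f (g v)" using F(2) gL by blast
  from glue_maps[OF V.module_axioms RR.module_axioms V.module_axioms L free_submodule f g(1) F(1) this]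
  obtain h where h: "h \<in> functionals {l \<oplus>\<^sub>V g v | l v. l \<in> L \<and> v \<in> free q}" "\<And>l. l \<in> L \<Longrightarrow> h l = f l"
    by blast
  have "N \<subseteq> {l \<oplus>\<^sub>V g v | l v. l \<in> L \<and> v \<in> free q}"
  proof
    fix n assume n: "n \<in> N"
    then obtain v where v: "v \<in> free q" "G v = \<pi> n" using Gm(2) by (metis imageE imageI)
    have "\<pi> (n \<ominus>\<^sub>V g v) = \<zero>\<^sub>V"
      unfolding V_map_minus[OF N \<pi>(1) n g(2)[OF v(1)]] g(3)[OF v(1)] v(2)
      using submodule_mapsD(1)[OF \<pi>(1) n] by (simp add: V.minus_eq V.r_neg)
    then have "n \<ominus>\<^sub>V g v \<in> L" using \<pi>(2) V.submodule_minus[OF N n g(2)[OF v(1)]] by blast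
    moreover have "n = (n \<ominus>\<^sub>V g v) \<oplus>\<^sub>V g v"
      by (rule V.minus_add_cancel[symmetric]) (use V.submodule_sub[OF N] n g(2)[OF v(1)] in blast)+
    ultimately show "n \<in> {l \<oplus>\<^sub>V g v | l v. l \<in> L \<and> v \<in> free q}" using v(1) by blast
  qed
  then show thesis using that[OF submodule_maps_mono[OF h(1)] h(2)] by blast
qed

subsection \<open>Concatenation of coordinate vectors\<close>

definition head :: "nat \<Rightarrow> (nat \<Rightarrow> 'a) \<Rightarrow> nat \<Rightarrow> 'a" where
  "head p v = (\<lambda>n. if n < p then v n else \<zero>)"

definition tail :: "nat \<Rightarrow> (nat \<Rightarrow> 'a) \<Rightarrow> nat \<Rightarrow> 'a" where
  "tail p v = (\<lambda>n. v (n + p))"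

definition concat :: "nat \<Rightarrow> (nat \<Rightarrow> 'a) \<Rightarrow> (nat \<Rightarrow> 'a) \<Rightarrow> nat \<Rightarrow> 'a" where
  "concat p v w = (\<lambda>n. if n < p then v n else w (n - p))"

lemma head_maps: "head p \<in> maps (free q)"
  by (rule submodule_mapsI) (auto simp: head_def sequence_module_simps freeD)

lemma tail_maps: "tail p \<in> maps (free q)"
  by (rule submodule_mapsI) (auto simp: tail_def sequence_module_simps freeD)

lemma head_free: "v \<in> free (p + q) \<Longrightarrow> head p v \<in> free p"
  by (auto simp: head_def vectors_def)

lemma tail_free: "v \<in> free (p + q) \<Longrightarrow> tail p v \<in> free q"
  by (auto simp: tail_def vectors_def)

lemma concat_free: "v \<in> free p \<Longrightarrow> w \<in> free q \<Longrightarrow> concat p v w \<in> free (p + q)"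
  by (auto simp: concat_def vectors_def)

lemma head_concat: "v \<in> free p \<Longrightarrow> head p (concat p v w) = v"
  by (auto simp: head_def concat_def vectors_def)

lemma tail_concat: "tail p (concat p v w) = w"
  by (auto simp: tail_def concat_def)

lemma tail_zero_iff: "v \<in> free (p + q) \<Longrightarrow> tail p v = \<zero>\<^sub>V \<longleftrightarrow> v \<in> free p"
proof
  assume v: "v \<in> free (p + q)" and t: "tail p v = \<zero>\<^sub>V"
  have "v n = \<zero>" if "n \<ge> p" for n
    using fun_cong[OF t, of "n - p"] that by (simp add: tail_def sequence_module_simps)
  then show "v \<in> free p" using v by (auto simp: vectors_def)
next
  assume "v \<in> free p"
  then show "tail p v = \<zero>\<^sub>V" by (auto simp: tail_def vectors_def sequence_module_simps)
qed

lemma head_id: "v \<in> free p \<Longrightarrow> head p v = v"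
  by (auto simp: head_def vectors_def)

end

context cube_zero_ring
begin

lemma zero_map_cover: "covers 0 (\<lambda>v. \<zero>\<^sub>V) {\<zero>\<^sub>V}"
proof -
  have "\<zero>\<^sub>V \<in> free 0" using V.submodule_zero[OF free_submodule] .
  then show ?thesis unfolding covers_def by (auto simp: linear_maps_def)
qed

lemma cover_adjoin:
  assumes G: "covers q G K" and x: "x \<in> carrier V"
  shows "\<exists>q' G'. covers q' G' (V.adjoin K x)"
proof -
  have Gm: "G \<in> maps (free q)" "G ` free q = K" using G by (auto simp: covers_def)
  note GD = submodule_mapsD[OF Gm(1)]
  define g where "g t = (if t < q then G (unit_vector R t) else x)" for t
  have gc: "g t \<in> carrier V" for t
    using GD(1)[OF unit_vector_free] x by (auto simp: g_def)
  define G' where "G' = lincomb V g (Suc q)"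
  have G': "G' \<in> maps (free (Suc q))" unfolding G'_def by (rule lincomb_maps_free[OF V.module_axioms gc])
  have eq: "G' v = v q \<odot>\<^sub>V x \<oplus>\<^sub>V G (head q v)" if v: "v \<in> free (Suc q)" for v
  proof -
    have vc: "v t \<in> carrier R" for t using freeD[OF v] .
    have h: "head q v \<in> free q" using head_free[of v q 1] v by simp
    have "G' v = v q \<odot>\<^sub>V g q \<oplus>\<^sub>V lincomb V g q v"
      unfolding G'_def by (rule V.lincomb_Suc[OF gc vc])
    also have "lincomb V g q v = lincomb V (\<lambda>t. G (unit_vector R t)) q (head q v)"
      by (rule V.lincomb_cong)
        (use GD(1)[OF unit_vector_free] vc freeD[OF h] in \<open>auto simp: g_def head_def\<close>)
    also have "\<dots> = G (head q v)" by (rule linear_eq_lincomb[OF V.module_axioms Gm(1) h, symmetric])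
    finally show ?thesis by (simp add: g_def)
  qed
  have "G' ` free (Suc q) = V.adjoin K x"
  proof (intro equalityI subsetI)
    fix u assume "u \<in> G' ` free (Suc q)"
    then obtain v where v: "v \<in> free (Suc q)" "u = G' v" by blast
    have h: "head q v \<in> free q" using head_free[of v q 1] v by simp
    have "u = G (head q v) \<oplus>\<^sub>V v q \<odot>\<^sub>V x"
      unfolding v(2) eq[OF v(1)] by (rule V.M.a_comm) (use GD(1)[OF h] freeD[OF v(1)] x in auto)
    then show "u \<in> V.adjoin K x" using V.adjoinI[of "G (head q v)" K "v q" x] h Gm(2) freeD[OF v(1)] by blast
  next
    fix u assume "u \<in> V.adjoin K x"
    then obtain k a where *: "k \<in> K" "a \<in> carrier R" "u = k \<oplus>\<^sub>V a \<odot>\<^sub>V x" unfolding V.adjoin_def by blast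
    then obtain w where w: "w \<in> free q" "k = G w" using Gm(2) by blast
    define v where "v = concat q w (\<lambda>n. if n = 0 then a else \<zero>)"
    have v: "v \<in> free (Suc q)"
      using concat_free[OF w(1), of "\<lambda>n. if n = 0 then a else \<zero>" 1] *(2) by (auto simp: v_def vectors_def)
    have "G' v = a \<odot>\<^sub>V x \<oplus>\<^sub>V G w"
    proof -
      have "head q v = w" unfolding v_def by (rule head_concat[OF w(1)])
      moreover have "v q = a" by (simp add: v_def concat_def)
      ultimately show ?thesis using eq[OF v] by simp
    qed
    also have "\<dots> = u" unfolding *(3) w(2) by (rule V.M.a_comm) (use GD(1)[OF w(1)] * x in auto)
    finally show "u \<in> G' ` free (Suc q)" using v by blast
  qed
  then show ?thesis using G' unfolding covers_def by blast
qed

text \<open>Finite generation, obtained from finite length.\<close>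

lemma cover_exists:
  assumes P: "submodule P R V" "P \<subseteq> free p"
  shows "\<exists>q G. covers q G P"
proof -
  have z: "submodule {\<zero>\<^sub>V} R V" "{\<zero>\<^sub>V} \<subseteq> P" using V.submodule_zero_set V.submodule_zero[OF P(1)] by auto
  have c0: "\<exists>q G. covers q G {\<zero>\<^sub>V}" using zero_map_cover by blast
  obtain K where K: "submodule K R V" "K \<subseteq> P" "\<exists>q G. covers q G K"
    and mx: "\<And>K'. submodule K' R V \<Longrightarrow> K \<subset> K' \<Longrightarrow> K' \<subseteq> P \<Longrightarrow> \<not> (\<exists>q G. covers q G K')"
    using maximal_submodule[where Q = "\<lambda>K. \<exists>q G. covers q G K", OF V.module_axioms z c0 vectors_len_finite[OF P(2)]]
    by blast
  have "K = P"
  proof (rule ccontr)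
    assume "K \<noteq> P"
    then obtain x where x: "x \<in> P" "x \<notin> K" using K by blast
    have xc: "x \<in> carrier V" using V.submodule_sub[OF P(1) x(1)] .
    show False
      using mx[of "V.adjoin K x"] V.adjoin_submodule[OF K(1) xc] V.adjoin_least[OF P(1) K(2) x(1)]
        cover_adjoin[OF _ xc] K(3) x by blast
  qed
  then show ?thesis using K by blast
qed


text \<open>A presentation of \<open>L\<close> and a lifted presentation of \<open>N/L\<close> together present \<open>N\<close>, and the
  syzygies form an exact sequence again.\<close>

lemma syzygy_sequence:
  assumes L: "submodule L R V" and N: "submodule N R V" and LN: "L \<subseteq> N"
    and \<pi>: "\<pi> \<in> maps N" "\<And>x. x \<in> N \<Longrightarrow> \<pi> x = \<zero>\<^sub>V \<longleftrightarrow> x \<in> L" "\<pi> ` N \<subseteq> free p"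
    and u: "covers q u L"
  obtains q' v w where "covers q' v (\<pi> ` N)" "covers (q + q') w N" "syzygy q u \<subseteq> syzygy (q + q') w"
    "\<And>x. x \<in> syzygy (q + q') w \<Longrightarrow> tail q x = \<zero>\<^sub>V \<longleftrightarrow> x \<in> syzygy q u"
    "tail q ` syzygy (q + q') w = syzygy q' v"
proof -
  have um: "u \<in> maps (free q)" "u ` free q = L" using u by (auto simp: covers_def)
  note uD = submodule_mapsD[OF um(1)]
  obtain q' v where v: "covers q' v (\<pi> ` N)"
    using cover_exists[OF V_image[OF N \<pi>(1)] \<pi>(3)] by blast
  have vm: "v \<in> maps (free q')" "v ` free q' = \<pi> ` N" using v by (auto simp: covers_def)
  obtain g where g: "g \<in> maps (free q')" "\<And>x. x \<in> free q' \<Longrightarrow> g x \<in> N" "\<And>x. x \<in> free q' \<Longrightarrow> \<pi> (g x) = v x"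
    using free_lift[OF V.module_axioms V.module_axioms N \<pi>(1) vm(1)] vm(2) by blast
  note gD = submodule_mapsD[OF g(1)]
  define w where "w x = u (head q x) \<oplus>\<^sub>V g (tail q x)" for x
  have ht: "head q x \<in> free q" "tail q x \<in> free q'" if "x \<in> free (q + q')" for x
    using head_free tail_free that by auto
  have "(\<lambda>x. u (head q x)) \<in> maps (free (q + q'))" "(\<lambda>x. g (tail q x)) \<in> maps (free (q + q'))"
    by (rule maps_comp[OF head_maps um(1)], use ht in blast)
      (rule maps_comp[OF tail_maps g(1)], use ht in blast)
  from maps_add[OF V.module_axioms V.module_axioms this]
  have wm: "w \<in> maps (free (q + q'))" unfolding w_def .
  have uL: "u y \<in> L" if "y \<in> free q" for y using that um(2) by blast
  have wN: "w x \<in> N" if "x \<in> free (q + q')" for x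
    unfolding w_def using V.submoduleE(5)[OF N] uL[OF ht(1)[OF that]] LN g(2)[OF ht(2)[OF that]] by blast
  have \<pi>w: "\<pi> (w x) = v (tail q x)" if x: "x \<in> free (q + q')" for x
  proof -
    have "\<pi> (w x) = \<pi> (u (head q x)) \<oplus>\<^sub>V \<pi> (g (tail q x))"
      unfolding w_def by (rule submodule_mapsD(2)[OF \<pi>(1)]) (use uL[OF ht(1)[OF x]] LN g(2)[OF ht(2)[OF x]] in blast)+
    also have "\<pi> (u (head q x)) = \<zero>\<^sub>V" using \<pi>(2) uL[OF ht(1)[OF x]] LN by blast
    also have "\<pi> (g (tail q x)) = v (tail q x)" by (rule g(3)[OF ht(2)[OF x]])
    also have "\<zero>\<^sub>V \<oplus>\<^sub>V v (tail q x) = v (tail q x)"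
      by (rule V.M.l_zero[OF submodule_mapsD(1)[OF vm(1) ht(2)[OF x]]])
    finally show ?thesis .
  qed
  have u0: "u \<zero>\<^sub>V = \<zero>\<^sub>V" "g \<zero>\<^sub>V = \<zero>\<^sub>V"
    using V_map_zero[OF free_submodule um(1)]
      V_map_zero[OF free_submodule g(1)] .
  have w_concat: "w (concat q y z) = u y \<oplus>\<^sub>V g z" if "y \<in> free q" for y z
    unfolding w_def tail_concat head_concat[OF that] ..
  have preim: "\<exists>y\<in>free q. w (concat q y z) = n"
    if n: "n \<in> N" and z: "z \<in> free q'" "v z = \<pi> n" for n z
  proof -
    have "\<pi> (n \<ominus>\<^sub>V g z) = \<pi> n \<ominus>\<^sub>V \<pi> (g z)"
      by (rule V_map_minus[OF N \<pi>(1) n g(2)[OF z(1)]])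
    also have "\<dots> = \<zero>\<^sub>V" using g(3)[OF z(1)] z(2) submodule_mapsD(1)[OF \<pi>(1) n]
      by (simp add: V.minus_eq V.r_neg)
    finally have "n \<ominus>\<^sub>V g z \<in> L" using \<pi>(2) V.submodule_minus[OF N n g(2)[OF z(1)]] by blast
    then obtain y where y: "y \<in> free q" "u y = n \<ominus>\<^sub>V g z" using um(2) by (metis imageE)
    have "w (concat q y z) = n" unfolding w_concat[OF y(1)] y(2)
      using V.submodule_sub[OF N n] gD(1)[OF z(1)] by (simp add: V.minus_eq V.M.a_assoc V.M.l_neg)
    then show ?thesis using y(1) by blast
  qed
  have "w ` free (q + q') = N"
  proof (intro equalityI subsetI)
    fix n assume n: "n \<in> N"
    then obtain z where z: "z \<in> free q'" "v z = \<pi> n" using vm(2) by (metis imageE imageI)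
    then obtain y where "y \<in> free q" "w (concat q y z) = n" using preim[OF n z] by blast
    then show "n \<in> w ` free (q + q')" using concat_free[OF _ z(1)] by blast
  qed (use wN in blast)
  then have cw: "covers (q + q') w N" using wm by (simp add: covers_def)
  have wf: "w x = u x" if x: "x \<in> free q" for x
  proof -
    have "x \<in> free (q + q')" using x free_mono[of q "q + q'"] by auto
    then have "tail q x = \<zero>\<^sub>V" using tail_zero_iff x by blast
    then have "w x = u x \<oplus>\<^sub>V \<zero>\<^sub>V" unfolding w_def head_id[OF x] using u0 by metis
    then show ?thesis using V.M.r_zero[OF uD(1)[OF x]] by metis
  qed
  have sub: "syzygy q u \<subseteq> syzygy (q + q') w"
    using wf free_mono[of q "q + q'"] by (auto simp: syzygy_def)
  have ker: "tail q x = \<zero>\<^sub>V \<longleftrightarrow> x \<in> syzygy q u" if x: "x \<in> syzygy (q + q') w" for x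
  proof -
    have xf: "x \<in> free (q + q')" "w x = \<zero>\<^sub>V" using x by (simp_all add: syzygy_def)
    show ?thesis unfolding tail_zero_iff[OF xf(1)]
      using wf xf by (auto simp: syzygy_def)
  qed
  have im: "tail q ` syzygy (q + q') w = syzygy q' v"
  proof (intro equalityI subsetI)
    fix z assume "z \<in> tail q ` syzygy (q + q') w"
    then obtain x where x: "x \<in> free (q + q')" "w x = \<zero>\<^sub>V" "z = tail q x"
      by (auto simp: syzygy_def)
    have "v z = \<zero>\<^sub>V" using \<pi>w[OF x(1)] x(2,3)
      V_map_zero[OF N \<pi>(1)] by metis
    then show "z \<in> syzygy q' v" using ht(2)[OF x(1)] x(3) by (simp add: syzygy_def)
  next
    fix z assume "z \<in> syzygy q' v"
    then have z: "z \<in> free q'" "v z = \<zero>\<^sub>V" by (simp_all add: syzygy_def)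
    have "v z = \<pi> \<zero>\<^sub>V" using z(2) V_map_zero[OF N \<pi>(1)] by metis
    then obtain y where y: "y \<in> free q" "w (concat q y z) = \<zero>\<^sub>V"
      using preim[OF V.submodule_zero[OF N] z(1)] by blast
    have "concat q y z \<in> syzygy (q + q') w"
      using y concat_free[OF y(1) z(1)] by (simp add: syzygy_def)
    then show "z \<in> tail q ` syzygy (q + q') w" using tail_concat by (metis imageI)
  qed
  show thesis by (rule that[OF v cw sub ker im])
qed

text \<open>For positive \<open>n\<close>, the exactness of \<open>Ext\<^sup>n(N, R) \<rightarrow> Ext\<^sup>n(L, R) \<rightarrow> Ext\<^sup>n\<^sup>+\<^sup>1(N/L, R)\<close>. Passing to the
  exact sequence of syzygies lowers \<open>n\<close>, until only the extension of functionals is left.\<close>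

lemma ext_vanishes_kernel:
  assumes "submodule L R V" "submodule N R V" "L \<subseteq> N"
    "\<pi> \<in> maps N" "\<And>x. x \<in> N \<Longrightarrow> \<pi> x = \<zero>\<^sub>V \<longleftrightarrow> x \<in> L" "\<pi> ` N \<subseteq> free p"
    "ext_vanishes (Suc n) p (\<pi> ` N)" "ext_vanishes n q N"
  shows "ext_vanishes n q L"
  using assms
proof (induction n arbitrary: L N p \<pi> q)
  case (0 L N p \<pi> q)
  obtain r G where G: "covers r G (\<pi> ` N)"
    using cover_exists[OF V_image[OF 0(2,4)] 0(6)] by blast
  have ev: "functionals_extend (syzygy r G) r" using 0(7) G by simp
  have "functionals_extend L q"
    unfolding functionals_extend_def
  proof
    fix f assume f: "f \<in> functionals L"
    obtain h where h: "h \<in> functionals N" "\<And>x. x \<in> L \<Longrightarrow> h x = f x"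
      using ext1_extends[OF 0(1-5) G ev f] by blast
    have "functionals_extend N q" using 0(8) by simp
    from bspec[OF this[unfolded functionals_extend_def] h(1)]
    obtain F where "F \<in> functionals (free q)" "\<forall>x\<in>N. F x = h x" by blast
    then show "\<exists>F\<in>functionals (free q). \<forall>x\<in>L. F x = f x" using h(2) 0(3) by (metis subsetD)
  qed
  then show ?case by simp
next
  case (Suc n L N p \<pi> q)
  have "ext_vanishes n r (syzygy r u)" if u: "covers r u L" for r u
  proof -
    obtain q' v w where s: "covers q' v (\<pi> ` N)" "covers (r + q') w N" "syzygy r u \<subseteq> syzygy (r + q') w"
      "\<And>x. x \<in> syzygy (r + q') w \<Longrightarrow> tail r x = \<zero>\<^sub>V \<longleftrightarrow> x \<in> syzygy r u"
      "tail r ` syzygy (r + q') w = syzygy q' v"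
      using syzygy_sequence[OF Suc.prems(1-6) u] by blast
    have um: "u \<in> maps (free r)" and wm: "w \<in> maps (free (r + q'))"
      using u s(1,2) by (auto simp: covers_def)
    have tm: "tail r \<in> maps (syzygy (r + q') w)" by (rule submodule_maps_mono[OF tail_maps syzygy_free])
    have tq: "tail r ` syzygy (r + q') w \<subseteq> free q'" unfolding s(5) by (rule syzygy_free)
    have ext: "ext_vanishes (Suc n) q' (tail r ` syzygy (r + q') w)" "ext_vanishes n (r + q') (syzygy (r + q') w)"
      using Suc.prems(7,8) s(1,2) unfolding s(5) by simp_all
    have "ext_vanishes n (r + q') (syzygy r u)"
      by (rule Suc.IH[OF syzygy_submodule[OF um] syzygy_submodule[OF wm] s(3) tm s(4) tq ext])
    then show ?thesis by (rule ext_vanishes_restrict) (rule le_add1)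
  qed
  then show ?case by simp
qed

text \<open>A presentation of \<open>P\<close> also presents \<open>\<pi> P\<close>, and \<open>K\<close> is the quotient of the two modules of relations,
  which reduces half-exactness of \<open>Ext\<close> to the previous lemma.\<close>

lemma ext_vanishes_extension:
  assumes P: "submodule P R V" and K: "K \<subseteq> P" "K \<subseteq> free p"
    and \<pi>: "\<pi> \<in> maps P" "\<And>x. x \<in> P \<Longrightarrow> \<pi> x = \<zero>\<^sub>V \<longleftrightarrow> x \<in> K"
    and ext: "ext_vanishes (Suc n) p K" "ext_vanishes (Suc n) q' (\<pi> ` P)"
  shows "ext_vanishes (Suc n) r P"
proof -
  have "ext_vanishes n q (syzygy q G)" if G: "covers q G P" for q G
  proof -
    let ?Y = "syzygy q (\<lambda>x. \<pi> (G x))"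
    have Gm: "G \<in> maps (free q)" and Gi: "G ` free q = P" using G by (simp_all add: covers_def)
    have pG: "(\<lambda>x. \<pi> (G x)) \<in> maps (free q)" by (rule maps_comp[OF Gm \<pi>(1)]) (use Gi in blast)
    have cov: "covers q (\<lambda>x. \<pi> (G x)) (\<pi> ` P)" using Gi pG by (auto simp: covers_def)
    have sub: "syzygy q G \<subseteq> ?Y" using V_map_zero[OF P \<pi>(1)] by (auto simp: syzygy_def)
    have GY: "G \<in> maps ?Y" by (rule submodule_maps_mono[OF Gm syzygy_free])
    have ker: "G x = \<zero>\<^sub>V \<longleftrightarrow> x \<in> syzygy q G" if "x \<in> ?Y" for x
      using that by (auto simp: syzygy_def)
    have "k \<in> G ` ?Y" if k: "k \<in> K" for k
    proof -
      obtain x where x: "x \<in> free q" "G x = k" using Gi K(1) k by (metis imageE subsetD)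
      have "\<pi> (G x) = \<zero>\<^sub>V" using \<pi>(2)[of k] k K(1) x(2) by blast
      then have "x \<in> ?Y" using x(1) by (simp add: syzygy_def)
      then show ?thesis using x(2) by blast
    qed
    moreover have "G x \<in> K" if x: "x \<in> ?Y" for x
      using \<pi>(2)[of "G x"] x Gi by (auto simp: syzygy_def)
    ultimately have im: "G ` ?Y = K" by blast
    show ?thesis
      by (rule ext_vanishes_kernel[OF syzygy_submodule[OF Gm] syzygy_submodule[OF pG] sub GY ker])
        (use im K(2) ext cov in auto)
  qed
  then show ?thesis by simp
qed

lemma ext_vanishes_iso:
  assumes \<pi>: "\<pi> \<in> maps P" "\<And>x. x \<in> P \<Longrightarrow> \<pi> x = \<zero>\<^sub>V \<longleftrightarrow> x = \<zero>\<^sub>V"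
    and ext: "ext_vanishes (Suc n) q' (\<pi> ` P)"
  shows "ext_vanishes (Suc n) r P"
proof -
  have "covers q (\<lambda>x. \<pi> (G x)) (\<pi> ` P) \<and> syzygy q (\<lambda>x. \<pi> (G x)) = syzygy q G"
    if G: "covers q G P" for q G
  proof -
    have Gm: "G \<in> maps (free q)" "G ` free q = P" using G by (auto simp: covers_def)
    have "(\<lambda>x. \<pi> (G x)) \<in> maps (free q)" by (rule maps_comp[OF Gm(1) \<pi>(1)]) (use Gm in blast)
    then show ?thesis using Gm \<pi>(2) by (auto simp: covers_def syzygy_def)
  qed
  then show ?thesis using ext by (metis ext_vanishes.simps(2))
qed

text \<open>The line \<open>R z\<close> is a copy of the residue field, and every nonzero module of finite length is an
  iterated extension of such copies.\<close>

lemma ext_vanishes_all: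
  assumes z: "z \<in> carrier V" "z \<noteq> \<zero>\<^sub>V" "\<And>c. c \<in> \<mm> \<Longrightarrow> c \<odot>\<^sub>V z = \<zero>\<^sub>V"
    and ext: "ext_vanishes (Suc n) r (V.adjoin {\<zero>\<^sub>V} z)"
    and P: "submodule P R V" "P \<subseteq> free p" "P \<noteq> {\<zero>\<^sub>V}"
  shows "ext_vanishes (Suc n) p P"
proof -
  have quot: "\<exists>\<pi>\<in>maps (V.adjoin K x). \<pi> ` V.adjoin K x = V.adjoin {\<zero>\<^sub>V} z \<and>
      (\<forall>y\<in>V.adjoin K x. \<pi> y = \<zero>\<^sub>V \<longleftrightarrow> y \<in> K)"
    if K: "submodule K R V" and x: "x \<in> carrier V" "x \<notin> K" "\<And>c. c \<in> \<mm> \<Longrightarrow> c \<odot>\<^sub>V x \<in> K" for K x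
  proof -
    obtain \<pi> where \<pi>: "\<pi> \<in> maps (V.adjoin K x)"
      "\<And>k a. k \<in> K \<Longrightarrow> a \<in> carrier R \<Longrightarrow> \<pi> (k \<oplus>\<^sub>V a \<odot>\<^sub>V x) = a \<odot>\<^sub>V z"
      using simple_quotient_map[OF V.module_axioms V.module_axioms K x(1,2) z(1,3)] by blast
    have line: "V.adjoin {\<zero>\<^sub>V} z = {a \<odot>\<^sub>V z | a. a \<in> carrier R}"
    proof -
      have "\<zero>\<^sub>V \<oplus>\<^sub>V a \<odot>\<^sub>V z = a \<odot>\<^sub>V z" if "a \<in> carrier R" for a
        by (rule V.M.l_zero) (use that z(1) in blast)
      then show ?thesis unfolding V.adjoin_def by (metis (no_types, opaque_lifting) singletonD singletonI)
    qed
    have "\<pi> ` V.adjoin K x = V.adjoin {\<zero>\<^sub>V} z"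
    proof (intro equalityI subsetI)
      fix u assume "u \<in> \<pi> ` V.adjoin K x"
      then obtain k a where "k \<in> K" "a \<in> carrier R" "u = \<pi> (k \<oplus>\<^sub>V a \<odot>\<^sub>V x)" unfolding V.adjoin_def by blast
      then show "u \<in> V.adjoin {\<zero>\<^sub>V} z" unfolding line using \<pi>(2) by blast
    next
      fix u assume "u \<in> V.adjoin {\<zero>\<^sub>V} z"
      then obtain a where "a \<in> carrier R" "u = a \<odot>\<^sub>V z" unfolding line by blast
      then show "u \<in> \<pi> ` V.adjoin K x" using \<pi>(2)[OF V.submodule_zero[OF K]] V.adjoinI[OF V.submodule_zero[OF K]]
        by (metis imageI)
    qed
    moreover have "\<pi> y = \<zero>\<^sub>V \<longleftrightarrow> y \<in> K" if y: "y \<in> V.adjoin K x" for y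
    proof -
      obtain k a where ka: "k \<in> K" "a \<in> carrier R" "y = k \<oplus>\<^sub>V a \<odot>\<^sub>V x" using y unfolding V.adjoin_def by blast
      have c: "k \<in> carrier V" "a \<odot>\<^sub>V x \<in> carrier V" using V.submodule_sub[OF K ka(1)] V.smult_closed[OF ka(2) x(1)] .
      have "a \<odot>\<^sub>V z = \<zero>\<^sub>V \<longleftrightarrow> a \<in> \<mm>"
        using scalar_in_m[OF V.module_axioms V.submodule_zero_set z(1)] z(2,3) ka(2) by (metis singletonD singletonI)
      moreover have "y \<in> K \<longleftrightarrow> a \<in> \<mm>"
      proof
        assume "y \<in> K"
        then have "y \<ominus>\<^sub>V k \<in> K" by (rule V.submodule_minus[OF K _ ka(1)])
        moreover have "y \<ominus>\<^sub>V k = a \<odot>\<^sub>V x"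
          unfolding ka(3) using c by (simp add: V.minus_eq V.M.a_ac V.r_neg1 V.r_neg2 V.M.r_neg)
        ultimately show "a \<in> \<mm>" using scalar_in_m[OF V.module_axioms K x(1,2) ka(2)] by simp
      next
        assume "a \<in> \<mm>"
        then show "y \<in> K" unfolding ka(3) using x(3) V.submoduleE(5)[OF K ka(1)] by blast
      qed
      ultimately show ?thesis using \<pi>(2)[OF ka(1,2)] ka(3) by metis
    qed
    ultimately show ?thesis using \<pi>(1) by blast
  qed
  define Q where "Q K \<longleftrightarrow> ext_vanishes (Suc n) p K" for K
  have zs: "submodule {\<zero>\<^sub>V} R V" by (rule V.submodule_zero_set)
  have "{\<zero>\<^sub>V} \<subset> P" using V.submodule_zero[OF P(1)] P(3) by blast
  then obtain x where x: "x \<in> P" "x \<notin> {\<zero>\<^sub>V}" "\<And>c. c \<in> \<mm> \<Longrightarrow> c \<odot>\<^sub>V x \<in> {\<zero>\<^sub>V}"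
    using simple_step[OF V.module_axioms zs P(1)] by metis
  have xc: "x \<in> carrier V" by (rule V.submodule_sub[OF P(1) x(1)])
  have zP: "{\<zero>\<^sub>V} \<subseteq> P" using V.submodule_zero[OF P(1)] by blast
  have K0: "submodule (V.adjoin {\<zero>\<^sub>V} x) R V" "V.adjoin {\<zero>\<^sub>V} x \<subseteq> P"
    using V.adjoin_submodule(1)[OF zs xc] V.adjoin_least[OF P(1) zP x(1)] .
  obtain \<pi> where \<pi>: "\<pi> \<in> maps (V.adjoin {\<zero>\<^sub>V} x)" "\<pi> ` V.adjoin {\<zero>\<^sub>V} x = V.adjoin {\<zero>\<^sub>V} z"
    "\<And>y. y \<in> V.adjoin {\<zero>\<^sub>V} x \<Longrightarrow> \<pi> y = \<zero>\<^sub>V \<longleftrightarrow> y \<in> {\<zero>\<^sub>V}"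
    using quot[OF zs xc x(2,3)] by blast
  have "Q (V.adjoin {\<zero>\<^sub>V} x)" unfolding Q_def
    by (rule ext_vanishes_iso[OF \<pi>(1), where q' = r]) (use \<pi>(2,3) ext in auto)
  then obtain K where K: "submodule K R V" "K \<subseteq> P" "Q K"
    and mx: "\<And>K'. submodule K' R V \<Longrightarrow> K \<subset> K' \<Longrightarrow> K' \<subseteq> P \<Longrightarrow> \<not> Q K'"
    using maximal_submodule[where Q = Q, OF V.module_axioms K0 _ vectors_len_finite[OF P(2)]] by blast
  have "K = P"
  proof (rule ccontr)
    assume "K \<noteq> P"
    then have "K \<subset> P" using K by blast
    then obtain y where y: "y \<in> P" "y \<notin> K" "\<And>c. c \<in> \<mm> \<Longrightarrow> c \<odot>\<^sub>V y \<in> K"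
      using simple_step[OF V.module_axioms K(1) P(1)] by metis
    have yc: "y \<in> carrier V" by (rule V.submodule_sub[OF P(1) y(1)])
    note K' = V.adjoin_submodule[OF K(1) yc] V.adjoin_least[OF P(1) K(2) y(1)]
    obtain \<rho> where \<rho>: "\<rho> \<in> maps (V.adjoin K y)" "\<rho> ` V.adjoin K y = V.adjoin {\<zero>\<^sub>V} z"
      "\<And>w. w \<in> V.adjoin K y \<Longrightarrow> \<rho> w = \<zero>\<^sub>V \<longleftrightarrow> w \<in> K"
      using quot[OF K(1) yc y(2,3)] by blast
    have "Q (V.adjoin K y)" unfolding Q_def
      by (rule ext_vanishes_extension[OF K'(1,2) _ \<rho>(1,3), where p = p and q' = r])
        (use \<rho>(2) ext K(2,3) P(2) Q_def in auto)
    then show False using mx[OF K'(1) _ K'(4)] K'(2,3) y(2) by blast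
  qed
  then show ?thesis using K Q_def by blast
qed

end

section \<open>Minimal acyclic complexes in coordinates\<close>

text \<open>The determinant \<open>b\<^sub>i\<^sup>2 - b\<^sub>i\<^sub>+\<^sub>1 b\<^sub>i\<^sub>-\<^sub>1\<close> is multiplied by \<open>h\<close> when \<open>i\<close> grows by one. Since the sequence
  extends indefinitely to the left, the determinant is divisible by all powers of \<open>h\<close> and therefore
  zero. So the sequence is geometric, and a geometric sequence of positive integers that is infinite
  on both sides is constant.\<close>

lemma two_sided_recurrence_constant:
  fixes b :: "int \<Rightarrow> int"
  assumes pos: "\<And>i. b i > 0" and h: "h \<ge> 2"
    and rec: "\<And>i. e * b i = b (i + 1) + h * b (i - 1)"
  shows "b i = b j"
proof -
  define \<Delta> where "\<Delta> i = b i * b i - b (i + 1) * b (i - 1)" for i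
  have \<Delta>_step: "\<Delta> i = h * \<Delta> (i - 1)" for i
  proof -
    have E1: "b (i + 1) = e * b i - h * b (i - 1)" using rec[of i] by simp
    have E2: "h * b (i - 2) = e * b (i - 1) - b i" using rec[of "i - 1"] by simp
    have "h * \<Delta> (i - 1) = h * b (i - 1) * b (i - 1) - b i * (h * b (i - 2))"
      by (simp add: \<Delta>_def algebra_simps)
    also have "\<dots> = b i * b i - (e * b i - h * b (i - 1)) * b (i - 1)"
      unfolding E2 by (simp add: algebra_simps)
    also have "\<dots> = \<Delta> i" unfolding \<Delta>_def E1 ..
    finally show ?thesis by simp
  qed
  have "\<Delta> i = h ^ n * \<Delta> (i - int n)" for i n
  proof (induction n)
    case (Suc n)
    then show ?case using \<Delta>_step[of "i - int n"] by (simp add: algebra_simps)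
  qed simp
  then have dvd: "h ^ n dvd \<Delta> i" for i n by (metis dvd_triv_left)
  have \<Delta>0: "\<Delta> i = 0" for i
  proof (rule ccontr)
    assume nz: "\<Delta> i \<noteq> 0"
    define n where "n = nat \<bar>\<Delta> i\<bar>"
    have "h ^ n \<le> \<bar>\<Delta> i\<bar>" using dvd_imp_le_int[OF nz dvd[of n i]] h by simp
    moreover have "int n < 2 ^ n" by (metis of_nat_less_two_power)
    moreover have "(2::int) ^ n \<le> h ^ n" using h by (intro power_mono) auto
    ultimately show False by (simp add: n_def)
  qed
  have sq: "b i * b i = b (i + 1) * b (i - 1)" for i using \<Delta>0[of i] by (simp add: \<Delta>_def)
  have down: "b (i - 1) < b i" if "b i < b (i + 1)" for i
  proof (rule ccontr)
    assume "\<not> b (i - 1) < b i"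
    then have "b i * b i \<le> b i * b (i - 1)" using pos[of i] by simp
    also have "\<dots> < b (i + 1) * b (i - 1)" using that pos[of "i - 1"] by simp
    finally show False using sq[of i] by simp
  qed
  have up: "b (i + 1) < b i" if "b i < b (i - 1)" for i
  proof (rule ccontr)
    assume "\<not> b (i + 1) < b i"
    then have "b i * b i \<le> b (i + 1) * b i" using pos[of i] by simp
    also have "\<dots> < b (i + 1) * b (i - 1)" using that pos[of "i + 1"] by simp
    finally show False using sq[of i] by simp
  qed
  have step: "b (i + 1) = b i" for i
  proof (rule ccontr)
    assume "b (i + 1) \<noteq> b i"
    then consider "b i < b (i + 1)" | "b (i + 1) < b i" by linarith
    then show False
    proof cases
      case 1
      have "b (i - int n) < b (i - int n + 1) \<and> b (i - int n) \<le> b i - int n" for n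
      proof (induction n)
        case (Suc n)
        then have "b (i - int n - 1) < b (i - int n)" using down by blast
        then show ?case using Suc by (simp add: algebra_simps)
      qed (use 1 in simp)
      then show False using pos[of "i - int (nat (b i))"] pos[of i]
        by (metis diff_self int_nat_eq less_imp_le linorder_not_less)
    next
      case 2
      have "b (i + int n + 1) < b (i + int n) \<and> b (i + int n) \<le> b i - int n" for n
      proof (induction n)
        case (Suc n)
        then have "b (i + int n + 1 + 1) < b (i + int n + 1)" using up[of "i + int n + 1"] by simp
        then show ?case using Suc by (simp add: algebra_simps)
      qed (use 2 in simp)
      then show False using pos[of "i + int (nat (b i))"] pos[of i]
        by (metis diff_self int_nat_eq less_imp_le linorder_not_less)
    qed
  qed
  have const: "b k = b 0" for k
  proof (induction k rule: int_induct[of _ 0])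
    case (step2 k)
    then show ?case using step[of "k - 1"] by simp
  qed (use step in auto)
  show ?thesis using const[of i] const[of j] by simp
qed

locale minimal_acyclic = cube_zero_ring +
  fixes b :: "int \<Rightarrow> nat" and D :: "int \<Rightarrow> (nat \<Rightarrow> 'a) \<Rightarrow> nat \<Rightarrow> 'a"
  assumes D_maps: "D i \<in> maps (free (b i))"
    and minimal: "v \<in> free (b i) \<Longrightarrow> D i v \<in> vectors R \<mm> (b (i - 1))"
    and exact: "{v \<in> free (b i). D i v = \<zero>\<^sub>V} = D (i + 1) ` free (b (i + 1))"
    and rank_nonzero: "\<exists>i. b i \<noteq> 0"
    and msq_nonzero: "msq \<noteq> {\<zero>}"
    and socle_not_cyclic: "s \<in> socle \<Longrightarrow> \<exists>t\<in>socle. \<forall>a\<in>carrier R. t \<noteq> a \<otimes> s"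
begin

text \<open>The syzygies of the complex.\<close>

definition Z :: "int \<Rightarrow> (nat \<Rightarrow> 'a) set" where
  "Z i = D (i + 1) ` free (b (i + 1))"

text \<open>This is \<open>\<mm> Z\<^sub>i\<close>.\<close>

definition radical :: "int \<Rightarrow> (nat \<Rightarrow> 'a) set" where
  "radical i = D (i + 1) ` vectors R \<mm> (b (i + 1))"

text \<open>An element of \<open>socle R\<^sup>b\<close> outside \<open>\<mm> Z\<^sub>i\<close> would span a direct summand of \<open>Z\<^sub>i\<close> isomorphic to the
  residue field.\<close>

definition no_residue_summand :: "int \<Rightarrow> bool" where
  "no_residue_summand i \<longleftrightarrow> vectors R socle (b i) \<subseteq> radical i"

lemma Z_kernel: "Z i = {v \<in> free (b i). D i v = \<zero>\<^sub>V}"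
  unfolding Z_def by (rule exact[symmetric])

lemma Z_image: "Z (i - 1) = D i ` free (b i)"
  by (simp add: Z_def)

lemma Z_submodule: "submodule (Z i) R V"
  unfolding Z_kernel by (rule V_kernel[OF free_submodule D_maps])

lemma Z_vectors_m: "Z i \<subseteq> vectors R \<mm> (b i)"
  using minimal[of _ "i + 1"] by (auto simp: Z_def)

lemma Z_free: "Z i \<subseteq> free (b i)"
  using Z_vectors_m vectors_sub_free[OF m_ideal] by blast

lemma D_eq_lincomb: "v \<in> free (b i) \<Longrightarrow> D i v = lincomb V (\<lambda>t. D i (unit_vector R t)) (b i) v"
  by (rule linear_eq_lincomb[OF V.module_axioms D_maps])

lemma D_unit_vector: "t < b i \<Longrightarrow> D i (unit_vector R t) \<in> vectors R \<mm> (b (i - 1))"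
  by (rule minimal[OF unit_vector_free])

lemma D_unit_carrier: "t < b i \<Longrightarrow> D i (unit_vector R t) \<in> carrier V"
  using D_unit_vector vectors_sub_free[OF m_ideal] free_in_V by blast

lemma D_in_submodule:
  assumes "submodule N R V" "v \<in> free (b i)" "\<And>t. t < b i \<Longrightarrow> v t \<odot>\<^sub>V D i (unit_vector R t) \<in> N"
  shows "D i v \<in> N"
  unfolding D_eq_lincomb[OF assms(2)]
  by (rule V.lincomb_in_submodule[OF assms(1) D_unit_carrier freeD[OF assms(2)] assms(3)])

lemma radical_submodule: "submodule (radical i) R V"
  unfolding radical_def
  by (rule V_image[OF vectors_submodule[OF m_ideal]
      submodule_maps_mono[OF D_maps vectors_sub_free[OF m_ideal]]])

lemma radical_sub_Z: "radical i \<subseteq> Z i"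
  unfolding radical_def Z_def using vectors_sub_free[OF m_ideal] by blast

text \<open>The columns of the differential have entries in \<open>\<mm>\<close>.\<close>

lemma radical_msq: "radical i \<subseteq> vectors R msq (b i)"
proof
  fix u assume "u \<in> radical i"
  then obtain v where v: "v \<in> vectors R \<mm> (b (i + 1))" "u = D (i + 1) v" unfolding radical_def by blast
  have "D (i + 1) v \<in> vectors R msq (b i)"
  proof (rule D_in_submodule[OF vectors_submodule[OF msq_ideal]])
    show "v \<in> free (b (i + 1))" using v(1) vectors_sub_free[OF m_ideal] by blast
  next
    fix t assume t: "t < b (i + 1)"
    have "v t \<in> \<mm>" using v(1) t by (auto simp: vectors_def)
    moreover have "D (i + 1) (unit_vector R t) \<in> vectors R \<mm> (b i)" using D_unit_vector[OF t] by simp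
    ultimately show "v t \<odot>\<^sub>V D (i + 1) (unit_vector R t) \<in> vectors R msq (b i)"
      using msqI m_carrier by (auto simp: vectors_def sequence_module_simps)
  qed
  then show "u \<in> vectors R msq (b i)" using v(2) by simp
qed

lemma smult_Z_radical:
  assumes "c \<in> \<mm>" "z \<in> Z i"
  shows "c \<odot>\<^sub>V z \<in> radical i"
proof -
  obtain v where v: "v \<in> free (b (i + 1))" "z = D (i + 1) v" using assms(2) unfolding Z_def by blast
  have "c \<odot>\<^sub>V v \<in> vectors R \<mm> (b (i + 1))"
    using v(1) assms(1) m_mult m_comm m_carrier by (auto simp: vectors_def sequence_module_simps)
  moreover have "c \<odot>\<^sub>V z = D (i + 1) (c \<odot>\<^sub>V v)"
    unfolding v(2) by (rule submodule_mapsD(3)[OF D_maps m_carrier[OF assms(1)] v(1), symmetric])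
  ultimately show ?thesis unfolding radical_def by blast
qed

lemma socle_sub_Z: "vectors R socle (b i) \<subseteq> Z i"
proof
  fix w assume w: "w \<in> vectors R socle (b i)"
  have wf: "w \<in> free (b i)" using w vectors_sub_free[OF socle_ideal] by blast
  have "D i w \<in> {\<zero>\<^sub>V}"
  proof (rule D_in_submodule[OF V.submodule_zero_set wf])
    fix t assume t: "t < b i"
    have "w t \<otimes> D i (unit_vector R t) n = \<zero>" for n
    proof (cases "n < b (i - 1)")
      case True
      then have "D i (unit_vector R t) n \<in> \<mm>" using D_unit_vector[OF t] by (auto simp: vectors_def)
      then show ?thesis using w t m_carrier m_comm[of "w t"] by (auto simp: vectors_def socle_def)
    next
      case False
      then have "D i (unit_vector R t) n = \<zero>" using D_unit_vector[OF t] by (auto simp: vectors_def)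
      then show ?thesis using freeD[OF wf] by simp
    qed
    then show "w t \<odot>\<^sub>V D i (unit_vector R t) \<in> {\<zero>\<^sub>V}" by (simp add: sequence_module_simps)
  qed
  then show "w \<in> Z i" using wf unfolding Z_kernel by blast
qed

lemma socle_nonzero: obtains s where "s \<in> socle" "s \<noteq> \<zero>"
proof -
  have "\<zero> \<in> msq" using msq_ideal by (simp add: additive_subgroup.zero_closed ideal.axioms(1))
  then show thesis using that msq_nonzero msq_sub_socle by blast
qed

lemma unit_multiple: "a \<in> J \<Longrightarrow> ideal J R \<Longrightarrow> t < c \<Longrightarrow> a \<odot>\<^sub>V unit_vector R t \<in> vectors R J c"
  using ideal.Icarr[of J R a] additive_subgroup.zero_closed[OF ideal.axioms(1), of J R]
  by (auto simp: vectors_def unit_vector_def sequence_module_simps)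

text \<open>Vanishing of one free module spreads in both directions. Downwards, the next syzygy module is zero
  but contains a nonzero socle vector as soon as the free module is nonzero; upwards, the next free
  module consists of cycles and so lies in its multiple by \<open>\<mm>\<close>.\<close>

lemma rank_pos: "b i > 0"
proof (rule ccontr)
  assume "\<not> b i > 0"
  then have b0: "b i = 0" by simp
  have dn: "b (k - 1) = 0" if "b k = 0" for k
  proof (rule ccontr)
    assume nz: "b (k - 1) \<noteq> 0"
    obtain s where s: "s \<in> socle" "s \<noteq> \<zero>" by (rule socle_nonzero)
    have "s \<odot>\<^sub>V unit_vector R 0 \<in> Z (k - 1)"
      using unit_multiple[OF s(1) socle_ideal, of 0 "b (k - 1)"] nz socle_sub_Z by blast
    then have "s \<odot>\<^sub>V unit_vector R 0 \<in> D k ` {\<zero>\<^sub>V}"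
      unfolding Z_image that vectors_0 .
    then have "s \<odot>\<^sub>V unit_vector R 0 = \<zero>\<^sub>V"
      using V_map_zero[OF free_submodule D_maps, of k]
      by (metis image_empty image_insert singletonD)
    then have "s \<otimes> unit_vector R 0 0 = \<zero>" by (auto simp: sequence_module_simps dest: fun_cong)
    then show False using s by (simp add: unit_vector_def socle_def)
  qed
  have up: "b (k + 1) = 0" if "b k = 0" for k
  proof (rule ccontr)
    assume nz: "b (k + 1) \<noteq> 0"
    have u: "unit_vector R 0 \<in> free (b (k + 1))" using nz unit_vector_free by simp
    have "D (k + 1) (unit_vector R 0) \<in> Z k" using u by (simp add: Z_def)
    then have "D (k + 1) (unit_vector R 0) = \<zero>\<^sub>V" using Z_free[of k] unfolding that vectors_0 by blast
    then have "unit_vector R 0 \<in> Z (k + 1)" using u unfolding Z_kernel by blast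
    then have "unit_vector R 0 0 \<in> \<mm>" using Z_vectors_m[of "k + 1"] nz by (auto simp: vectors_def)
    then show False using one_notin_m by (simp add: unit_vector_def)
  qed
  have "b k = 0" for k
    by (induction k rule: int_induct[of _ i]) (use b0 dn up in auto)
  then show False using rank_nonzero by simp
qed

subsection \<open>Numerical consequences\<close>

text \<open>The ring itself has length \<open>mdim + 1\<close>.\<close>

definition mdim :: nat where "mdim = the_enat (ideal_len \<mm>)"
definition hdim :: nat where "hdim = the_enat (ideal_len msq)"
definition vlen :: "(nat \<Rightarrow> 'a) set \<Rightarrow> nat" where "vlen P = the_enat (len P)"

lemma mdim: "ideal_len \<mm> = enat mdim"
  using ideal_len_finite[of \<mm>] m_carrier by (auto simp: mdim_def subset_iff)

lemma hdim: "ideal_len msq = enat hdim"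
  using ideal_len_finite[of msq] msq_carrier by (auto simp: hdim_def subset_iff)

lemma rdim: "ideal_len (carrier R) = enat (mdim + 1)"
  using ideal_len_carrier mdim by (simp add: one_enat_def)

lemma vlen: "P \<subseteq> free c \<Longrightarrow> len P = enat (vlen P)"
  using vectors_len_finite[of P c] by (auto simp: vlen_def)

lemma vlen_free: "vlen (free c) = c * (mdim + 1)"
  using vectors_length[OF oneideal, of c] rdim by (simp add: vlen_def)

lemma vlen_m: "vlen (vectors R \<mm> c) = c * mdim"
  using vectors_length[OF m_ideal, of c] mdim by (simp add: vlen_def)

lemma vlen_msq: "vlen (vectors R msq c) = c * hdim"
  using vectors_length[OF msq_ideal, of c] hdim by (simp add: vlen_def)

lemma vlen_mono: "P \<subseteq> Q \<Longrightarrow> Q \<subseteq> free c \<Longrightarrow> vlen P \<le> vlen Q"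
  using V.length_mono[of P Q] vlen[of P c] vlen[of Q c] by auto

lemma vlen_rank_nullity:
  assumes "submodule P R V" "P \<subseteq> free c" "f \<in> maps P" "f ` P \<subseteq> free c'"
  shows "vlen P = vlen {x \<in> P. f x = \<zero>\<^sub>V} + vlen (f ` P)"
proof -
  have ker: "{x \<in> P. f x = \<zero>\<^sub>V} \<subseteq> free c" using assms(2) by blast
  have "enat (vlen P) = enat (vlen {x \<in> P. f x = \<zero>\<^sub>V}) + enat (vlen (f ` P))"
    using length_rank_nullity[OF V.module_axioms V.module_axioms assms(1,3)]
    unfolding vlen[OF assms(2)] vlen[OF ker] vlen[OF assms(4)] .
  then show ?thesis by simp
qed

lemma free_length: "b i * (mdim + 1) = vlen (Z i) + vlen (Z (i - 1))"
  using vlen_rank_nullity[OF free_submodule order_refl D_maps, of i "b (i - 1)"] Z_free[of "i - 1"]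
  by (simp add: vlen_free Z_kernel[symmetric] Z_image)

text \<open>The differential takes \<open>R\<^sup>b\<close> onto \<open>Z\<^sub>i\<close> and \<open>\<mm> R\<^sup>b\<close> onto \<open>\<mm> Z\<^sub>i\<close>, both with kernel \<open>Z\<^sub>i\<^sub>+\<^sub>1\<close>.\<close>

lemma Z_length: "vlen (Z i) = b (i + 1) + vlen (radical i)"
proof -
  have ker: "{v \<in> vectors R \<mm> (b (i + 1)). D (i + 1) v = \<zero>\<^sub>V} = Z (i + 1)"
    using Z_vectors_m[of "i + 1"] vectors_sub_free[OF m_ideal] unfolding Z_kernel by blast
  have "b (i + 1) * mdim = vlen (Z (i + 1)) + vlen (radical i)"
    using vlen_rank_nullity[OF vectors_submodule[OF m_ideal] vectors_sub_free[OF m_ideal]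
        submodule_maps_mono[OF D_maps vectors_sub_free[OF m_ideal]], of "i + 1" "b i"]
      radical_sub_Z[of i] Z_free[of i] ker
    by (simp add: vlen_m radical_def)
  moreover have "b (i + 1) * (mdim + 1) = vlen (Z (i + 1)) + vlen (Z i)"
    using free_length[of "i + 1"] by simp
  ultimately show ?thesis by (simp add: algebra_simps)
qed

text \<open>The inclusions \<open>socle R\<^sup>b \<subseteq> \<mm> Z\<^sub>i \<subseteq> \<mm>\<^sup>2 R\<^sup>b\<close>, read off in one coordinate.\<close>

lemma socle_eq_msq:
  assumes "no_residue_summand i"
  shows "socle = msq"
proof
  show "socle \<subseteq> msq"
  proof
    fix s assume s: "s \<in> socle"
    have "s \<odot>\<^sub>V unit_vector R 0 \<in> vectors R msq (b i)"
      using unit_multiple[OF s socle_ideal rank_pos] assms radical_msq unfolding no_residue_summand_def by blast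
    then have "s \<otimes> unit_vector R 0 0 \<in> msq" using rank_pos[of i] by (auto simp: vectors_def sequence_module_simps)
    then show "s \<in> msq" using s by (simp add: unit_vector_def socle_def)
  qed
qed (rule msq_sub_socle)

lemma Z_length_no_residue:
  assumes "no_residue_summand i"
  shows "vlen (Z i) = b (i + 1) + b i * hdim"
proof -
  have "radical i = vectors R msq (b i)"
    using radical_msq assms[unfolded no_residue_summand_def socle_eq_msq[OF assms]] by (rule subset_antisym)
  then show ?thesis using Z_length vlen_msq by simp
qed

lemma rank_recurrence:
  assumes "no_residue_summand i" "no_residue_summand (i - 1)"
  shows "b i * mdim = b (i + 1) + b i * hdim + b (i - 1) * hdim"
  using free_length[of i] Z_length_no_residue[OF assms(1)] Z_length_no_residue[OF assms(2)]
  by (simp add: algebra_simps)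

lemma hdim_ge_2:
  assumes "socle = msq"
  shows "hdim \<ge> 2"
proof -
  obtain s where s: "s \<in> socle" "s \<noteq> \<zero>" by (rule socle_nonzero)
  then obtain t where t: "t \<in> socle" "\<And>a. a \<in> carrier R \<Longrightarrow> t \<noteq> a \<otimes> s" using socle_not_cyclic by blast
  have sc: "s \<in> carrier R" using s by (simp add: socle_def)
  have z: "submodule {\<zero>} R RR" using RR.submodule_zero_set by simp
  define L where "L = RR.adjoin {\<zero>} s"
  have L: "submodule L R RR" "{\<zero>} \<subseteq> L" "s \<in> L"
    unfolding L_def using RR.adjoin_submodule[OF z, of s] sc by auto
  have ss: "submodule socle R RR" using socle_ideal ideal_submodule by blast
  have "L \<subseteq> socle" unfolding L_def
    by (rule RR.adjoin_least[OF ss]) (use s RR.submodule_zero[OF ss] in auto)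
  moreover have "t \<notin> L"
  proof
    assume "t \<in> L"
    then obtain a where "a \<in> carrier R" "t = \<zero> \<oplus> a \<otimes> s" unfolding L_def RR.adjoin_def by auto
    then show False using t(2)[of a] sc by simp
  qed
  ultimately have "L \<subset> socle" using t(1) by blast
  then have 2: "ideal_len L + 1 \<le> ideal_len socle" by (rule RR.length_strict_mono[OF L(1)])
  have "{\<zero>} \<subset> L" using L s by blast
  then have "ideal_len {\<zero>} + 1 \<le> ideal_len L" by (rule RR.length_strict_mono[OF z])
  then have "1 + 1 \<le> ideal_len L + 1" using add_right_mono[of 1 "ideal_len L" 1] RR.length_zero by simp
  then have "1 + 1 \<le> ideal_len msq" using 2 assms order_trans by metis
  then show ?thesis using hdim by (simp add: one_enat_def)
qed

subsection \<open>Residue field summands and Ext\<close>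

text \<open>A complement of \<open>R w\<close> in \<open>Z\<^sub>i\<close>, found as a maximal submodule among those that contain \<open>\<mm> Z\<^sub>i\<close> but
  not \<open>w\<close>.\<close>

lemma residue_complement:
  assumes w: "w \<in> vectors R socle (b i)" "w \<notin> radical i"
  obtains K where "submodule K R V" "w \<notin> K" "Z i = V.adjoin K w"
proof -
  have wZ: "w \<in> Z i" using w socle_sub_Z by blast
  have wc: "w \<in> carrier V" using wZ Z_free free_in_V by blast
  obtain K where K: "submodule K R V" "K \<subseteq> Z i" "radical i \<subseteq> K \<and> w \<notin> K"
    and mx: "\<And>K'. submodule K' R V \<Longrightarrow> K \<subset> K' \<Longrightarrow> K' \<subseteq> Z i \<Longrightarrow> \<not> (radical i \<subseteq> K' \<and> w \<notin> K')"
    using maximal_submodule[where Q = "\<lambda>K. radical i \<subseteq> K \<and> w \<notin> K", OF V.module_axioms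
        radical_submodule radical_sub_Z _ vectors_len_finite[OF Z_free]] w(2) by blast
  have "Z i \<subseteq> V.adjoin K w"
  proof
    fix y assume y: "y \<in> Z i"
    have yc: "y \<in> carrier V" using y Z_free free_in_V by blast
    show "y \<in> V.adjoin K w"
    proof (cases "y \<in> K")
      case True
      then show ?thesis using V.adjoin_submodule(2)[OF K(1) wc] by blast
    next
      case False
      note ad = V.adjoin_submodule[OF K(1) yc]
      have "w \<in> V.adjoin K y"
        using mx[OF ad(1) _ V.adjoin_least[OF Z_submodule K(2) y]] ad(2,3) False K(3) by blast
      then obtain k a where ka: "k \<in> K" "a \<in> carrier R" "w = k \<oplus>\<^sub>V a \<odot>\<^sub>V y"
        unfolding V.adjoin_def by blast
      have "a \<notin> \<mm>"
      proof
        assume "a \<in> \<mm>"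
        then have "a \<odot>\<^sub>V y \<in> K" using smult_Z_radical y K(3) by blast
        then show False using V.submoduleE(5)[OF K(1) ka(1)] ka(3) K(3) by metis
      qed
      then obtain c where c: "c \<in> carrier R" "c \<otimes> a = \<one>" using unit_outside_m ka(2) by metis
      have kc: "k \<in> carrier V" by (rule V.submodule_sub[OF K(1) ka(1)])
      have "c \<odot>\<^sub>V w = c \<odot>\<^sub>V k \<oplus>\<^sub>V (c \<otimes> a) \<odot>\<^sub>V y"
        unfolding ka(3) by (rule V.adjoin_smult[OF kc ka(2) c(1) yc])
      then have cw: "c \<odot>\<^sub>V w = c \<odot>\<^sub>V k \<oplus>\<^sub>V y" unfolding c(2) V.smult_one[OF yc] .
      have ckK: "c \<odot>\<^sub>V k \<in> K" by (rule V.submoduleE(4)[OF K(1) c(1) ka(1)])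
      have "y = \<ominus>\<^bsub>V\<^esub> (c \<odot>\<^sub>V k) \<oplus>\<^sub>V c \<odot>\<^sub>V w"
        unfolding cw using V.submodule_sub[OF K(1) ckK] yc by (simp add: V.r_neg1)
      then show ?thesis using V.adjoinI[OF V.submoduleE(3)[OF K(1) ckK] c(1)] by metis
    qed
  qed
  then have "Z i = V.adjoin K w" using V.adjoin_least[OF Z_submodule K(2) wZ] by blast
  then show thesis using that K by blast
qed

lemma socle_kills: "w \<in> vectors R socle c \<Longrightarrow> a \<in> \<mm> \<Longrightarrow> a \<odot>\<^sub>V w = \<zero>\<^sub>V"
proof -
  assume w: "w \<in> vectors R socle c" and a: "a \<in> \<mm>"
  have "a \<otimes> w n = \<zero>" for n
    by (cases "n < c") (use w a m_carrier[OF a] in \<open>auto simp: vectors_def socle_def\<close>)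
  then show ?thesis by (simp add: sequence_module_simps)
qed

text \<open>If \<open>w\<close> spans a residue field summand of \<open>Z\<^sub>i\<close>, then some functional sends \<open>w\<close> to a socle element
  \<open>s \<noteq> 0\<close> and a complement to zero. An extension of it to the free module takes a unit as a value,
  because the coordinates of \<open>w\<close> lie in the socle; so it maps \<open>socle R\<^sup>b\<close> onto the socle. But \<open>socle R\<^sup>b\<close>
  lies in \<open>Z\<^sub>i\<close>, where only multiples of \<open>s\<close> are attained.\<close>

lemma extend_imp_no_residue:
  assumes ext: "functionals_extend (Z i) (b i)"
  shows "no_residue_summand i"
proof (rule ccontr)
  assume "\<not> no_residue_summand i"
  then obtain w where w: "w \<in> vectors R socle (b i)" "w \<notin> radical i"
    unfolding no_residue_summand_def by blast
  have wf: "w \<in> free (b i)" using w vectors_sub_free[OF socle_ideal] by blast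
  obtain K where K: "submodule K R V" "w \<notin> K" "Z i = V.adjoin K w" using residue_complement[OF w] .
  obtain s where s: "s \<in> socle" "s \<noteq> \<zero>" by (rule socle_nonzero)
  have sc: "s \<in> carrier R" using s by (simp add: socle_def)
  obtain f where f: "f \<in> functionals (Z i)"
    "\<And>k a. k \<in> K \<Longrightarrow> a \<in> carrier R \<Longrightarrow> f (k \<oplus>\<^sub>V a \<odot>\<^sub>V w) = a \<odot>\<^bsub>RR\<^esub> s"
    using simple_quotient_map[OF V.module_axioms RR.module_axioms K(1) free_in_V[OF wf] K(2), of s] s sc
    unfolding K(3) by (auto simp: socle_def)
  obtain F where F: "F \<in> functionals (free (b i))" "\<And>z. z \<in> Z i \<Longrightarrow> F z = f z"
    using bspec[OF ext[unfolded functionals_extend_def] f(1)] by blast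
  note FD = submodule_mapsD[OF F(1)]
  have "F w = s"
  proof -
    have "w = \<zero>\<^sub>V \<oplus>\<^sub>V \<one> \<odot>\<^sub>V w" using free_in_V[OF wf] by simp
    then have "f w = \<one> \<odot>\<^bsub>RR\<^esub> s" using f(2)[OF V.submodule_zero[OF K(1)] one_closed] by metis
    then show ?thesis using F(2) w(1) socle_sub_Z sc by auto
  qed
  have "\<exists>t<b i. F (unit_vector R t) \<notin> \<mm>"
  proof (rule ccontr)
    assume "\<not> ?thesis"
    then have Fm: "\<And>t. t < b i \<Longrightarrow> F (unit_vector R t) \<in> \<mm>" by blast
    have "lincomb RR (\<lambda>t. F (unit_vector R t)) (b i) w \<in> {\<zero>}"
    proof (rule RR.lincomb_in_submodule)
      show "submodule {\<zero>} R RR" using RR.submodule_zero_set by simp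
      fix t assume t: "t < b i"
      show "F (unit_vector R t) \<in> carrier RR" using Fm[OF t] m_carrier by simp
      show "w t \<in> carrier R" by (rule freeD[OF wf])
      have "w t \<in> socle" using w(1) t by (auto simp: vectors_def)
      then show "w t \<odot>\<^bsub>RR\<^esub> F (unit_vector R t) \<in> {\<zero>}"
        using Fm[OF t] m_comm[of "w t" "F (unit_vector R t)"] m_carrier by (simp add: socle_def)
    qed
    then show False using linear_eq_lincomb[OF RR.module_axioms F(1) wf] \<open>F w = s\<close> s(2) by simp
  qed
  then obtain t where t: "t < b i" "F (unit_vector R t) \<notin> \<mm>" by blast
  have Ftc: "F (unit_vector R t) \<in> carrier R" using FD(1)[OF unit_vector_free[OF t(1)]] by simp
  obtain c where c: "c \<in> carrier R" "c \<otimes> F (unit_vector R t) = \<one>" using unit_outside_m[OF Ftc t(2)] .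
  obtain r where r: "r \<in> socle" "\<And>a. a \<in> carrier R \<Longrightarrow> r \<noteq> a \<otimes> s" using socle_not_cyclic[OF s(1)] by blast
  have rc: "r \<in> carrier R" using r by (simp add: socle_def)
  have rcs: "c \<otimes> r \<in> socle" using r(1) c(1) ideal.I_l_closed[OF socle_ideal] by blast
  have cr: "c \<otimes> r \<in> carrier R" using c rc by simp
  have vZ: "(c \<otimes> r) \<odot>\<^sub>V unit_vector R t \<in> Z i"
    using unit_multiple[OF rcs socle_ideal t(1)] socle_sub_Z by blast
  then obtain k a where ka: "k \<in> K" "a \<in> carrier R" "(c \<otimes> r) \<odot>\<^sub>V unit_vector R t = k \<oplus>\<^sub>V a \<odot>\<^sub>V w"
    unfolding K(3) V.adjoin_def by blast
  have "F ((c \<otimes> r) \<odot>\<^sub>V unit_vector R t) = (c \<otimes> r) \<otimes> F (unit_vector R t)"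
    using FD(3)[OF cr unit_vector_free[OF t(1)]] by simp
  also have "\<dots> = r \<otimes> (c \<otimes> F (unit_vector R t))" using c(1) rc Ftc by (simp add: m_ac)
  also have "\<dots> = r" using c(2) rc by simp
  finally have "F ((c \<otimes> r) \<odot>\<^sub>V unit_vector R t) = r" .
  moreover have "F ((c \<otimes> r) \<odot>\<^sub>V unit_vector R t) = a \<otimes> s"
    using F(2)[OF vZ] f(2)[OF ka(1,2)] unfolding ka(3) by simp
  ultimately show False using r(2)[OF ka(2)] by simp
qed

text \<open>A retraction of \<open>Z\<^sub>i\<close> onto \<open>P\<close>, up to maps that extend to the ambient free module. Unlike retractions
  in the strict sense, these pass to syzygies, and the error term is harmless for \<open>Ext\<close>.\<close>

definition retraction ::
  "(nat \<Rightarrow> 'a) set \<Rightarrow> nat \<Rightarrow> int \<Rightarrow> ((nat \<Rightarrow> 'a) \<Rightarrow> nat \<Rightarrow> 'a) \<Rightarrow> ((nat \<Rightarrow> 'a) \<Rightarrow> nat \<Rightarrow> 'a) \<Rightarrow>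
   ((nat \<Rightarrow> 'a) \<Rightarrow> nat \<Rightarrow> 'a) \<Rightarrow> bool" where
  "retraction P q i \<alpha> \<beta> \<rho> \<longleftrightarrow>
     submodule P R V \<and> P \<subseteq> free q \<and>
     \<alpha> \<in> maps (free q) \<and> \<alpha> ` free q \<subseteq> free (b i) \<and> \<alpha> ` P \<subseteq> Z i \<and> \<beta> \<in> maps (Z i) \<and> \<beta> ` Z i \<subseteq> P \<and>
     \<rho> \<in> maps (free q) \<and> \<rho> ` free q \<subseteq> P \<and> (\<forall>x\<in>P. \<beta> (\<alpha> x) = x \<oplus>\<^sub>V \<rho> x)"

definition stable_retract :: "(nat \<Rightarrow> 'a) set \<Rightarrow> nat \<Rightarrow> int \<Rightarrow> bool" where
  "stable_retract P q i \<longleftrightarrow> (\<exists>\<alpha> \<beta> \<rho>. retraction P q i \<alpha> \<beta> \<rho>)"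

lemma retractionD:
  assumes "retraction P q i \<alpha> \<beta> \<rho>"
  shows "submodule P R V" "P \<subseteq> free q" "\<alpha> \<in> maps (free q)" "\<alpha> ` free q \<subseteq> free (b i)" "\<alpha> ` P \<subseteq> Z i"
    "\<beta> \<in> maps (Z i)" "\<beta> ` Z i \<subseteq> P" "\<rho> \<in> maps (free q)" "\<rho> ` free q \<subseteq> P"
    "\<And>x. x \<in> P \<Longrightarrow> \<beta> (\<alpha> x) = x \<oplus>\<^sub>V \<rho> x"
  using assms unfolding retraction_def by (simp_all)

text \<open>Lift \<open>\<alpha>\<close>, \<open>\<beta>\<close> and \<open>\<rho>\<close> to the presentations of \<open>P\<close> and \<open>Z\<^sub>i\<close>; the lifts compose to the identity up
  to a map into the relations.\<close>

lemma stable_retract_syzygy: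
  assumes r: "stable_retract P q i" and G: "covers p G P"
  shows "stable_retract (syzygy p G) p (i + 1)"
proof -
  obtain \<alpha> \<beta> \<rho> where ret: "retraction P q i \<alpha> \<beta> \<rho>" using r unfolding stable_retract_def by blast
  note P = retractionD(1,2)[OF ret] and \<alpha> = retractionD(3,5)[OF ret]
    and \<beta> = retractionD(6,7)[OF ret] and \<rho> = retractionD(8,9)[OF ret] and eq = retractionD(10)[OF ret]
  have Gm: "G \<in> maps (free p)" and Gi: "G ` free p = P" using G by (auto simp: covers_def)
  have GP: "G x \<in> P" if "x \<in> free p" for x using that Gi by blast
  note Vm = V.module_axioms
  have z0: "f \<zero>\<^sub>V = \<zero>\<^sub>V" if "f \<in> maps N" "submodule N R V" for f N
    by (rule submodule_map_zero[OF Vm Vm that(2,1)])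
  have aG: "(\<lambda>x. \<alpha> (G x)) \<in> maps (free p)" by (rule maps_comp[OF Gm \<alpha>(1)]) (use Gi P(2) in blast)
  obtain \<alpha>' where \<alpha>': "\<alpha>' \<in> maps (free p)" "\<And>x. x \<in> free p \<Longrightarrow> \<alpha>' x \<in> free (b (i + 1))"
    "\<And>x. x \<in> free p \<Longrightarrow> D (i + 1) (\<alpha>' x) = \<alpha> (G x)"
    using free_lift[OF Vm Vm free_submodule D_maps aG] GP \<alpha>(2) unfolding Z_def by blast
  have DZ: "D (i + 1) x \<in> Z i" if "x \<in> free (b (i + 1))" for x using that unfolding Z_def by blast
  have bD: "(\<lambda>x. \<beta> (D (i + 1) x)) \<in> maps (free (b (i + 1)))" by (rule maps_comp[OF D_maps \<beta>(1)]) (use DZ in blast)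
  have "(\<lambda>x. \<beta> (D (i + 1) x)) ` free (b (i + 1)) \<subseteq> G ` free p" using DZ \<beta>(2) Gi by blast
  then obtain \<beta>' where \<beta>': "\<beta>' \<in> maps (free (b (i + 1)))" "\<And>x. x \<in> free (b (i + 1)) \<Longrightarrow> \<beta>' x \<in> free p"
    "\<And>x. x \<in> free (b (i + 1)) \<Longrightarrow> G (\<beta>' x) = \<beta> (D (i + 1) x)"
    using free_lift[OF Vm Vm free_submodule Gm bD] by blast
  obtain \<sigma> where \<sigma>: "\<sigma> \<in> maps (free q)" "\<And>x. x \<in> free q \<Longrightarrow> \<sigma> x \<in> free p" "\<And>x. x \<in> free q \<Longrightarrow> G (\<sigma> x) = \<rho> x"
    using free_lift[OF Vm Vm free_submodule Gm \<rho>(1)] \<rho>(2) Gi by blast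
  define \<rho>' where "\<rho>' x = (\<beta>' (\<alpha>' x) \<ominus>\<^sub>V x) \<ominus>\<^sub>V \<sigma> (G x)" for x
  have id: "(\<lambda>x. x) \<in> maps (free p)" by (rule submodule_mapsI) (use free_in_V in auto)
  have ba: "(\<lambda>x. \<beta>' (\<alpha>' x)) \<in> maps (free p)" by (rule maps_comp[OF \<alpha>'(1) \<beta>'(1)]) (use \<alpha>'(2) in blast)
  have sG: "(\<lambda>x. \<sigma> (G x)) \<in> maps (free p)" by (rule maps_comp[OF Gm \<sigma>(1)]) (use Gi P(2) in blast)
  have \<rho>'m: "\<rho>' \<in> maps (free p)" unfolding \<rho>'_def by (rule maps_minus[OF Vm Vm maps_minus[OF Vm Vm ba id] sG])
  have \<rho>'s: "\<rho>' x \<in> syzygy p G" if x: "x \<in> free p" for x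
  proof -
    have f: "\<beta>' (\<alpha>' x) \<in> free p" "\<sigma> (G x) \<in> free p" using \<beta>'(2)[OF \<alpha>'(2)[OF x]] \<sigma>(2) GP[OF x] P(2) by auto
    have f2: "\<beta>' (\<alpha>' x) \<ominus>\<^sub>V x \<in> free p" by (rule V.submodule_minus[OF free_submodule f(1) x])
    have "\<rho>' x \<in> free p" unfolding \<rho>'_def by (rule V.submodule_minus[OF free_submodule f2 f(2)])
    moreover have "G (\<rho>' x) = (G (\<beta>' (\<alpha>' x)) \<ominus>\<^sub>V G x) \<ominus>\<^sub>V G (\<sigma> (G x))"
      unfolding \<rho>'_def submodule_map_minus[OF Vm Vm free_submodule Gm f2 f(2)]
        submodule_map_minus[OF Vm Vm free_submodule Gm f(1) x] ..
    moreover have "G (\<beta>' (\<alpha>' x)) = G x \<oplus>\<^sub>V \<rho> (G x)"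
      unfolding \<beta>'(3)[OF \<alpha>'(2)[OF x]] \<alpha>'(3)[OF x] by (rule eq[OF GP[OF x]])
    moreover have "G (\<sigma> (G x)) = \<rho> (G x)" by (rule \<sigma>(3)) (use GP[OF x] P(2) in blast)
    moreover have "(G x \<oplus>\<^sub>V \<rho> (G x)) \<ominus>\<^sub>V G x \<ominus>\<^sub>V \<rho> (G x) = \<zero>\<^sub>V"
    proof -
      have c: "G x \<in> carrier V" "\<rho> (G x) \<in> carrier V"
        using V.submodule_sub[OF P(1)] GP[OF x] \<rho>(2) P(2) by blast+
      show ?thesis unfolding V.add_minus_cancel[OF c] using c(2) by (simp add: V.minus_eq V.r_neg)
    qed
    ultimately show ?thesis by (simp add: syzygy_def)
  qed
  have 1: "\<alpha>' x \<in> Z (i + 1)" if "x \<in> syzygy p G" for x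
  proof -
    have x: "x \<in> free p" "G x = \<zero>\<^sub>V" using that by (simp_all add: syzygy_def)
    have "D (i + 1) (\<alpha>' x) = \<zero>\<^sub>V" unfolding \<alpha>'(3)[OF x(1)] x(2) by (rule z0[OF \<alpha>(1) free_submodule])
    then show ?thesis unfolding Z_kernel using \<alpha>'(2)[OF x(1)] by blast
  qed
  have 2: "\<beta>' x \<in> syzygy p G" if "x \<in> Z (i + 1)" for x
  proof -
    have x: "x \<in> free (b (i + 1))" "D (i + 1) x = \<zero>\<^sub>V" using that unfolding Z_kernel by blast+
    have "G (\<beta>' x) = \<zero>\<^sub>V" unfolding \<beta>'(3)[OF x(1)] x(2) by (rule z0[OF \<beta>(1) Z_submodule])
    then show ?thesis using \<beta>'(2)[OF x(1)] by (simp add: syzygy_def)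
  qed
  have 3: "\<beta>' (\<alpha>' x) = x \<oplus>\<^sub>V \<rho>' x" if "x \<in> syzygy p G" for x
  proof -
    have x: "x \<in> free p" "G x = \<zero>\<^sub>V" using that by (simp_all add: syzygy_def)
    have s0: "\<sigma> (G x) = \<zero>\<^sub>V" unfolding x(2) by (rule z0[OF \<sigma>(1) free_submodule])
    have c: "x \<in> carrier V" "\<beta>' (\<alpha>' x) \<in> carrier V"
      using free_in_V[OF x(1)] free_in_V[OF \<beta>'(2)[OF \<alpha>'(2)[OF x(1)]]] .
    show ?thesis unfolding \<rho>'_def s0 by (rule V.plus_minus_cancel[OF c, symmetric])
  qed
  have "retraction (syzygy p G) p (i + 1) \<alpha>' \<beta>' \<rho>'"
    unfolding retraction_def
  proof (intro conjI ballI syzygy_submodule[OF Gm] syzygy_free \<alpha>'(1) submodule_maps_mono[OF \<beta>'(1) Z_free] \<rho>'m)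
    show "\<alpha>' ` free p \<subseteq> free (b (i + 1))" using \<alpha>'(2) by blast
    show "\<alpha>' ` syzygy p G \<subseteq> Z (i + 1)" using 1 by blast
    show "\<beta>' ` Z (i + 1) \<subseteq> syzygy p G" using 2 by blast
    show "\<rho>' ` free p \<subseteq> syzygy p G" using \<rho>'s by blast
    show "\<beta>' (\<alpha>' x) = x \<oplus>\<^sub>V \<rho>' x" if "x \<in> syzygy p G" for x by (rule 3[OF that])
  qed
  then show ?thesis unfolding stable_retract_def by blast
qed

lemma stable_retract_extend:
  assumes r: "stable_retract P q i" and ext: "functionals_extend (Z i) (b i)"
  shows "functionals_extend P q"
  unfolding functionals_extend_def
proof
  fix f assume f: "f \<in> functionals P"
  obtain \<alpha> \<beta> \<rho> where ret: "retraction P q i \<alpha> \<beta> \<rho>" using r unfolding stable_retract_def by blast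
  note P = retractionD(1,2)[OF ret] and \<alpha> = retractionD(3-5)[OF ret]
    and \<beta> = retractionD(6,7)[OF ret] and \<rho> = retractionD(8,9)[OF ret] and eq = retractionD(10)[OF ret]
  have fb: "(\<lambda>x. f (\<beta> x)) \<in> functionals (Z i)" by (rule maps_comp[OF \<beta>(1) f \<beta>(2)])
  obtain F where F: "F \<in> functionals (free (b i))" "\<And>x. x \<in> Z i \<Longrightarrow> F x = f (\<beta> x)"
    using bspec[OF ext[unfolded functionals_extend_def] fb] by blast
  have Fa: "(\<lambda>x. F (\<alpha> x)) \<in> functionals (free q)" by (rule maps_comp[OF \<alpha>(1) F(1) \<alpha>(2)])
  have fr: "(\<lambda>x. f (\<rho> x)) \<in> functionals (free q)" by (rule maps_comp[OF \<rho>(1) f \<rho>(2)])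
  define H where "H x = F (\<alpha> x) \<ominus>\<^bsub>RR\<^esub> f (\<rho> x)" for x
  have "H \<in> functionals (free q)"
    unfolding H_def by (rule maps_minus[OF V.module_axioms RR.module_axioms Fa fr])
  moreover have "H x = f x" if x: "x \<in> P" for x
  proof -
    have xq: "x \<in> free q" using x P(2) by blast
    have r: "\<rho> x \<in> P" using \<rho>(2) xq by blast
    have "F (\<alpha> x) = f (x \<oplus>\<^sub>V \<rho> x)" using F(2) \<alpha>(3) x eq[OF x] by (metis image_subset_iff)
    also have "\<dots> = f (\<rho> x) \<oplus>\<^bsub>RR\<^esub> f x"
      using submodule_mapsD(2)[OF f x r] submodule_mapsD(1)[OF f x] submodule_mapsD(1)[OF f r] by (simp add: a_comm)
    finally show ?thesis
      unfolding H_def using RR.add_minus_cancel[OF submodule_mapsD(1)[OF f r] submodule_mapsD(1)[OF f x]] by simp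
  qed
  ultimately show "\<exists>F\<in>functionals (free q). \<forall>x\<in>P. F x = f x" by blast
qed

text \<open>\<open>Ext\<close> of a stable retract of \<open>Z\<^sub>i\<close> is a direct summand of \<open>Ext\<close> of \<open>Z\<^sub>i\<close>, which the complex itself
  computes.\<close>

lemma stable_retract_ext_vanishes:
  assumes "stable_retract P q i" "functionals_extend (Z (i + int n)) (b (i + int n))"
  shows "ext_vanishes n q P"
  using assms
proof (induction n arbitrary: P q i)
  case 0
  then show ?case using stable_retract_extend by simp
next
  case (Suc n)
  have "ext_vanishes n p (syzygy p G)" if "covers p G P" for p G
    using Suc.IH[OF stable_retract_syzygy[OF Suc.prems(1) that]] Suc.prems(2) by (simp add: algebra_simps)
  then show ?case by simp
qed

lemma ext_vanishes_Z:
  assumes "ext_vanishes n (b i) (Z i)"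
  shows "functionals_extend (Z (i + int n)) (b (i + int n))"
  using assms
proof (induction n arbitrary: i)
  case (Suc n)
  have "covers (b (i + 1)) (D (i + 1)) (Z i)" "syzygy (b (i + 1)) (D (i + 1)) = Z (i + 1)"
    using D_maps by (auto simp: covers_def Z_def syzygy_def exact)
  then have "ext_vanishes n (b (i + 1)) (Z (i + 1))" using Suc.prems by (metis ext_vanishes.simps(2))
  from Suc.IH[OF this] show ?case by (simp add: algebra_simps)
qed simp

lemma residue_line_retract:
  assumes w: "w \<in> vectors R socle (b i)" "w \<notin> radical i"
  shows "stable_retract (V.adjoin {\<zero>\<^sub>V} w) (b i) i"
proof -
  have wf: "w \<in> free (b i)" using w vectors_sub_free[OF socle_ideal] by blast
  have wc: "w \<in> carrier V" by (rule free_in_V[OF wf])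
  have wZ: "w \<in> Z i" using w socle_sub_Z by blast
  obtain K where K: "submodule K R V" "w \<notin> K" "Z i = V.adjoin K w" using residue_complement[OF w] .
  obtain \<beta> where \<beta>: "\<beta> \<in> maps (Z i)"
    "\<And>k a. k \<in> K \<Longrightarrow> a \<in> carrier R \<Longrightarrow> \<beta> (k \<oplus>\<^sub>V a \<odot>\<^sub>V w) = a \<odot>\<^sub>V w"
    using simple_quotient_map[OF V.module_axioms V.module_axioms K(1) wc K(2) wc socle_kills[OF w(1)]]
    unfolding K(3) by blast
  note zs = V.submodule_zero_set
  note line = V.adjoin_submodule[OF zs wc]
  have lineZ: "V.adjoin {\<zero>\<^sub>V} w \<subseteq> Z i"
    by (rule V.adjoin_least[OF Z_submodule _ wZ]) (use V.submodule_zero[OF Z_submodule] in blast)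
  have id: "(\<lambda>x. x) \<in> maps (free (b i))" by (rule submodule_mapsI) (use free_in_V in auto)
  have zero: "(\<lambda>x. \<zero>\<^sub>V) \<in> maps (free (b i))" by (rule submodule_mapsI) (auto simp: sequence_module_simps)
  have "\<beta> z \<in> V.adjoin {\<zero>\<^sub>V} w" if z: "z \<in> Z i" for z
  proof -
    obtain k a where ka: "k \<in> K" "a \<in> carrier R" "z = k \<oplus>\<^sub>V a \<odot>\<^sub>V w"
      using z unfolding K(3) V.adjoin_def by blast
    show ?thesis unfolding ka(3) \<beta>(2)[OF ka(1,2)] by (rule V.submoduleE(4)[OF line(1) ka(2) line(3)])
  qed
  moreover have "\<beta> x = x \<oplus>\<^sub>V \<zero>\<^sub>V" if x: "x \<in> V.adjoin {\<zero>\<^sub>V} w" for x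
  proof -
    obtain a where a: "a \<in> carrier R" "x = \<zero>\<^sub>V \<oplus>\<^sub>V a \<odot>\<^sub>V w" using x unfolding V.adjoin_def by blast
    have c: "a \<odot>\<^sub>V w \<in> carrier V" using V.smult_closed[OF a(1) wc] .
    have "\<beta> x = a \<odot>\<^sub>V w" unfolding a(2) by (rule \<beta>(2)[OF V.submodule_zero[OF K(1)] a(1)])
    then show ?thesis using a(2) V.M.l_zero[OF c] V.M.r_zero[OF c] by metis
  qed
  ultimately have "retraction (V.adjoin {\<zero>\<^sub>V} w) (b i) i (\<lambda>x. x) \<beta> (\<lambda>x. \<zero>\<^sub>V)"
    unfolding retraction_def using line(1,2) id zero \<beta>(1) lineZ Z_free[of i]
    by (intro conjI) (assumption | blast)+
  then show ?thesis unfolding stable_retract_def by blast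
qed

text \<open>If \<open>Z\<^sub>j\<close> has a residue field summand and \<open>i > j\<close>, then the hypothesis gives \<open>Ext\<^sup>i\<^sup>-\<^sup>j(k, R) = 0\<close> for the
  residue field \<open>k\<close>, hence the same vanishing for every module of finite length. Applied to the syzygy
  module \<open>i - j\<close> places below \<open>Z\<^sub>j\<close>, it says that functionals extend from \<open>Z\<^sub>j\<close>, which excludes residue
  field summands of \<open>Z\<^sub>j\<close>.\<close>

lemma extend_imp_no_residue_below:
  assumes ext: "functionals_extend (Z i) (b i)" and "j \<le> i"
  shows "no_residue_summand j"
proof (rule ccontr)
  assume no: "\<not> no_residue_summand j"
  then have "j < i" using extend_imp_no_residue[OF ext] assms(2) by (cases "j = i") auto
  define n where "n = nat (i - j - 1)"
  have i: "i = j + int n + 1" using \<open>j < i\<close> by (simp add: n_def)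
  obtain w where w: "w \<in> vectors R socle (b j)" "w \<notin> radical j"
    using no unfolding no_residue_summand_def by blast
  have wc: "w \<in> carrier V" using w vectors_sub_free[OF socle_ideal] free_in_V by blast
  have wn: "w \<noteq> \<zero>\<^sub>V" using w(2) V.submodule_zero[OF radical_submodule] by metis
  have line: "ext_vanishes (Suc n) (b j) (V.adjoin {\<zero>\<^sub>V} w)"
    by (rule stable_retract_ext_vanishes[OF residue_line_retract[OF w]]) (use ext i in \<open>simp add: ac_simps\<close>)
  define l where "l = j - int n - 1"
  obtain s where s: "s \<in> socle" "s \<noteq> \<zero>" by (rule socle_nonzero)
  have sZ: "s \<odot>\<^sub>V unit_vector R 0 \<in> Z l" using unit_multiple[OF s(1) socle_ideal rank_pos] socle_sub_Z by blast
  have "s \<odot>\<^sub>V unit_vector R 0 \<noteq> \<zero>\<^sub>V"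
  proof
    assume "s \<odot>\<^sub>V unit_vector R 0 = \<zero>\<^sub>V"
    then have "s \<otimes> unit_vector R 0 0 = \<zero>" by (auto simp: sequence_module_simps dest: fun_cong)
    then show False using s by (simp add: unit_vector_def socle_def)
  qed
  then have Znz: "Z l \<noteq> {\<zero>\<^sub>V}" using sZ by blast
  have "ext_vanishes (Suc n) (b l) (Z l)"
    by (rule ext_vanishes_all[OF wc wn _ line Z_submodule Z_free Znz]) (rule socle_kills[OF w(1)])
  from ext_vanishes_Z[OF this] have "functionals_extend (Z j) (b j)" by (simp add: l_def)
  then show False using extend_imp_no_residue no by blast
qed

subsection \<open>The dual complex\<close>

text \<open>This is \<open>H\<^sup>i(A\<^sup>*) = 0\<close>.\<close>

definition dual_exact :: "int \<Rightarrow> bool" where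
  "dual_exact i \<longleftrightarrow> (\<forall>f\<in>functionals (free (b i)). (\<forall>z\<in>Z i. f z = \<zero>) \<longrightarrow>
     (\<exists>g\<in>functionals (free (b (i - 1))). \<forall>v\<in>free (b i). f v = g (D i v)))"

lemma dual_exact_imp_extend:
  assumes "dual_exact i"
  shows "functionals_extend (Z (i - 1)) (b (i - 1))"
  unfolding functionals_extend_def
proof
  fix f assume f: "f \<in> functionals (Z (i - 1))"
  have fD: "(\<lambda>v. f (D i v)) \<in> functionals (free (b i))" by (rule maps_comp[OF D_maps f]) (simp add: Z_image)
  have z0: "f (D i z) = \<zero>" if "z \<in> Z i" for z
    using that functional_zero[OF Z_submodule f] unfolding Z_kernel by auto
  obtain g where g: "g \<in> functionals (free (b (i - 1)))" "\<And>v. v \<in> free (b i) \<Longrightarrow> f (D i v) = g (D i v)"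
    using assms[unfolded dual_exact_def, rule_format, OF fD z0] by blast
  then show "\<exists>F\<in>functionals (free (b (i - 1))). \<forall>x\<in>Z (i - 1). F x = f x" unfolding Z_image by (intro bexI[of _ g]) auto
qed

lemma dual_exact_no_residue:
  assumes "dual_exact i" "j < i"
  shows "no_residue_summand j"
  by (rule extend_imp_no_residue_below[OF dual_exact_imp_extend[OF assms(1)]]) (use assms(2) in simp)

text \<open>Exactness of the dual in arbitrarily high degrees removes all residue field summands, so the
  recurrence for the ranks holds everywhere.\<close>

theorem equal_ranks:
  assumes "\<And>j. \<exists>i>j. dual_exact i"
  shows "b i = b j"
proof -
  have nr: "no_residue_summand j" for j using assms dual_exact_no_residue by blast
  have h: "hdim \<ge> 2" by (rule hdim_ge_2[OF socle_eq_msq[OF nr]])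
  have "int (b i) = int (b j)"
  proof (rule two_sided_recurrence_constant[where b = "\<lambda>i. int (b i)" and h = "int hdim" and e = "int mdim - int hdim"])
    fix k
    have "int (b k * mdim) = int (b (k + 1) + b k * hdim + b (k - 1) * hdim)"
      using rank_recurrence[OF nr nr, of k] by simp
    then show "(int mdim - int hdim) * int (b k) = int (b (k + 1)) + int hdim * int (b (k - 1))"
      by (simp add: algebra_simps)
  qed (use h rank_pos in auto)
  then show ?thesis by simp
qed

definition pairing :: "nat \<Rightarrow> (nat \<Rightarrow> 'a) \<Rightarrow> (nat \<Rightarrow> 'a) \<Rightarrow> 'a" where
  "pairing q \<phi> v = lincomb RR \<phi> q v"

text \<open>Under \<open>pairing\<close>, which identifies \<open>R\<^sup>b\<close> with its dual, this is the dual of the differential.\<close>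

definition transpose :: "int \<Rightarrow> (nat \<Rightarrow> 'a) \<Rightarrow> nat \<Rightarrow> 'a" where
  "transpose i \<phi> = (\<lambda>t. if t < b i then pairing (b (i - 1)) \<phi> (D i (unit_vector R t)) else \<zero>)"

lemma pairing_functional: "\<phi> \<in> free q \<Longrightarrow> pairing q \<phi> \<in> functionals (free c)"
  unfolding pairing_def by (rule lincomb_maps_free[OF RR.module_axioms]) (simp add: freeD)

lemma pairing_commute: "\<phi> \<in> carrier V \<Longrightarrow> v \<in> carrier V \<Longrightarrow> pairing q \<phi> v = pairing q v \<phi>"
  unfolding pairing_def lincomb_def by (rule RR.finsum_cong') (auto simp: m_comm sequence_module_simps)

lemma functional_pairing:
  assumes "f \<in> functionals (free q)"
  obtains \<phi> where "\<phi> \<in> free q" "\<And>v. v \<in> free q \<Longrightarrow> f v = pairing q \<phi> v"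
proof -
  define \<phi> where "\<phi> t = (if t < q then f (unit_vector R t) else \<zero>)" for t
  have c: "f (unit_vector R t) \<in> carrier R" if "t < q" for t
    using submodule_mapsD(1)[OF assms unit_vector_free[OF that]] by simp
  have "f v = pairing q \<phi> v" if v: "v \<in> free q" for v
    unfolding linear_eq_lincomb[OF RR.module_axioms assms v] pairing_def
    by (rule RR.lincomb_cong) (use c freeD[OF v] in \<open>auto simp: \<phi>_def\<close>)
  moreover have "\<phi> \<in> free q" using c by (auto simp: \<phi>_def vectors_def)
  ultimately show thesis using that by blast
qed

lemma transpose_pairing:
  assumes \<phi>: "\<phi> \<in> free (b (i - 1))" and v: "v \<in> free (b i)"
  shows "pairing (b i) (transpose i \<phi>) v = pairing (b (i - 1)) \<phi> (D i v)"
proof -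
  have DF: "D i ` free (b i) \<subseteq> free (b (i - 1))" using Z_free[of "i - 1"] unfolding Z_image .
  have f: "(\<lambda>v. pairing (b (i - 1)) \<phi> (D i v)) \<in> functionals (free (b i))"
    by (rule maps_comp[OF D_maps pairing_functional[OF \<phi>] DF])
  have c: "t < b i \<Longrightarrow> pairing (b (i - 1)) \<phi> (D i (unit_vector R t)) \<in> carrier R" for t
    using submodule_mapsD(1)[OF f unit_vector_free] by simp
  show ?thesis
    unfolding linear_eq_lincomb[OF RR.module_axioms f v] unfolding pairing_def[of "b i"]
    by (rule RR.lincomb_cong) (use c freeD[OF v] in \<open>auto simp: transpose_def\<close>)
qed

lemma transpose_free: "\<phi> \<in> free (b (i - 1)) \<Longrightarrow> transpose i \<phi> \<in> free (b i)"
proof -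
  assume \<phi>: "\<phi> \<in> free (b (i - 1))"
  have "pairing (b (i - 1)) \<phi> (D i (unit_vector R t)) \<in> carrier R" if t: "t < b i" for t
  proof -
    have "D i (unit_vector R t) \<in> free (b (i - 1))" using D_unit_vector[OF t] vectors_sub_free[OF m_ideal] by blast
    from submodule_mapsD(1)[OF pairing_functional[OF \<phi>] this] show ?thesis by simp
  qed
  then show ?thesis by (auto simp: transpose_def vectors_def)
qed

lemma transpose_maps: "transpose i \<in> maps (free (b (i - 1)))"
proof -
  let ?c = "b (i - 1)"
  have row: "pairing ?c (D i (unit_vector R t)) \<in> functionals (free ?c)" if "t < b i" for t
    by (rule pairing_functional) (use D_unit_vector[OF that] vectors_sub_free[OF m_ideal] in blast)
  have tr: "transpose i \<phi> = (\<lambda>t. if t < b i then pairing ?c (D i (unit_vector R t)) \<phi> else \<zero>)"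
    if "\<phi> \<in> free ?c" for \<phi>
    unfolding transpose_def using pairing_commute[OF free_in_V[OF that] D_unit_carrier] by auto
  show ?thesis
  proof (rule submodule_mapsI)
    fix x assume x: "x \<in> free ?c"
    show "transpose i x \<in> carrier V" by (rule free_in_V[OF transpose_free[OF x]])
    show "transpose i (a \<odot>\<^sub>V x) = a \<odot>\<^sub>V transpose i x" if a: "a \<in> carrier R" for a
    proof -
      have "transpose i (a \<odot>\<^sub>V x) t = a \<otimes> transpose i x t" for t
        unfolding tr[OF x] tr[OF V.submoduleE(4)[OF free_submodule a x]]
        using submodule_mapsD(3)[OF row a x, of t] a by simp
      then show ?thesis unfolding sequence_module_simps(4)[of R a "transpose i x"] by (rule HOL.ext)
    qed
    fix y assume y: "y \<in> free ?c"
    have "transpose i (x \<oplus>\<^sub>V y) t = transpose i x t \<oplus> transpose i y t" for t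
      unfolding tr[OF x] tr[OF y] tr[OF V.submoduleE(5)[OF free_submodule x y]]
      using submodule_mapsD(2)[OF row x y, of t] by simp
    then show "transpose i (x \<oplus>\<^sub>V y) = transpose i x \<oplus>\<^sub>V transpose i y"
      unfolding sequence_module_simps(3)[of R "transpose i x" "transpose i y"] by (rule HOL.ext)
  qed
qed

definition dual_kernel :: "int \<Rightarrow> (nat \<Rightarrow> 'a) set" where
  "dual_kernel i = {\<phi> \<in> free (b i). transpose (i + 1) \<phi> = \<zero>\<^sub>V}"

definition dual_image :: "int \<Rightarrow> (nat \<Rightarrow> 'a) set" where
  "dual_image i = transpose i ` free (b (i - 1))"

lemma dual_kernel_iff:
  "\<phi> \<in> dual_kernel i \<longleftrightarrow> \<phi> \<in> free (b i) \<and> (\<forall>z\<in>Z i. pairing (b i) \<phi> z = \<zero>)"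
proof (cases "\<phi> \<in> free (b i)")
  case True
  have tp: "pairing (b (i + 1)) (transpose (i + 1) \<phi>) v = pairing (b i) \<phi> (D (i + 1) v)"
    if "v \<in> free (b (i + 1))" for v using transpose_pairing[of \<phi> "i + 1" v] True that by simp
  show ?thesis
  proof
    assume "\<phi> \<in> dual_kernel i"
    then have z: "transpose (i + 1) \<phi> = \<zero>\<^sub>V" unfolding dual_kernel_def by blast
    have "pairing (b i) \<phi> (D (i + 1) v) = \<zero>" if v: "v \<in> free (b (i + 1))" for v
    proof -
      have "pairing (b (i + 1)) \<zero>\<^sub>V v \<in> {\<zero>}"
        unfolding pairing_def
        by (rule RR.lincomb_in_submodule) (use RR.submodule_zero_set freeD[OF v] in \<open>auto simp: sequence_module_simps\<close>)
      then show ?thesis using tp[OF v] z by simp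
    qed
    then show "\<phi> \<in> free (b i) \<and> (\<forall>z\<in>Z i. pairing (b i) \<phi> z = \<zero>)" using True unfolding Z_def by blast
  next
    assume a: "\<phi> \<in> free (b i) \<and> (\<forall>z\<in>Z i. pairing (b i) \<phi> z = \<zero>)"
    have "transpose (i + 1) \<phi> = \<zero>\<^sub>V"
    proof
      fix t
      show "transpose (i + 1) \<phi> t = \<zero>\<^sub>V t"
        using a unit_vector_free[of t "b (i + 1)"] by (auto simp: transpose_def Z_def sequence_module_simps)
    qed
    then show "\<phi> \<in> dual_kernel i" using True unfolding dual_kernel_def by blast
  qed
qed (simp add: dual_kernel_def)

lemma dual_image_sub_kernel: "dual_image i \<subseteq> dual_kernel i"
proof
  fix \<phi> assume "\<phi> \<in> dual_image i"
  then obtain \<psi> where \<psi>: "\<psi> \<in> free (b (i - 1))" "\<phi> = transpose i \<psi>" unfolding dual_image_def by blast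
  have "pairing (b i) \<phi> z = \<zero>" if z: "z \<in> Z i" for z
  proof -
    have "pairing (b i) \<phi> z = pairing (b (i - 1)) \<psi> (D i z)"
      unfolding \<psi>(2) by (rule transpose_pairing[OF \<psi>(1)]) (use z Z_free in blast)
    also have "D i z = \<zero>\<^sub>V" using z unfolding Z_kernel by blast
    also have "pairing (b (i - 1)) \<psi> \<zero>\<^sub>V = \<zero>"
      using functional_zero[OF free_submodule pairing_functional[OF \<psi>(1)]] by simp
    finally show ?thesis .
  qed
  then show "\<phi> \<in> dual_kernel i" unfolding dual_kernel_iff using transpose_free \<psi> by blast
qed

lemma dual_exact_iff: "dual_exact i \<longleftrightarrow> dual_kernel i = dual_image i"
proof
  assume ex: "dual_exact i"
  have "dual_kernel i \<subseteq> dual_image i"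
  proof
    fix \<phi> assume "\<phi> \<in> dual_kernel i"
    then have \<phi>: "\<phi> \<in> free (b i)" "\<forall>z\<in>Z i. pairing (b i) \<phi> z = \<zero>" unfolding dual_kernel_iff by auto
    obtain g where g: "g \<in> functionals (free (b (i - 1)))" "\<And>v. v \<in> free (b i) \<Longrightarrow> pairing (b i) \<phi> v = g (D i v)"
      using ex \<phi>(2) pairing_functional[OF \<phi>(1)] unfolding dual_exact_def by blast
    obtain \<psi> where \<psi>: "\<psi> \<in> free (b (i - 1))" "\<And>v. v \<in> free (b (i - 1)) \<Longrightarrow> g v = pairing (b (i - 1)) \<psi> v"
      using functional_pairing[OF g(1)] by blast
    have "\<phi> = transpose i \<psi>"
    proof
      fix t
      show "\<phi> t = transpose i \<psi> t"
      proof (cases "t < b i")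
        case True
        have u: "unit_vector R t \<in> free (b i)" using True unit_vector_free by blast
        have "\<phi> t = pairing (b i) \<phi> (unit_vector R t)"
          unfolding pairing_def using lincomb_unit_vector[OF RR.module_axioms _ True, of \<phi>] freeD[OF \<phi>(1)] by simp
        also have "\<dots> = pairing (b (i - 1)) \<psi> (D i (unit_vector R t))"
          using g(2)[OF u] \<psi>(2) D_unit_vector[OF True] vectors_sub_free[OF m_ideal] by (metis subsetD)
        also have "\<dots> = transpose i \<psi> t" using True by (simp add: transpose_def)
        finally show ?thesis .
      qed (use \<phi>(1) in \<open>auto simp: transpose_def vectors_def\<close>)
    qed
    then show "\<phi> \<in> dual_image i" unfolding dual_image_def using \<psi>(1) by blast
  qed
  then show "dual_kernel i = dual_image i" using dual_image_sub_kernel by blast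
next
  assume eq: "dual_kernel i = dual_image i"
  show "dual_exact i"
    unfolding dual_exact_def
  proof (intro ballI impI)
    fix f assume f: "f \<in> functionals (free (b i))" "\<forall>z\<in>Z i. f z = \<zero>"
    obtain \<phi> where \<phi>: "\<phi> \<in> free (b i)" "\<And>v. v \<in> free (b i) \<Longrightarrow> f v = pairing (b i) \<phi> v"
      using functional_pairing[OF f(1)] by blast
    have "\<phi> \<in> dual_kernel i" unfolding dual_kernel_iff using \<phi> f(2) Z_free by (metis subsetD)
    then obtain \<psi> where \<psi>: "\<psi> \<in> free (b (i - 1))" "\<phi> = transpose i \<psi>" using eq unfolding dual_image_def by blast
    show "\<exists>g\<in>functionals (free (b (i - 1))). \<forall>v\<in>free (b i). f v = g (D i v)"
      using pairing_functional[OF \<psi>(1)] \<phi>(2) transpose_pairing[OF \<psi>(1)] \<psi>(2) by metis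
  qed
qed

lemma dual_image_free: "dual_image i \<subseteq> free (b i)"
  unfolding dual_image_def using transpose_free by blast

lemma dual_kernel_free: "dual_kernel i \<subseteq> free (b i)"
  unfolding dual_kernel_def by blast

lemma dual_length: "vlen (dual_kernel (i - 1)) + vlen (dual_image i) = b (i - 1) * (mdim + 1)"
  using vlen_rank_nullity[OF free_submodule order_refl transpose_maps, of i "b i"] dual_image_free[of i]
  by (simp add: vlen_free dual_kernel_def dual_image_def)

text \<open>The image of \<open>R\<^sup>b\<close> exceeds that of \<open>\<mm> R\<^sup>b\<close>, which lies in \<open>\<mm>\<^sup>2 R\<^sup>b\<close>, by at most the length of
  \<open>R\<^sup>b / \<mm> R\<^sup>b\<close>.\<close>

lemma dual_image_length_le: "vlen (dual_image i) \<le> b (i - 1) + b i * hdim"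
proof -
  let ?c = "b (i - 1)"
  have tm: "transpose i \<in> maps (vectors R \<mm> ?c)"
    by (rule submodule_maps_mono[OF transpose_maps vectors_sub_free[OF m_ideal]])
  have sub: "transpose i ` vectors R \<mm> ?c \<subseteq> vectors R msq (b i)"
  proof
    fix \<phi> assume "\<phi> \<in> transpose i ` vectors R \<mm> ?c"
    then obtain \<psi> where \<psi>: "\<psi> \<in> vectors R \<mm> ?c" "\<phi> = transpose i \<psi>" by blast
    have "pairing ?c \<psi> (D i (unit_vector R t)) \<in> msq" if t: "t < b i" for t
      unfolding pairing_def
    proof (rule RR.lincomb_in_submodule)
      show "submodule msq R RR" using msq_ideal ideal_submodule by blast
      fix n assume n: "n < ?c"
      have m: "\<psi> n \<in> \<mm>" "D i (unit_vector R t) n \<in> \<mm>" using n \<psi>(1) D_unit_vector[OF t] by (auto simp: vectors_def)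
      show "\<psi> n \<in> carrier RR" "D i (unit_vector R t) n \<in> carrier R" using m m_carrier by auto
      show "D i (unit_vector R t) n \<odot>\<^bsub>RR\<^esub> \<psi> n \<in> msq" using msqI m by simp
    qed
    then show "\<phi> \<in> vectors R msq (b i)" unfolding \<psi>(2) by (auto simp: transpose_def vectors_def)
  qed
  have "?c * mdim = vlen {x \<in> vectors R \<mm> ?c. transpose i x = \<zero>\<^sub>V} + vlen (transpose i ` vectors R \<mm> ?c)"
    using vlen_rank_nullity[OF vectors_submodule[OF m_ideal] vectors_sub_free[OF m_ideal] tm, of "b i"]
      sub vectors_sub_free[OF msq_ideal, of "b i"] unfolding vlen_m by blast
  also have "vlen {x \<in> vectors R \<mm> ?c. transpose i x = \<zero>\<^sub>V} \<le> vlen (dual_kernel (i - 1))"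
    by (rule vlen_mono[OF _ dual_kernel_free])
      (use vectors_sub_free[OF m_ideal] in \<open>auto simp: dual_kernel_def\<close>)
  also have "vlen (transpose i ` vectors R \<mm> ?c) \<le> b i * hdim"
    using vlen_mono[OF sub vectors_sub_free[OF msq_ideal]] vlen_msq by simp
  finally have "?c * mdim \<le> vlen (dual_kernel (i - 1)) + b i * hdim" by simp
  then show ?thesis using dual_length[of i] by (simp add: algebra_simps)
qed

text \<open>For ranks all equal to \<open>c\<close>, the recurrence forces \<open>R\<close> to have length \<open>2 (1 + hdim)\<close>, whereas images in
  the dual complex have length at most \<open>c (1 + hdim)\<close>, half of the length of \<open>R\<^sup>c\<close>. Exactness in degree
  \<open>l - 1\<close> bounds the kernel there from above, hence the image in degree \<open>l\<close> from below; exactness in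
  degree \<open>l + 1\<close> bounds the image there from below, hence the kernel in degree \<open>l\<close> from above.\<close>

theorem dual_exact_between:
  assumes ranks: "\<And>i j. b i = b j" and "dual_exact (l - 1)" "dual_exact (l + 1)"
  shows "dual_exact l"
proof -
  define c where "c = b 0"
  have c: "b i = c" for i unfolding c_def by (rule ranks)
  have cpos: "c > 0" using rank_pos[of 0] c by simp
  have "c * mdim = c + c * hdim + c * hdim"
    using rank_recurrence[of l] dual_exact_no_residue[OF assms(3)] by (simp add: c)
  then have "c * mdim = c * (1 + 2 * hdim)" by (simp add: algebra_simps)
  then have mdim: "mdim = 1 + 2 * hdim" using nat_mult_eq_cancel1[OF cpos] by blast
  have 1: "vlen (dual_kernel (l - 1)) \<le> c + c * hdim"
    using dual_image_length_le[of "l - 1"] assms(2) by (simp add: c dual_exact_iff)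
  have 2: "vlen (dual_image (l + 2)) \<le> c + c * hdim" using dual_image_length_le[of "l + 2"] by (simp add: c)
  have a: "vlen (dual_kernel (l - 1)) + vlen (dual_image l) = c * (2 + 2 * hdim)"
    using dual_length[of l] by (simp add: c mdim)
  have b: "vlen (dual_kernel l) + vlen (dual_image (l + 1)) = c * (2 + 2 * hdim)"
    using dual_length[of "l + 1"] by (simp add: c mdim)
  have d: "vlen (dual_kernel (l + 1)) + vlen (dual_image (l + 2)) = c * (2 + 2 * hdim)"
  proof -
    have "l + 2 - 1 = l + 1" by simp
    from dual_length[of "l + 2", unfolded this] show ?thesis by (simp add: c mdim)
  qed
  have "vlen (dual_kernel l) \<le> vlen (dual_image l)"
    using a b d 1 2 assms(3) by (simp add: dual_exact_iff algebra_simps)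
  moreover have "submodule (dual_image l) R V"
    unfolding dual_image_def by (rule V_image[OF free_submodule transpose_maps])
  ultimately have "dual_image l = dual_kernel l"
    using V.length_eq_imp_eq[OF _ dual_image_sub_kernel] vlen[OF dual_image_free] vlen[OF dual_kernel_free]
    by (metis enat.distinct(1) enat_ord_simps(1))
  then show ?thesis unfolding dual_exact_iff by simp
qed

end

section \<open>From free modules to coordinates\<close>

text \<open>The cosets of the image in the kernel are all equal exactly if the kernel is contained in the image.\<close>

lemma trivial_homology_iff:
  assumes L: "module R L" and M: "module R M" and N: "module R N"
    and f: "f \<in> linear_maps R L M" and g: "g \<in> linear_maps R M N"
    and gf: "\<And>x. x \<in> carrier L \<Longrightarrow> g (f x) = \<zero>\<^bsub>N\<^esub>"
  shows "trivial_group (homology_at L M N f g) \<longleftrightarrow> {x \<in> carrier M. g x = \<zero>\<^bsub>N\<^esub>} = f ` carrier L"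
proof -
  interpret L: module R L by fact
  interpret M: module R M by fact
  interpret N: module R N by fact
  define K where "K = a_kernel M N g"
  define I where "I = f ` carrier L"
  define G where "G = (add_monoid M)\<lparr>carrier := K\<rparr>"
  have K: "K = {x \<in> carrier M. g x = \<zero>\<^bsub>N\<^esub>}" by (simp add: K_def a_kernel_def')
  have Ks: "submodule K R M" unfolding K
    by (rule submodule_kernel[OF M N M.carrier_is_submodule]) (use g in simp)
  have Is: "submodule I R M" unfolding I_def
    by (rule submodule_image[OF L M L.carrier_is_submodule]) (use f in simp)
  have IK: "I \<subseteq> K" unfolding I_def K using f gf by (auto simp: linear_maps_def)
  have Kg: "subgroup K (add_monoid M)" and Ig: "subgroup I (add_monoid M)"
    using Ks Is submodule.axioms(1) by blast+
  have Ag: "group (add_monoid M)" using M.a_comm_group comm_group.axioms(2) by blast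
  interpret G: group G unfolding G_def by (rule subgroup.subgroup_is_group[OF Kg Ag])
  have IG: "subgroup I G" unfolding G_def by (rule group.subgroup_incl[OF Ag Ig Kg IK])
  interpret G: comm_group G
    by (rule G.group_comm_groupI)
      (use M.submodule_sub[OF Ks] in \<open>auto simp: G_def M.a_comm\<close>)
  have norm: "I \<lhd> G" by (rule G.subgroup_imp_normal[OF IG])
  have grp: "group (G Mod I)" by (rule normal.factorgroup_is_group[OF norm])
  have "trivial_group (G Mod I) \<longleftrightarrow> K = I"
  proof
    assume "trivial_group (G Mod I)"
    then have r: "rcosets\<^bsub>G\<^esub> I = {I}" by (simp add: trivial_group_def FactGroup_def)
    have "a \<in> I" if a: "a \<in> K" for a
    proof -
      have aG: "a \<in> carrier G" using a by (simp add: G_def)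
      have "I #>\<^bsub>G\<^esub> a \<in> rcosets\<^bsub>G\<^esub> I" using aG by (auto simp: RCOSETS_def)
      then have "I #>\<^bsub>G\<^esub> a = I" using r by blast
      then show ?thesis using G.rcos_self[OF aG IG] by simp
    qed
    then show "K = I" using IK by blast
  next
    assume "K = I"
    then have IG': "carrier G = I" by (simp add: G_def)
    have "I #>\<^bsub>G\<^esub> a = I" if "a \<in> I" for a
      using G.coset_join2[of a I] IG IG' that by blast
    then have "rcosets\<^bsub>G\<^esub> I = {I}" using G.one_closed unfolding RCOSETS_def IG' by auto
    then show "trivial_group (G Mod I)" using grp by (simp add: trivial_group_def FactGroup_def)
  qed
  then show ?thesis by (simp add: homology_at_def G_def K_def[symmetric] I_def[symmetric] K[symmetric])
qed

lemma dual_module_simps [simp]: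
  "carrier (dual_module R M) = linear_maps R M (regular_module R) \<inter> extensional (carrier M)"
  "\<zero>\<^bsub>dual_module R M\<^esub> = (\<lambda>x\<in>carrier M. \<zero>\<^bsub>R\<^esub>)"
  "f \<oplus>\<^bsub>dual_module R M\<^esub> g = (\<lambda>x\<in>carrier M. f x \<oplus>\<^bsub>R\<^esub> g x)"
  "a \<odot>\<^bsub>dual_module R M\<^esub> f = (\<lambda>x\<in>carrier M. a \<otimes>\<^bsub>R\<^esub> f x)"
  by (auto simp: dual_module_def)

lemma linear_mapsD:
  assumes "f \<in> linear_maps R M N"
  shows "x \<in> carrier M \<Longrightarrow> f x \<in> carrier N"
    and "x \<in> carrier M \<Longrightarrow> y \<in> carrier M \<Longrightarrow> f (x \<oplus>\<^bsub>M\<^esub> y) = f x \<oplus>\<^bsub>N\<^esub> f y"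
    and "a \<in> carrier R \<Longrightarrow> x \<in> carrier M \<Longrightarrow> f (a \<odot>\<^bsub>M\<^esub> x) = a \<odot>\<^bsub>N\<^esub> f x"
  using assms by (auto simp: linear_maps_def)

lemma dual_module_module:
  assumes M: "module R M"
  shows "module R (dual_module R M)"
proof -
  interpret M: module R M by fact
  have cl: "(\<lambda>x\<in>carrier M. f x \<oplus>\<^bsub>R\<^esub> g x) \<in> carrier (dual_module R M)"
    if "f \<in> carrier (dual_module R M)" "g \<in> carrier (dual_module R M)" for f g
  proof -
    have fg: "f \<in> linear_maps R M (regular_module R)" "g \<in> linear_maps R M (regular_module R)" using that by auto
    show ?thesis
      using linear_mapsD[OF fg(1)] linear_mapsD[OF fg(2)]
      by (auto simp: linear_maps_def M.R.a_ac M.R.r_distr)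
  qed
  have sc: "(\<lambda>x\<in>carrier M. a \<otimes>\<^bsub>R\<^esub> f x) \<in> carrier (dual_module R M)"
    if "a \<in> carrier R" "f \<in> carrier (dual_module R M)" for a f
  proof -
    have f: "f \<in> linear_maps R M (regular_module R)" using that by auto
    show ?thesis using linear_mapsD[OF f] that(1) by (auto simp: linear_maps_def M.R.m_lcomm M.R.r_distr)
  qed
  have fx: "f x \<in> carrier R" if "f \<in> carrier (dual_module R M)" "x \<in> carrier M" for f x
    using that by (auto simp: linear_maps_def)
  have ext: "f = g" if "f \<in> extensional (carrier M)" "g \<in> extensional (carrier M)"
    "\<And>x. x \<in> carrier M \<Longrightarrow> f x = g x" for f g
    using that by (rule extensionalityI)
  show ?thesis
  proof (rule moduleI)
    show "cring R" by (rule M.R.is_cring)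
    show "abelian_group (dual_module R M)"
    proof (rule abelian_groupI)
      show "\<zero>\<^bsub>dual_module R M\<^esub> \<in> carrier (dual_module R M)" by (auto simp: linear_maps_def)
      fix f g h assume fgh: "f \<in> carrier (dual_module R M)" "g \<in> carrier (dual_module R M)" "h \<in> carrier (dual_module R M)"
      show "f \<oplus>\<^bsub>dual_module R M\<^esub> g \<in> carrier (dual_module R M)" using cl fgh by simp
      show "f \<oplus>\<^bsub>dual_module R M\<^esub> g = g \<oplus>\<^bsub>dual_module R M\<^esub> f"
        by (rule ext) (use fx fgh in \<open>auto simp: M.R.a_comm simp del: dual_module_simps(1)\<close>)
      show "f \<oplus>\<^bsub>dual_module R M\<^esub> g \<oplus>\<^bsub>dual_module R M\<^esub> h = f \<oplus>\<^bsub>dual_module R M\<^esub> (g \<oplus>\<^bsub>dual_module R M\<^esub> h)"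
        by (rule ext) (use fx fgh in \<open>auto simp: M.R.a_assoc simp del: dual_module_simps(1)\<close>)
      show "\<zero>\<^bsub>dual_module R M\<^esub> \<oplus>\<^bsub>dual_module R M\<^esub> f = f"
        by (rule ext) (use fx fgh in \<open>auto simp: linear_maps_def\<close>)
      have m1: "\<ominus>\<^bsub>R\<^esub> \<one>\<^bsub>R\<^esub> \<in> carrier R" by simp
      show "\<exists>k\<in>carrier (dual_module R M). k \<oplus>\<^bsub>dual_module R M\<^esub> f = \<zero>\<^bsub>dual_module R M\<^esub>"
      proof (rule bexI[OF _ sc[OF m1 fgh(1)]])
        show "(\<lambda>x\<in>carrier M. (\<ominus>\<^bsub>R\<^esub> \<one>\<^bsub>R\<^esub>) \<otimes>\<^bsub>R\<^esub> f x) \<oplus>\<^bsub>dual_module R M\<^esub> f = \<zero>\<^bsub>dual_module R M\<^esub>"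
          by (rule ext) (use fx fgh in \<open>auto simp: M.R.l_minus M.R.l_neg simp del: dual_module_simps(1)\<close>)
      qed
    qed
  next
    fix a f assume "a \<in> carrier R" "f \<in> carrier (dual_module R M)"
    then show "a \<odot>\<^bsub>dual_module R M\<^esub> f \<in> carrier (dual_module R M)" using sc by simp
  next
    fix a c f assume *: "a \<in> carrier R" "c \<in> carrier R" "f \<in> carrier (dual_module R M)"
    show "(a \<oplus>\<^bsub>R\<^esub> c) \<odot>\<^bsub>dual_module R M\<^esub> f = a \<odot>\<^bsub>dual_module R M\<^esub> f \<oplus>\<^bsub>dual_module R M\<^esub> c \<odot>\<^bsub>dual_module R M\<^esub> f"
      by (rule ext) (use fx * in \<open>auto simp: M.R.l_distr simp del: dual_module_simps(1)\<close>)
    show "a \<otimes>\<^bsub>R\<^esub> c \<odot>\<^bsub>dual_module R M\<^esub> f = a \<odot>\<^bsub>dual_module R M\<^esub> (c \<odot>\<^bsub>dual_module R M\<^esub> f)"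
      by (rule ext) (use fx * in \<open>auto simp: M.R.m_assoc simp del: dual_module_simps(1)\<close>)
  next
    fix a f g assume *: "a \<in> carrier R" "f \<in> carrier (dual_module R M)" "g \<in> carrier (dual_module R M)"
    show "a \<odot>\<^bsub>dual_module R M\<^esub> (f \<oplus>\<^bsub>dual_module R M\<^esub> g) = a \<odot>\<^bsub>dual_module R M\<^esub> f \<oplus>\<^bsub>dual_module R M\<^esub> a \<odot>\<^bsub>dual_module R M\<^esub> g"
      by (rule ext) (use fx * in \<open>auto simp: M.R.r_distr simp del: dual_module_simps(1)\<close>)
  next
    fix f assume *: "f \<in> carrier (dual_module R M)"
    show "\<one>\<^bsub>R\<^esub> \<odot>\<^bsub>dual_module R M\<^esub> f = f"
      by (rule ext) (use fx * in \<open>auto simp: linear_maps_def\<close>)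
  qed
qed

lemma dual_map_linear:
  assumes u: "u \<in> linear_maps R M N"
  and cl: "\<And>x y. x \<in> carrier M \<Longrightarrow> y \<in> carrier M \<Longrightarrow> x \<oplus>\<^bsub>M\<^esub> y \<in> carrier M"
    "\<And>a x. a \<in> carrier R \<Longrightarrow> x \<in> carrier M \<Longrightarrow> a \<odot>\<^bsub>M\<^esub> x \<in> carrier M"
  shows "dual_map M u \<in> linear_maps R (dual_module R N) (dual_module R M)"
  using linear_mapsD[OF u] cl
  by (auto simp: linear_maps_def dual_map_def compose_def restrict_def fun_eq_iff Pi_iff extensional_def)

text \<open>The domain has rank \<open>card B\<close>, so with the basis selected by \<^const>\<open>free_rank\<close> the coordinate vectors
  have exactly \<open>free_rank\<close> many entries.\<close>

lemma (in coordinate_ring) basis_coordinates: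
  assumes M: "module R M" and B: "finite_basis R M B"
  obtains \<kappa> where "\<kappa> \<in> submodule_maps R V (free (card B)) M" "bij_betw \<kappa> (free (card B)) (carrier M)"
proof -
  interpret M: module R M by fact
  define n where "n = card B"
  have fin: "finite B" "B \<subseteq> carrier M" using B by (auto simp: finite_basis_def)
  have uniq: "\<And>x. x \<in> carrier M \<Longrightarrow> \<exists>!c. c \<in> B \<rightarrow>\<^sub>E carrier R \<and> x = (\<Oplus>\<^bsub>M\<^esub>b\<in>B. c b \<odot>\<^bsub>M\<^esub> b)"
    using B by (auto simp: finite_basis_def)
  obtain e where e: "bij_betw e {..<n} B"
    using ex_bij_betw_nat_finite[OF fin(1)] by (auto simp: n_def atLeast0LessThan)
  have eB: "e t \<in> B" if "t < n" for t using e that by (auto simp: bij_betw_def)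
  have ec: "e t \<in> carrier M" if "t < n" for t using eB[OF that] fin by blast
  have inj: "inj_on e {..<n}" and im: "e ` {..<n} = B" using e by (auto simp: bij_betw_def)
  define \<kappa> where "\<kappa> = lincomb M e n"
  define \<gamma> where "\<gamma> v = (\<lambda>\<beta>\<in>B. v (inv_into {..<n} e \<beta>))" for v :: "nat \<Rightarrow> 'a"
  have \<kappa>: "\<kappa> \<in> submodule_maps R V (free n) M" unfolding \<kappa>_def by (rule lincomb_maps_free[OF M ec])
  have \<gamma>e: "\<gamma> v (e t) = v t" if "t < n" for v t using eB[OF that] inj that by (simp add: \<gamma>_def)
  have \<gamma>c: "\<gamma> v \<in> B \<rightarrow>\<^sub>E carrier R" if "v \<in> free n" for v using freeD[OF that] by (auto simp: \<gamma>_def)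
  have sum: "(\<Oplus>\<^bsub>M\<^esub>\<beta>\<in>B. c \<beta> \<odot>\<^bsub>M\<^esub> \<beta>) = (\<Oplus>\<^bsub>M\<^esub>t\<in>{..<n}. c (e t) \<odot>\<^bsub>M\<^esub> e t)" if "c \<in> B \<rightarrow> carrier R" for c
    unfolding im[symmetric] by (rule M.finsum_reindex[OF _ inj]) (use that fin(2) in \<open>auto simp: im\<close>)
  have \<kappa>\<gamma>: "\<kappa> v = (\<Oplus>\<^bsub>M\<^esub>\<beta>\<in>B. \<gamma> v \<beta> \<odot>\<^bsub>M\<^esub> \<beta>)" if v: "v \<in> free n" for v
  proof -
    have "(\<Oplus>\<^bsub>M\<^esub>\<beta>\<in>B. \<gamma> v \<beta> \<odot>\<^bsub>M\<^esub> \<beta>) = (\<Oplus>\<^bsub>M\<^esub>t\<in>{..<n}. \<gamma> v (e t) \<odot>\<^bsub>M\<^esub> e t)"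
      by (rule sum) (use \<gamma>c[OF v] in auto)
    also have "\<dots> = \<kappa> v" unfolding \<kappa>_def lincomb_def
      by (rule M.finsum_cong') (use \<gamma>e ec freeD[OF v] in auto)
    finally show ?thesis by simp
  qed
  have "inj_on \<kappa> (free n)"
  proof (rule inj_onI)
    fix v w assume v: "v \<in> free n" and w: "w \<in> free n" and eq: "\<kappa> v = \<kappa> w"
    have "\<kappa> v \<in> carrier M" using submodule_mapsD(1)[OF \<kappa> v] .
    then have "\<gamma> v = \<gamma> w" using uniq[of "\<kappa> v"] \<gamma>c[OF v] \<gamma>c[OF w] \<kappa>\<gamma>[OF v] \<kappa>\<gamma>[OF w] eq by metis
    then have "v t = w t" if "t < n" for t using \<gamma>e[OF that] by metis
    then show "v = w" using v w by (auto simp: vectors_def fun_eq_iff) (metis not_le)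
  qed
  moreover have "\<kappa> ` free n = carrier M"
  proof (intro equalityI subsetI)
    fix x assume "x \<in> carrier M"
    then obtain c where c: "c \<in> B \<rightarrow>\<^sub>E carrier R" "x = (\<Oplus>\<^bsub>M\<^esub>b\<in>B. c b \<odot>\<^bsub>M\<^esub> b)" using uniq by blast
    define v where "v t = (if t < n then c (e t) else \<zero>)" for t
    have v: "v \<in> free n" using c(1) eB by (auto simp: v_def vectors_def)
    have "\<kappa> v = (\<Oplus>\<^bsub>M\<^esub>t\<in>{..<n}. c (e t) \<odot>\<^bsub>M\<^esub> e t)" unfolding \<kappa>_def lincomb_def
      by (rule M.finsum_cong') (use c(1) eB ec in \<open>auto simp: v_def\<close>)
    also have "\<dots> = x" unfolding c(2) by (rule sum[symmetric]) (use c(1) in auto)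
    finally show "x \<in> \<kappa> ` free n" using v by blast
  qed (use submodule_mapsD(1)[OF \<kappa>] in blast)
  ultimately show thesis using that[of \<kappa>] \<kappa> unfolding n_def bij_betw_def by blast
qed

text \<open>The maps \<open>\<kappa>\<close> are coordinate systems; the differentials become matrices acting on \<open>R\<^sup>n\<close>.\<close>

locale coordinatized_complex = coordinate_ring R for R (structure) +
  fixes A :: "int \<Rightarrow> ('a, 'c, 'm) module_scheme" and d :: "int \<Rightarrow> 'c \<Rightarrow> 'c"
    and n :: "int \<Rightarrow> nat" and \<kappa> :: "int \<Rightarrow> (nat \<Rightarrow> 'a) \<Rightarrow> 'c"
  assumes complex: "free_complex R A d"
    and \<kappa>_maps: "\<kappa> i \<in> submodule_maps R V (free (n i)) (A i)"
    and \<kappa>_bij: "bij_betw (\<kappa> i) (free (n i)) (carrier (A i))"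
begin

definition \<chi> :: "int \<Rightarrow> 'c \<Rightarrow> nat \<Rightarrow> 'a" where "\<chi> i = inv_into (free (n i)) (\<kappa> i)"
definition D :: "int \<Rightarrow> (nat \<Rightarrow> 'a) \<Rightarrow> nat \<Rightarrow> 'a" where "D i v = \<chi> (i - 1) (d i (\<kappa> i v))"

lemma A_module: "module R (A i)"
  using complex by (simp add: free_complex_def fg_free_def)

lemma d_linear: "d i \<in> linear_maps R (A i) (A (i - 1))"
  using complex by (simp add: free_complex_def)

lemma d_closed: "x \<in> carrier (A i) \<Longrightarrow> d i x \<in> carrier (A (i - 1))"
  using linear_mapsD(1)[OF d_linear] .

lemma dd: "x \<in> carrier (A (i + 1)) \<Longrightarrow> d i (d (i + 1) x) = \<zero>\<^bsub>A (i - 1)\<^esub>"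
  using complex by (simp add: free_complex_def)

lemma \<kappa>_closed: "v \<in> free (n i) \<Longrightarrow> \<kappa> i v \<in> carrier (A i)"
  using \<kappa>_bij by (auto simp: bij_betw_def)

lemma \<chi>_closed: "x \<in> carrier (A i) \<Longrightarrow> \<chi> i x \<in> free (n i)"
  unfolding \<chi>_def using \<kappa>_bij[of i] by (metis bij_betw_def inv_into_into)

lemma \<kappa>\<chi>: "x \<in> carrier (A i) \<Longrightarrow> \<kappa> i (\<chi> i x) = x"
  unfolding \<chi>_def using \<kappa>_bij[of i] by (metis bij_betw_def f_inv_into_f)

lemma \<chi>\<kappa>: "v \<in> free (n i) \<Longrightarrow> \<chi> i (\<kappa> i v) = v"
  unfolding \<chi>_def using \<kappa>_bij[of i] by (metis bij_betw_def inv_into_f_f)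

lemma \<kappa>_inj: "v \<in> free (n i) \<Longrightarrow> w \<in> free (n i) \<Longrightarrow> \<kappa> i v = \<kappa> i w \<Longrightarrow> v = w"
  using \<chi>\<kappa> by metis

lemma \<chi>_maps: "\<chi> i \<in> linear_maps R (A i) V"
proof -
  interpret A: module R "A i" by (rule A_module)
  note kD = submodule_mapsD[OF \<kappa>_maps[of i]]
  have "\<chi> i \<in> submodule_maps R (A i) (carrier (A i)) V"
  proof (rule submodule_mapsI)
    fix x assume "x \<in> carrier (A i)"
    then show "\<chi> i x \<in> carrier V" by (rule free_in_V[OF \<chi>_closed])
  next
    fix x y assume xy: "x \<in> carrier (A i)" "y \<in> carrier (A i)"
    show "\<chi> i (x \<oplus>\<^bsub>A i\<^esub> y) = \<chi> i x \<oplus>\<^sub>V \<chi> i y"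
      by (rule \<kappa>_inj[OF \<chi>_closed[OF A.M.a_closed[OF xy]] V.submoduleE(5)[OF free_submodule \<chi>_closed[OF xy(1)] \<chi>_closed[OF xy(2)]]])
        (simp only: kD(2)[OF \<chi>_closed[OF xy(1)] \<chi>_closed[OF xy(2)]] \<kappa>\<chi> xy A.M.a_closed)
  next
    fix a x assume a: "a \<in> carrier R" and x: "x \<in> carrier (A i)"
    show "\<chi> i (a \<odot>\<^bsub>A i\<^esub> x) = a \<odot>\<^sub>V \<chi> i x"
      by (rule \<kappa>_inj[OF \<chi>_closed[OF A.smult_closed[OF a x]] V.submoduleE(4)[OF free_submodule a \<chi>_closed[OF x]]])
        (simp only: kD(3)[OF a \<chi>_closed[OF x]] \<kappa>\<chi> x A.smult_closed[OF a x])
  qed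
  then show ?thesis by simp
qed

lemma D_maps: "D i \<in> maps (free (n i))"
proof -
  have 1: "(\<lambda>v. d i (\<kappa> i v)) \<in> submodule_maps R V (free (n i)) (A (i - 1))"
    by (rule maps_comp[OF \<kappa>_maps, where Q = "carrier (A i)"]) (use d_linear \<kappa>_closed in auto)
  have "(\<lambda>v. \<chi> (i - 1) (d i (\<kappa> i v))) \<in> maps (free (n i))"
    by (rule maps_comp[OF 1, where Q = "carrier (A (i - 1))"]) (use \<chi>_maps \<kappa>_closed d_closed in auto)
  then show ?thesis unfolding D_def[abs_def] .
qed

lemma D_closed: "v \<in> free (n i) \<Longrightarrow> D i v \<in> free (n (i - 1))"
  unfolding D_def by (rule \<chi>_closed[OF d_closed[OF \<kappa>_closed]])

lemma \<kappa>_D: "v \<in> free (n i) \<Longrightarrow> \<kappa> (i - 1) (D i v) = d i (\<kappa> i v)"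
  unfolding D_def by (rule \<kappa>\<chi>[OF d_closed[OF \<kappa>_closed]])

lemma \<chi>_d: "x \<in> carrier (A i) \<Longrightarrow> \<chi> (i - 1) (d i x) = D i (\<chi> i x)"
  unfolding D_def by (simp add: \<kappa>\<chi>)

lemma \<kappa>_zero: "\<kappa> i \<zero>\<^sub>V = \<zero>\<^bsub>A i\<^esub>"
  by (rule submodule_map_zero[OF V.module_axioms A_module free_submodule \<kappa>_maps])

lemma D_zero_iff: "v \<in> free (n i) \<Longrightarrow> D i v = \<zero>\<^sub>V \<longleftrightarrow> d i (\<kappa> i v) = \<zero>\<^bsub>A (i - 1)\<^esub>"
  using \<kappa>_D[of v i] \<kappa>_zero[of "i - 1"] \<kappa>_inj[OF D_closed V.submodule_zero[OF free_submodule]] by metis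

lemma homology_vanishes_iff:
  "trivial_group (homology A d i) \<longleftrightarrow> {x \<in> carrier (A i). d i x = \<zero>\<^bsub>A (i - 1)\<^esub>} = d (i + 1) ` carrier (A (i + 1))"
  unfolding homology_def
  by (rule trivial_homology_iff[OF A_module A_module A_module _ d_linear dd]) (use d_linear[of "i + 1"] in simp)

lemma D_exact:
  assumes "acyclic_complex A d"
  shows "{v \<in> free (n i). D i v = \<zero>\<^sub>V} = D (i + 1) ` free (n (i + 1))"
proof -
  have ex: "{x \<in> carrier (A i). d i x = \<zero>\<^bsub>A (i - 1)\<^esub>} = d (i + 1) ` carrier (A (i + 1))"
    using assms homology_vanishes_iff[of i] by (simp add: acyclic_complex_def)
  show ?thesis
  proof (intro equalityI subsetI)
    fix v assume "v \<in> {v \<in> free (n i). D i v = \<zero>\<^sub>V}"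
    then have v: "v \<in> free (n i)" "d i (\<kappa> i v) = \<zero>\<^bsub>A (i - 1)\<^esub>" using D_zero_iff by blast+
    then obtain y where y: "y \<in> carrier (A (i + 1))" "\<kappa> i v = d (i + 1) y" using ex \<kappa>_closed by blast
    have "v = D (i + 1) (\<chi> (i + 1) y)" using \<chi>_d[OF y(1)] y(2) \<chi>\<kappa>[OF v(1)] by simp
    then show "v \<in> D (i + 1) ` free (n (i + 1))" using \<chi>_closed[OF y(1)] by blast
  next
    fix v assume "v \<in> D (i + 1) ` free (n (i + 1))"
    then obtain w where w: "w \<in> free (n (i + 1))" "v = D (i + 1) w" by blast
    have v: "v \<in> free (n i)" using D_closed[OF w(1)] w(2) by simp
    have "d i (\<kappa> i v) = \<zero>\<^bsub>A (i - 1)\<^esub>" using \<kappa>_D[OF w(1)] w(2) dd[OF \<kappa>_closed[OF w(1)]] by simp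
    then show "v \<in> {v \<in> free (n i). D i v = \<zero>\<^sub>V}" using v D_zero_iff by blast
  qed
qed

lemma D_minimal:
  assumes min: "minimal_complex R J A d" and J: "ideal J R" and v: "v \<in> free (n i)"
  shows "D i v \<in> vectors R J (n (i - 1))"
proof -
  let ?N = "\<kappa> (i - 1) ` vectors R J (n (i - 1))"
  have sub: "vectors R J (n (i - 1)) \<subseteq> free (n (i - 1))" by (rule vectors_sub_free[OF J])
  have N: "submodule ?N R (A (i - 1))"
    by (rule submodule_image[OF V.module_axioms A_module vectors_submodule[OF J] submodule_maps_mono[OF \<kappa>_maps sub]])
  have "a \<odot>\<^bsub>A (i - 1)\<^esub> x \<in> ?N" if a: "a \<in> J" and x: "x \<in> carrier (A (i - 1))" for a x
  proof -
    have ac: "a \<in> carrier R" using a J ideal.Icarr by metis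
    have "a \<odot>\<^sub>V \<chi> (i - 1) x \<in> vectors R J (n (i - 1))"
      using \<chi>_closed[OF x] a J by (auto simp: vectors_def sequence_module_simps ideal.I_r_closed ac)
    moreover have "a \<odot>\<^bsub>A (i - 1)\<^esub> x = \<kappa> (i - 1) (a \<odot>\<^sub>V \<chi> (i - 1) x)"
      using submodule_mapsD(3)[OF \<kappa>_maps ac \<chi>_closed[OF x]] \<kappa>\<chi>[OF x] by simp
    ultimately show ?thesis by blast
  qed
  then have "ideal_smult R J (A (i - 1)) \<subseteq> ?N" using N unfolding ideal_smult_def by blast
  moreover have "d i (\<kappa> i v) \<in> ideal_smult R J (A (i - 1))"
    using min \<kappa>_closed[OF v] unfolding minimal_complex_def by blast
  ultimately obtain w where w: "w \<in> vectors R J (n (i - 1))" "d i (\<kappa> i v) = \<kappa> (i - 1) w" by blast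
  then show ?thesis unfolding D_def using \<chi>\<kappa>[of w "i - 1"] sub by auto
qed

text \<open>Composition with \<open>\<kappa>\<close> and with its inverse \<open>\<chi>\<close> translates between functionals on \<open>A\<^sub>i\<close> and on
  \<open>R\<^sup>n\<close>; restriction to the carrier restores the default value that elements of the dual module have
  outside of it.\<close>

lemma vanishing_degree_iff:
  "i \<in> vanishing_degrees R A d \<longleftrightarrow>
    (\<forall>f\<in>functionals (free (n i)). (\<forall>w\<in>free (n (i + 1)). f (D (i + 1) w) = \<zero>) \<longrightarrow>
     (\<exists>g\<in>functionals (free (n (i - 1))). \<forall>v\<in>free (n i). f v = g (D i v)))" (is "_ \<longleftrightarrow> ?E")
proof -
  let ?A = "carrier (A i)"
  have mcl: "x \<oplus>\<^bsub>A k\<^esub> y \<in> carrier (A k)" "a \<in> carrier R \<Longrightarrow> a \<odot>\<^bsub>A k\<^esub> x \<in> carrier (A k)"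
    if "x \<in> carrier (A k)" "y \<in> carrier (A k)" for x y k a
  proof -
    interpret A: module R "A k" by (rule A_module)
    show "x \<oplus>\<^bsub>A k\<^esub> y \<in> carrier (A k)" "a \<in> carrier R \<Longrightarrow> a \<odot>\<^bsub>A k\<^esub> x \<in> carrier (A k)" using that by auto
  qed
  have dl: "dual_map (A k) (d k) \<in> linear_maps R (dual_module R (A (k - 1))) (dual_module R (A k))" for k
    by (rule dual_map_linear[OF d_linear]) (use mcl in auto)
  have d1: "dual_map (A (i + 1)) (d (i + 1)) \<in> linear_maps R (dual_module R (A i)) (dual_module R (A (i + 1)))"
    using dl[of "i + 1"] by simp
  have app: "dual_map (A k) (d k) \<phi> x = \<phi> (d k x)" if "x \<in> carrier (A k)" for k \<phi> x
    using that by (simp add: dual_map_def compose_def)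
  have zero_iff: "dual_map (A (i + 1)) (d (i + 1)) \<phi> = \<zero>\<^bsub>dual_module R (A (i + 1))\<^esub> \<longleftrightarrow>
      (\<forall>x\<in>carrier (A (i + 1)). \<phi> (d (i + 1) x) = \<zero>)" for \<phi>
    by (auto simp: dual_map_def compose_def restrict_def fun_eq_iff)
  have lin0: "\<phi> \<zero>\<^bsub>A k\<^esub> = \<zero>" if "\<phi> \<in> linear_maps R (A k) RR" for \<phi> k
    using submodule_map_zero[OF A_module RR.module_axioms module.carrier_is_submodule[OF A_module], of \<phi> k] that by simp
  have cc: "dual_map (A (i + 1)) (d (i + 1)) (dual_map (A i) (d i) \<phi>) = \<zero>\<^bsub>dual_module R (A (i + 1))\<^esub>"
    if "\<phi> \<in> carrier (dual_module R (A (i - 1)))" for \<phi>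
    unfolding zero_iff
  proof
    fix x assume x: "x \<in> carrier (A (i + 1))"
    have "d (i + 1) x \<in> ?A" using d_closed[OF x] by simp
    then have "dual_map (A i) (d i) \<phi> (d (i + 1) x) = \<phi> (d i (d (i + 1) x))" by (rule app)
    also have "\<dots> = \<zero>" unfolding dd[OF x] by (rule lin0) (use that in simp)
    finally show "dual_map (A i) (d i) \<phi> (d (i + 1) x) = \<zero>" .
  qed
  let ?K = "{\<phi> \<in> carrier (dual_module R (A i)). dual_map (A (i + 1)) (d (i + 1)) \<phi> = \<zero>\<^bsub>dual_module R (A (i + 1))\<^esub>}"
  let ?I = "dual_map (A i) (d i) ` carrier (dual_module R (A (i - 1)))"
  have "i \<in> vanishing_degrees R A d \<longleftrightarrow> ?K = ?I"
    unfolding vanishing_degrees_def dual_cohomology_def mem_Collect_eq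
    by (rule trivial_homology_iff[where f = "dual_map (A i) (d i)" and g = "dual_map (A (i + 1)) (d (i + 1))", OF dual_module_module[OF A_module] dual_module_module[OF A_module]
          dual_module_module[OF A_module] dl d1 cc])
  also have "\<dots> \<longleftrightarrow> ?K \<subseteq> ?I"
    using linear_mapsD(1)[OF dl[of i]] cc by blast
  also have "\<dots> \<longleftrightarrow> ?E"
  proof
    assume KI: "?K \<subseteq> ?I"
    show ?E
    proof (intro ballI impI)
      fix f assume f: "f \<in> functionals (free (n i))" "\<forall>w\<in>free (n (i + 1)). f (D (i + 1) w) = \<zero>"
      define \<phi> where "\<phi> = (\<lambda>x\<in>?A. f (\<chi> i x))"
      have "(\<lambda>x. f (\<chi> i x)) \<in> submodule_maps R (A i) ?A RR"
        by (rule maps_comp[OF _ f(1)]) (use \<chi>_maps \<chi>_closed in auto)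
      from submodule_mapsD[OF this]
      have \<phi>: "\<phi> \<in> carrier (dual_module R (A i))" unfolding \<phi>_def using mcl by (auto simp: linear_maps_def)
      have "\<phi> (d (i + 1) x) = \<zero>" if x: "x \<in> carrier (A (i + 1))" for x
      proof -
        have "\<chi> i (d (i + 1) x) = D (i + 1) (\<chi> (i + 1) x)" using \<chi>_d[OF x] by simp
        then show ?thesis using f(2) \<chi>_closed[OF x] d_closed[OF x] by (simp add: \<phi>_def)
      qed
      then have "\<phi> \<in> ?K" using \<phi> zero_iff by blast
      then obtain \<psi> where \<psi>: "\<psi> \<in> carrier (dual_module R (A (i - 1)))" "\<phi> = dual_map (A i) (d i) \<psi>"
        using KI by blast
      show "\<exists>g\<in>functionals (free (n (i - 1))). \<forall>v\<in>free (n i). f v = g (D i v)"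
      proof (intro bexI ballI)
        show "(\<lambda>v. \<psi> (\<kappa> (i - 1) v)) \<in> functionals (free (n (i - 1)))"
          by (rule maps_comp[OF \<kappa>_maps, where Q = "carrier (A (i - 1))"]) (use \<psi>(1) \<kappa>_closed in auto)
        fix v assume v: "v \<in> free (n i)"
        have "f v = \<phi> (\<kappa> i v)" using \<kappa>_closed[OF v] \<chi>\<kappa>[OF v] by (simp add: \<phi>_def)
        also have "\<dots> = \<psi> (d i (\<kappa> i v))" unfolding \<psi>(2) by (rule app[OF \<kappa>_closed[OF v]])
        finally show "f v = \<psi> (\<kappa> (i - 1) (D i v))" using \<kappa>_D[OF v] by simp
      qed
    qed
  next
    assume E: ?E
    show "?K \<subseteq> ?I"
    proof
      fix \<phi> assume "\<phi> \<in> ?K"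
      then have \<phi>: "\<phi> \<in> linear_maps R (A i) RR" "\<phi> \<in> extensional ?A"
        "\<And>x. x \<in> carrier (A (i + 1)) \<Longrightarrow> \<phi> (d (i + 1) x) = \<zero>" using zero_iff by auto
      have f: "(\<lambda>v. \<phi> (\<kappa> i v)) \<in> functionals (free (n i))"
        by (rule maps_comp[OF \<kappa>_maps, where Q = ?A]) (use \<phi>(1) \<kappa>_closed in auto)
      have "\<phi> (\<kappa> i (D (i + 1) w)) = \<zero>" if w: "w \<in> free (n (i + 1))" for w
        using \<kappa>_D[OF w] \<phi>(3)[OF \<kappa>_closed[OF w]] by simp
      then obtain g where g: "g \<in> functionals (free (n (i - 1)))" "\<And>v. v \<in> free (n i) \<Longrightarrow> \<phi> (\<kappa> i v) = g (D i v)"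
        using E[rule_format, OF f] by blast
      define \<psi> where "\<psi> = (\<lambda>x\<in>carrier (A (i - 1)). g (\<chi> (i - 1) x))"
      have "(\<lambda>x. g (\<chi> (i - 1) x)) \<in> submodule_maps R (A (i - 1)) (carrier (A (i - 1))) RR"
        by (rule maps_comp[OF _ g(1)]) (use \<chi>_maps \<chi>_closed in auto)
      from submodule_mapsD[OF this]
      have \<psi>: "\<psi> \<in> carrier (dual_module R (A (i - 1)))" unfolding \<psi>_def using mcl by (auto simp: linear_maps_def)
      have "\<phi> = dual_map (A i) (d i) \<psi>"
      proof (rule extensionalityI[OF \<phi>(2)])
        show "dual_map (A i) (d i) \<psi> \<in> extensional ?A" by (simp add: dual_map_def)
        fix x assume x: "x \<in> ?A"
        have "\<phi> x = g (D i (\<chi> i x))" using g(2)[OF \<chi>_closed[OF x]] \<kappa>\<chi>[OF x] by simp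
        also have "\<dots> = \<psi> (d i x)" using \<chi>_d[OF x] d_closed[OF x] by (simp add: \<psi>_def)
        also have "\<dots> = dual_map (A i) (d i) \<psi> x" by (rule app[OF x, symmetric])
        finally show "\<phi> x = dual_map (A i) (d i) \<psi> x" .
      qed
      then show "\<phi> \<in> ?I" using \<psi> by blast
    qed
  qed
  finally show ?thesis .
qed

end

section \<open>Equal ranks and total acyclicity\<close>

theorem theoremC:
  fixes R :: "('a, 'r) ring_scheme" and \<mm> :: "'a set"
    and A :: "int \<Rightarrow> ('a, 'b, 'm) module_scheme" and d :: "int \<Rightarrow> 'b \<Rightarrow> 'b"
    and H :: "int set"
  assumes "local_ring R \<mm>" and "noetherian_ring R"
    and "\<not> gorenstein_local_ring R \<mm>"
    and "\<mm> \<cdot>\<^bsub>R\<^esub> \<mm> \<cdot>\<^bsub>R\<^esub> \<mm> = {\<zero>\<^bsub>R\<^esub>}" and "\<mm> \<cdot>\<^bsub>R\<^esub> \<mm> \<noteq> {\<zero>\<^bsub>R\<^esub>}"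
    and "free_complex R A d" and "nonzero_complex A"
    and "minimal_complex R \<mm> A d" and "acyclic_complex A d"
  defines "H \<equiv> vanishing_degrees R A d"
  shows "(infinite {i \<in> H. i > 0} \<longrightarrow> (\<forall>i j. free_rank R (A i) = free_rank R (A j))) \<and>
    ((\<forall>i j. free_rank R (A i) = free_rank R (A j)) \<longrightarrow>
       (\<forall>l. l - 1 \<in> H \<and> l + 1 \<in> H \<longrightarrow> l \<in> H)) \<and>
    ((\<forall>i. card ({i, i + 1, i + 2} \<inter> H) \<ge> 2) \<longrightarrow> H = UNIV \<and> totally_acyclic R A d)"
proof -
  interpret R: cring R using assms(1) by (simp add: local_ring_def)
  interpret R: coordinate_ring R by unfold_locales
  define n where "n i = free_rank R (A i)" for i
  have "\<exists>\<kappa>. \<kappa> \<in> submodule_maps R (sequence_module R) (vectors R (carrier R) (n i)) (A i) \<and>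
      bij_betw \<kappa> (vectors R (carrier R) (n i)) (carrier (A i))" for i
  proof -
    have M: "module R (A i)" and "\<exists>B. finite_basis R (A i) B"
      using assms(6) by (auto simp: free_complex_def fg_free_def)
    then have B: "finite_basis R (A i) (SOME B. finite_basis R (A i) B)" by (metis someI_ex)
    show ?thesis using R.basis_coordinates[OF M B] unfolding n_def free_rank_def by metis
  qed
  then obtain \<kappa> where \<kappa>: "\<And>i. \<kappa> i \<in> submodule_maps R (sequence_module R) (vectors R (carrier R) (n i)) (A i)"
    "\<And>i. bij_betw (\<kappa> i) (vectors R (carrier R) (n i)) (carrier (A i))" by metis
  interpret C: coordinatized_complex R A d n \<kappa>
    by unfold_locales (use assms(6) \<kappa> in auto)
  interpret Q: cube_zero_ring R \<mm>
  proof (intro cube_zero_ring.intro cube_zero_ring_axioms.intro R.coordinate_ring_axioms)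
    show "maximalideal \<mm> R" using assms(1) by (simp add: local_ring_def)
  qed fact+
  interpret M: minimal_acyclic R \<mm> n C.D
  proof unfold_locales
    fix i v
    show "C.D i \<in> R.maps (R.free (n i))" by (rule C.D_maps)
    show "{v \<in> R.free (n i). C.D i v = \<zero>\<^bsub>sequence_module R\<^esub>} = C.D (i + 1) ` R.free (n (i + 1))"
      by (rule C.D_exact[OF assms(9)])
    show "C.D i v \<in> vectors R \<mm> (n (i - 1))" if "v \<in> R.free (n i)"
      by (rule C.D_minimal[OF assms(8) Q.m_ideal that])
  next
    obtain i where i: "carrier (A i) \<noteq> {\<zero>\<^bsub>A i\<^esub>}" using assms(7) by (auto simp: nonzero_complex_def)
    have "n i \<noteq> 0"
    proof
      assume "n i = 0"
      then have "carrier (A i) = \<kappa> i ` {\<zero>\<^bsub>sequence_module R\<^esub>}"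
        using \<kappa>(2)[of i] R.vectors_0 by (metis bij_betw_imp_surj_on)
      then show False using i C.\<kappa>_zero[of i] by (metis image_empty image_insert)
    qed
    then show "\<exists>i. n i \<noteq> 0" by blast
  next
    show "\<mm> \<cdot>\<^bsub>R\<^esub> \<mm> \<noteq> {\<zero>\<^bsub>R\<^esub>}" by fact
    fix s assume "s \<in> Q.socle"
    then show "\<exists>t\<in>Q.socle. \<forall>a\<in>carrier R. t \<noteq> a \<otimes>\<^bsub>R\<^esub> s"
      using Q.socle_not_principal[OF assms(1,3)] by blast
  qed
  have H: "i \<in> H \<longleftrightarrow> M.dual_exact i" for i
    unfolding H_def C.vanishing_degree_iff M.dual_exact_def M.Z_def by simp
  have i_ii: "n i = n j" if inf: "infinite {i \<in> H. i > 0}" for i j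
  proof (rule M.equal_ranks)
    fix k
    show "\<exists>i>k. M.dual_exact i"
    proof (rule ccontr)
      assume "\<not> ?thesis"
      then have "{i \<in> H. i > 0} \<subseteq> {0..k}" using H by (auto simp: not_less)
      then show False using inf finite_subset by blast
    qed
  qed
  have ii_iii: "l \<in> H" if "\<And>i j. n i = n j" "l - 1 \<in> H" "l + 1 \<in> H" for l
    using M.dual_exact_between[of l] that H by blast
  have all: "H = UNIV" if two: "\<And>i. card ({i, i + 1, i + 2} \<inter> H) \<ge> 2"
  proof -
    have "infinite {i \<in> H. i > 0}"
    proof
      assume fin: "finite {i \<in> H. i > 0}"
      \<comment> \<open>zero keeps the maximum defined if there is no positive degree to consider\<close>
      define k where "k = Max (insert 0 {i \<in> H. i > 0})"
      have le: "i \<le> k" if "i \<in> H" "i > 0" for i unfolding k_def using fin that by (intro Max_ge) auto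
      have "k \<ge> 0" unfolding k_def using fin by (intro Max_ge) auto
      then have "{k + 1, k + 1 + 1, k + 1 + 2} \<inter> H = {}" using le by force
      then show False using two[of "k + 1"] by simp
    qed
    then have ranks: "\<And>i j. n i = n j" by (rule i_ii)
    have "l \<in> H" for l
    proof (rule ccontr)
      assume l: "l \<notin> H"
      have "l - 1 \<in> H \<and> l + 1 \<in> H"
      proof (rule ccontr)
        assume "\<not> ?thesis"
        then have "{l - 1, l, l + 1} \<inter> H \<subseteq> {l - 1} \<or> {l - 1, l, l + 1} \<inter> H \<subseteq> {l + 1}"
          using l by auto
        then have "card ({l - 1, l, l + 1} \<inter> H) \<le> 1"
          using card_mono[of "{l - 1}"] card_mono[of "{l + 1}"] by fastforce
        moreover have eqs: "l - 1 + 1 = l" "l - 1 + 2 = l + 1" by simp_all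
        moreover have "2 \<le> card ({l - 1, l, l + 1} \<inter> H)" using two[of "l - 1"] unfolding eqs .
        ultimately show False by simp
      qed
      then show False using ii_iii[OF ranks] l by blast
    qed
    then show ?thesis by blast
  qed
  have tot: "totally_acyclic R A d" if "H = UNIV"
    using that assms(6,9) unfolding totally_acyclic_def H_def vanishing_degrees_def by blast
  show ?thesis
    unfolding n_def[symmetric]
  proof (intro conjI impI allI)
    show "n i = n j" if "infinite {i \<in> H. i > 0}" for i j by (rule i_ii[OF that])
    show "l \<in> H" if "\<forall>i j. n i = n j" "l - 1 \<in> H \<and> l + 1 \<in> H" for l
      using ii_iii[of l] that by blast
    assume "\<forall>i. card ({i, i + 1, i + 2} \<inter> H) \<ge> 2"
    then show "H = UNIV" using all by blast
    then show "totally_acyclic R A d" by (rule tot)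
  qed
qed

end
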